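(* Let $\Omega\subset\mathbb{C}$ be a bounded finitely connected domain with boundary $\Gamma=\partial\Omega$. Then $f(z)$ is the projection of $\overline{z}$ onto $A^{2}(\Omega)$ if and only if $$|z|^{2}=F(z)+\overline{F(z)}\quad\text{on }\Gamma,$$ where $F'(z)=f(z)$.
   Context: $A^{2}(\Omega)$ is the Bergman space of functions $f$ analytic in $\Omega$ with $\|f\|_{A^2(\Omega)}^2=\int_\Omega |f(z)|^2\,dA(z)<\infty$, where $dA$ is area measure; it is a closed subspace of $L^2(\Omega)=L^2(\Omega,dA)$. The projection of $\overline z$ onto $A^2(\Omega)$ is the orthogonal projection in $L^2(\Omega)$, i.e. the best approximation to $\overline z$ from $A^2(\Omega)$ in the $L^2(\Omega)$-norm. Although $F$ can be multivalued when $\Omega$ is multiply connected, $\operatorname{Re}F$ can be assumed to be single valued, since $2\operatorname{Re}F=F+\overline F$ is a solution to the Dirichlet problem in $\Omega$ with data $|z|^2$ on $\Gamma$ (a harmonic function in $\Omega$ with boundary values $|z|^2$ on $\Gamma$).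
   Formalization: The formal theorem also assumes that no component of the complement of Ω is a single point; without this the claim fails, e.g. for the punctured disc, where the projection is f = 0 but |z|² is not constant on Γ. *)

theory Defs
  imports "HOL-Complex_Analysis.Complex_Analysis"
begin

text \<open>
  A domain is a nonempty open connected set. Connectivity is counted by the components of the
  complement in the plane; for bounded \<open>\<Omega>\<close> these correspond one-to-one to the components of the
  complement in the Riemann sphere, since exactly one of them is unbounded.
  Singleton components are allowed here. They have to be excluded separately where the Dirichlet
  problem must be solvable: on the punctured disc the data \<open>|z|\<^sup>2\<close> are attained by no harmonic function.
\<close>

definition bounded_finitely_connected_domain :: "complex set \<Rightarrow> bool" where
  "bounded_finitely_connected_domain \<Omega> \<longleftrightarrow>
     open \<Omega> \<and> connected \<Omega> \<and> \<Omega> \<noteq> {} \<and> bounded \<Omega> \<and> finite (components (- \<Omega>))"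

text \<open>
  Functions on \<open>\<Omega>\<close> are represented by total functions on the plane, whose values outside \<open>\<Omega>\<close>
  are irrelevant. On the plane, \<^const>\<open>lborel\<close> is area measure.
\<close>

definition L2_on :: "complex set \<Rightarrow> (complex \<Rightarrow> complex) set" where
  "L2_on \<Omega> = {f. set_borel_measurable lborel \<Omega> f \<and>
                 set_integrable lborel \<Omega> (\<lambda>z. (cmod (f z))\<^sup>2)}"

definition L2_inner :: "complex set \<Rightarrow> (complex \<Rightarrow> complex) \<Rightarrow> (complex \<Rightarrow> complex) \<Rightarrow> complex" where
  "L2_inner \<Omega> f g = (LINT z:\<Omega>|lborel. f z * cnj (g z))"

definition bergman_space :: "complex set \<Rightarrow> (complex \<Rightarrow> complex) set" where
  "bergman_space \<Omega> = {f \<in> L2_on \<Omega>. f holomorphic_on \<Omega>}"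

definition is_L2_projection ::
  "complex set \<Rightarrow> (complex \<Rightarrow> complex) set \<Rightarrow> (complex \<Rightarrow> complex) \<Rightarrow> (complex \<Rightarrow> complex) \<Rightarrow> bool"
where
  "is_L2_projection \<Omega> V \<phi> p \<longleftrightarrow>
     \<phi> \<in> L2_on \<Omega> \<and> p \<in> V \<and> (\<forall>g\<in>V. L2_inner \<Omega> (\<lambda>z. \<phi> z - p z) g = 0)"

text \<open>
  A primitive \<open>F\<close> of \<open>f\<close> may be multivalued, so it is given by local branches \<open>F\<close> with \<open>F' = f\<close>;
  the function \<open>h\<close> is the single-valued \<open>F + cnj F = 2 Re F\<close> on all of \<open>\<Omega>\<close>. Different local
  branches may differ by imaginary constants only, so \<open>F\<close> has purely imaginary periods.
\<close>

definition primitive_plus_conjugate ::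
  "complex set \<Rightarrow> (complex \<Rightarrow> complex) \<Rightarrow> (complex \<Rightarrow> real) \<Rightarrow> bool"
where
  "primitive_plus_conjugate \<Omega> f h \<longleftrightarrow>
     (\<forall>z\<in>\<Omega>. \<exists>r>0. \<exists>F. ball z r \<subseteq> \<Omega> \<and>
        (\<forall>w\<in>ball z r. (F has_field_derivative f w) (at w) \<and>
                       complex_of_real (h w) = F w + cnj (F w)))"

text \<open>Boundary values are limits from inside \<open>\<Omega>\<close> at every point of the boundary.\<close>

definition has_boundary_values ::
  "complex set \<Rightarrow> (complex \<Rightarrow> real) \<Rightarrow> (complex \<Rightarrow> real) \<Rightarrow> bool"
where
  "has_boundary_values \<Omega> h \<phi> \<longleftrightarrow> (\<forall>\<zeta>\<in>frontier \<Omega>. (h \<longlongrightarrow> \<phi> \<zeta>) (at \<zeta> within \<Omega>))"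

end

theory Submission
  imports Defs
begin

text \<open>
  Write \<open>\<phi> z = cnj z - f z\<close>, and let the derivative \<open>\<partial>/\<partial>z\<close> be taken in the sense of Wirtinger.

  If \<open>h = F + cnj F\<close> has the boundary values \<open>|z|\<^sup>2\<close>, then \<open>u = |z|\<^sup>2 - h\<close> satisfies \<open>\<partial>u = \<phi>\<close>, is negative by the
  maximum principle and tends to \<open>0\<close> at the boundary. Testing with \<open>C\<^sup>1\<close> truncations of \<open>u\<close>, which have
  compact support, gives first \<open>\<phi> \<in> L\<^sup>2\<close> and then \<open>\<integral> \<phi> cnj g = \<integral> \<partial>(u cnj g) = 0\<close> for \<open>g\<close> in the Bergman space.

  Conversely, let \<open>\<phi>\<close> be orthogonal to the Bergman space. Up to a constant factor, the Cauchy potential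
  \<open>u w = \<integral> \<phi> z / cnj (w - z)\<close> solves \<open>\<partial>u = \<phi>\<close>, so locally \<open>|w|\<^sup>2 - u w = F w + cnj (G w)\<close> with \<open>F' = f\<close> and
  \<open>G\<close> holomorphic. By orthogonality, every \<open>g\<close> in the Bergman space may be subtracted from the kernel
  \<open>1 / (w - z)\<close>. Let \<open>a\<close> be a point of the complement nearest to \<open>w\<close>, and \<open>b\<close> a point of its component in the
  complement at a distance bounded below. Then \<open>(z - a) / (z - b)\<close> has a holomorphic square root \<open>s\<close>,
  because winding numbers are constant on the component, and \<open>g z = - s z / ((z - a) (s z + s w))\<close> is so
  close to the kernel that the difference is bounded in \<open>L\<^sup>2\<close> and concentrates at the boundary point as \<open>w\<close> tends
  to it. Hence \<open>u\<close> tends to \<open>0\<close> at the boundary, and by the maximum principle \<open>|w|\<^sup>2 - u w\<close> is real.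
\<close>

section \<open>Wirtinger derivatives and the divergence theorem\<close>

text \<open>The boundary is only a topological frontier, so Green's formula with boundary terms is
  not at hand: every integration by parts uses a compactly supported function, obtained from the
  compactness of the sets where u stays away from 0. The kernel 1 / cnj y is not square integrable
  at 0 and cannot be compared in L^2 with Bergman functions; the potential is therefore formed with
  bounded C^1 kernels of radius \<delta>, and a moment is subtracted to remove the dependence on
  \<delta>. The constant factor is the common mass of the bumps, whose value \<pi> never has to be
  computed. The square root answers the same borderline: a simple pole at a boundary point need not
  be square integrable, whereas with the factor s it has size |z - a|^(-1/2) near a. Far from a the
  error decays like |z - a|^(-3/2), so its square is integrable over the plane, with a bound that
  does not depend on the distance from w to the boundary. The point b exists because no component of
  the complement is a single point, and having finitely many components makes its distance from a
  uniform.\<close>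

definition wirtinger :: "(complex \<Rightarrow> complex) \<Rightarrow> complex \<Rightarrow> complex \<Rightarrow> complex \<Rightarrow> bool" where
  "wirtinger X a b z \<longleftrightarrow> (X has_derivative (\<lambda>h. a * h + b * cnj h)) (at z)"

lemma wirtinger_const: "wirtinger (\<lambda>z. c) 0 0 z"
  by (simp add: wirtinger_def)

lemma wirtinger_DERIV: "(X has_field_derivative a) (at z) \<Longrightarrow> wirtinger X a 0 z"
  by (simp add: wirtinger_def has_field_derivative_def)

lemma wirtinger_imp_DERIV: "wirtinger X a 0 z \<Longrightarrow> (X has_field_derivative a) (at z)"
  by (simp add: wirtinger_def has_field_derivative_def)

lemma wirtinger_cnj: "wirtinger X a b z \<Longrightarrow> wirtinger (\<lambda>z. cnj (X z)) (cnj b) (cnj a) z"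
  unfolding wirtinger_def
  by (rule has_derivative_eq_rhs, rule bounded_linear.has_derivative[OF bounded_linear_cnj])
     (auto simp: algebra_simps)

lemma wirtinger_cnj_ident: "wirtinger cnj 0 1 z"
  using wirtinger_cnj[OF wirtinger_DERIV[OF DERIV_ident], of z] by simp

lemma wirtinger_add:
  "wirtinger X a b z \<Longrightarrow> wirtinger Y c d z \<Longrightarrow> wirtinger (\<lambda>z. X z + Y z) (a + c) (b + d) z"
  unfolding wirtinger_def
  by (rule has_derivative_eq_rhs, erule (1) has_derivative_add) (simp add: fun_eq_iff algebra_simps)

lemma wirtinger_diff:
  "wirtinger X a b z \<Longrightarrow> wirtinger Y c d z \<Longrightarrow> wirtinger (\<lambda>z. X z - Y z) (a - c) (b - d) z"
  unfolding wirtinger_def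
  by (rule has_derivative_eq_rhs, erule (1) has_derivative_diff) (simp add: fun_eq_iff algebra_simps)

lemma wirtinger_mult:
  "wirtinger X a b z \<Longrightarrow> wirtinger Y c d z \<Longrightarrow>
   wirtinger (\<lambda>z. X z * Y z) (a * Y z + X z * c) (b * Y z + X z * d) z"
  unfolding wirtinger_def
  by (rule has_derivative_eq_rhs, erule (1) has_derivative_mult) (simp add: fun_eq_iff algebra_simps)

lemma wirtinger_reflect:
  "wirtinger X a b (w - z) \<Longrightarrow> wirtinger (\<lambda>z. X (w - z)) (- a) (- b) z"
  unfolding wirtinger_def
  by (rule has_derivative_eq_rhs,
      rule has_derivative_compose[of "\<lambda>z. w - z" "\<lambda>h. - h" z UNIV X])
     (auto intro!: derivative_eq_intros)

lemma wirtinger_translate: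
  "wirtinger X a b (z - w) \<Longrightarrow> wirtinger (\<lambda>z. X (z - w)) a b z"
  unfolding wirtinger_def
  by (rule has_derivative_eq_rhs,
      rule has_derivative_compose[of "\<lambda>z. z - w" "\<lambda>h. h" z UNIV X])
     (auto intro!: derivative_eq_intros)

lemma wirtinger_real_compose:
  assumes "wirtinger (\<lambda>z. of_real (r z)) a b z" and p: "(p has_real_derivative p') (at (r z))"
  shows "wirtinger (\<lambda>z. of_real (p (r z))) (of_real p' * a) (of_real p' * b) z"
proof -
  let ?D = "\<lambda>h. a * h + b * cnj h"
  have X: "((\<lambda>z. complex_of_real (r z)) has_derivative ?D) (at z)"
    using assms(1) by (simp add: wirtinger_def)
  have r: "(r has_derivative (\<lambda>h. Re (?D h))) (at z)"
    using bounded_linear.has_derivative[OF bounded_linear_Re X] by simp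
  have "((\<lambda>z. complex_of_real (r z)) has_derivative (\<lambda>h. of_real (Re (?D h)))) (at z)"
    by (rule bounded_linear.has_derivative[OF bounded_linear_of_real r])
  \<comment> \<open>The function is real valued, so by uniqueness its derivative equals its own real
    part; this stands in for a relation between a and b.\<close>
  then have eq: "?D = (\<lambda>h. of_real (Re (?D h)))"
    using X has_derivative_unique by blast
  have p': "(p has_derivative (\<lambda>h. h * p')) (at (r z))"
    using p unfolding has_field_derivative_def by (rule has_derivative_eq_rhs) (simp add: fun_eq_iff)
  have "((\<lambda>z. p (r z)) has_derivative (\<lambda>h. Re (?D h) * p')) (at z)"
    by (rule has_derivative_compose[OF r, THEN has_derivative_eq_rhs])
       (use p' in auto)
  then have "((\<lambda>z. complex_of_real (p (r z))) has_derivative (\<lambda>h. of_real (Re (?D h) * p'))) (at z)"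
    by (rule bounded_linear.has_derivative[OF bounded_linear_of_real])
  moreover have "complex_of_real (Re (?D h) * p') = of_real p' * a * h + of_real p' * b * cnj h" for h
    unfolding of_real_mult fun_cong[OF eq, of h, symmetric] by (simp only: algebra_simps)
  ultimately show ?thesis
    by (simp add: wirtinger_def)
qed

lemma wirtinger_norm_sq: "wirtinger (\<lambda>z. of_real ((cmod z)\<^sup>2)) (cnj z) z z"
  using wirtinger_mult[OF wirtinger_DERIV[OF DERIV_ident] wirtinger_cnj_ident, of z]
  by (simp add: complex_norm_square wirtinger_def del: of_real_power)

lemma wirtinger_transform_open:
  assumes "wirtinger X a b z" "open S" "z \<in> S" "\<And>x. x \<in> S \<Longrightarrow> X x = Y x"
  shows "wirtinger Y a b z"
  using assms has_derivative_transform_within_open unfolding wirtinger_def by blast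

lemma wirtinger_const_unique:
  assumes "wirtinger (\<lambda>z. c) a b z"
  shows "a = 0" "b = 0"
proof -
  have eq: "(\<lambda>h. a * h + b * cnj h) = (\<lambda>h. 0)"
    using assms unfolding wirtinger_def by (rule has_derivative_unique) simp
  have "a + b = 0" "(a - b) * \<i> = 0"
    using fun_cong[OF eq, of 1] fun_cong[OF eq, of \<i>] by (simp_all add: ring_distribs)
  then show "a = 0" "b = 0" by auto
qed

lemma wirtinger_continuous: "wirtinger X a b z \<Longrightarrow> isCont X z"
  using has_derivative_continuous wirtinger_def by blast

text \<open>All C^1 gluings below, of the kernel profile, of its radial antiderivative and of the
  truncations, are reduced to this one kink.\<close>

lemma DERIV_max_sq: "((\<lambda>x. (max 0 x)\<^sup>2) has_real_derivative 2 * max 0 x) (at (x::real))"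
proof -
  consider "x > 0" | "x < 0" | "x = 0" by linarith
  then show ?thesis
  proof cases
    case 1
    have "((\<lambda>x. x\<^sup>2) has_real_derivative 2 * max 0 x) (at x)"
      using 1 by (auto intro!: derivative_eq_intros)
    then show ?thesis
      by (rule has_field_derivative_transform_within_open[of _ _ _ "{0<..}"]) (use 1 in auto)
  next
    case 2
    have "((\<lambda>x. 0) has_real_derivative 2 * max 0 x) (at x)"
      using 2 by (auto intro!: derivative_eq_intros)
    then show ?thesis
      by (rule has_field_derivative_transform_within_open[of _ _ _ "{..<0}"]) (use 2 in auto)
  next
    case 3
    have "((\<lambda>h::real. (max 0 h)\<^sup>2 / h) \<longlongrightarrow> 0) (at 0)"
    proof (rule Lim_null_comparison)
      show "\<forall>\<^sub>F h in at 0. norm ((max 0 h)\<^sup>2 / h) \<le> \<bar>h::real\<bar>"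
        by (rule eventuallyI) (auto simp: max_def power2_eq_square)
      show "((\<lambda>h::real. \<bar>h\<bar>) \<longlongrightarrow> 0) (at 0)"
        by (rule tendsto_rabs_zero) simp
    qed
    then show ?thesis
      using 3 by (simp add: DERIV_def)
  qed
qed

lemma wirtinger_lipschitz:
  assumes "\<And>y. wirtinger X (a y) (b y) y" "\<And>y. cmod (a y) \<le> L" "\<And>y. cmod (b y) \<le> L"
  shows "cmod (X x - X y) \<le> 2 * L * cmod (x - y)"
proof (rule differentiable_bound[of UNIV])
  show "(X has_derivative (\<lambda>h. a y * h + b y * cnj h)) (at y within UNIV)" for y
    using assms(1) by (simp add: wirtinger_def)
  show "onorm (\<lambda>h. a y * h + b y * cnj h) \<le> 2 * L" for y
  proof (rule onorm_le)
    fix h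
    have "cmod (a y * h + b y * cnj h) \<le> cmod (a y) * cmod h + cmod (b y) * cmod h"
      using norm_triangle_ineq[of "a y * h" "b y * cnj h"] by (simp add: norm_mult)
    also have "\<dots> \<le> L * cmod h + L * cmod h"
      by (intro add_mono mult_right_mono assms) auto
    finally show "cmod (a y * h + b y * cnj h) \<le> 2 * L * cmod h"
      by simp
  qed
qed auto

text \<open>The regularity comes from the kernel alone, so integrability of \<open>\<phi>\<close>
  suffices: the error of the difference quotient of \<open>X\<close> tends to 0 pointwise, is
  bounded by the Lipschitz estimate, and dominated convergence applies with a multiple of
  |\<open>\<phi>\<close>|.\<close>

lemma wirtinger_convolution:
  fixes \<phi> :: "complex \<Rightarrow> complex"
  assumes \<phi>: "integrable lborel \<phi>"
    and X: "\<And>y. wirtinger X (a y) (b y) y"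
    and a: "a \<in> borel_measurable borel" "\<And>y. cmod (a y) \<le> L"
    and b: "b \<in> borel_measurable borel" "\<And>y. cmod (b y) \<le> L"
    and M: "\<And>y. cmod (X y) \<le> M"
  shows "wirtinger (\<lambda>w. LINT z|lborel. \<phi> z * X (w - z))
           (LINT z|lborel. \<phi> z * a (w - z)) (LINT z|lborel. \<phi> z * b (w - z)) w"
proof -
  have mX: "X \<in> borel_measurable borel"
    by (intro borel_measurable_continuous_onI continuous_at_imp_continuous_on)
       (use X wirtinger_continuous in blast)
  have [measurable]: "(\<lambda>z. w - z) \<in> borel_measurable borel" for w :: complex
    by simp
  have ms: "(\<lambda>z. G (w - z)) \<in> borel_measurable lborel" if "G \<in> borel_measurable borel"
    for G :: "complex \<Rightarrow> complex" and w
    using that by measurable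
  have m\<phi>: "\<phi> \<in> borel_measurable lborel"
    using \<phi> by auto
  have int: "integrable lborel (\<lambda>z. \<phi> z * G (w - z))"
    if "G \<in> borel_measurable borel" "\<And>y. cmod (G y) \<le> K" for G w K
  proof (rule Bochner_Integration.integrable_bound)
    show "integrable lborel (\<lambda>z. K * cmod (\<phi> z))"
      using \<phi> by auto
    show "(\<lambda>z. \<phi> z * G (w - z)) \<in> borel_measurable lborel"
      by (intro borel_measurable_times m\<phi> ms that)
    have "cmod (\<phi> z) * cmod (G (w - z)) \<le> \<bar>K\<bar> * cmod (\<phi> z)" for z
      using that(2)[of "w - z"] mult_left_mono[of "cmod (G (w - z))" "\<bar>K\<bar>" "cmod (\<phi> z)"]
      by (simp add: mult.commute)
    then show "AE z in lborel. cmod (\<phi> z * G (w - z)) \<le> norm (K * cmod (\<phi> z))"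
      by (simp add: norm_mult abs_mult)
  qed
  let ?A = "LINT z|lborel. \<phi> z * a (w - z)" and ?B = "LINT z|lborel. \<phi> z * b (w - z)"
  let ?U = "\<lambda>w. LINT z|lborel. \<phi> z * X (w - z)"
  \<comment> \<open>The scaled first-order error of \<open>X\<close>. Its bound 4 L adds 2 L from
    the Lipschitz estimate and 2 L from the linear part; at h = 0 division by zero makes it
    0.\<close>
  define E where "E = (\<lambda>h y. (X (y + h) - X y - (a y * h + b y * cnj h)) / of_real (cmod h))"
  have EL: "cmod (E h y) \<le> 4 * L" for h y
  proof (cases "h = 0")
    case True
    then show ?thesis
      using order_trans[OF norm_ge_zero a(2)[of 0]] by (simp add: E_def)
  next
    case False
    have "cmod (X (y + h) - X y - (a y * h + b y * cnj h))
        \<le> cmod (X (y + h) - X y) + (cmod (a y * h) + cmod (b y * cnj h))"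
      by (meson norm_triangle_ineq norm_triangle_ineq4 add_left_mono order_trans)
    also have "\<dots> \<le> 2 * L * cmod h + (L * cmod h + L * cmod h)"
      using wirtinger_lipschitz[OF X a(2) b(2), of "y + h" y]
      by (intro add_mono) (auto simp: norm_mult intro!: mult_right_mono a b)
    finally show ?thesis
      using False by (simp add: E_def norm_divide field_simps)
  qed
  have mE: "E h \<in> borel_measurable borel" for h
  proof -
    have "(\<lambda>y. X (y + h)) \<in> borel_measurable borel"
      using mX by measurable
    then show ?thesis
      unfolding E_def using mX a(1) b(1) by measurable
  qed
  have E0: "(\<lambda>h. E h y) \<midarrow>0\<rightarrow> 0" for y
  proof -
    have "(\<lambda>h. norm (X (y + h) - X y - (a y * h + b y * cnj h)) / norm h) \<midarrow>0\<rightarrow> 0"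
      using X[of y] unfolding wirtinger_def has_derivative_at by blast
    then show ?thesis
      by (subst tendsto_norm_zero_iff[symmetric]) (simp add: E_def norm_divide)
  qed
  have quot: "(?U (w + h) - ?U w - (?A * h + ?B * cnj h)) / of_real (cmod h)
      = (LINT z|lborel. \<phi> z * E h (w - z))" for h
  proof -
    have lin: "?U (w + h) - ?U w - (?A * h + ?B * cnj h)
       = (LINT z|lborel. \<phi> z * X (w + h - z) - \<phi> z * X (w - z)
            - (\<phi> z * a (w - z) * h + \<phi> z * b (w - z) * cnj h))"
      using int[OF mX M] int[OF a] int[OF b] by simp
    have "(?U (w + h) - ?U w - (?A * h + ?B * cnj h)) / of_real (cmod h) = (LINT z|lborel. (\<phi> z * X (w + h - z) - \<phi> z * X (w - z)
            - (\<phi> z * a (w - z) * h + \<phi> z * b (w - z) * cnj h)) / of_real (cmod h))"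
      unfolding lin by simp
    also have "\<dots> = (LINT z|lborel. \<phi> z * E h (w - z))"
      by (intro Bochner_Integration.integral_cong refl)
         (simp only: E_def times_divide_eq_right right_diff_distrib distrib_left mult.assoc
           add_diff_eq diff_add_eq)
    finally show ?thesis .
  qed
  have "(\<lambda>h. LINT z|lborel. \<phi> z * E h (w - z)) \<midarrow>0\<rightarrow> 0"
    unfolding tendsto_at_iff_sequentially
  proof safe
    fix h :: "nat \<Rightarrow> complex"
    assume h: "\<forall>i. h i \<in> UNIV - {0}" "h \<longlonglongrightarrow> 0"
    have "(\<lambda>i. LINT z|lborel. \<phi> z * E (h i) (w - z)) \<longlonglongrightarrow> integral\<^sup>L lborel (\<lambda>z::complex. 0::complex)"
    proof (rule integral_dominated_convergence)
      show "integrable lborel (\<lambda>z. 4 * L * cmod (\<phi> z))"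
        using \<phi> by auto
      show "(\<lambda>z. \<phi> z * E (h i) (w - z)) \<in> borel_measurable lborel" for i
        by (intro borel_measurable_times m\<phi> ms mE)
      have "(\<lambda>i. \<phi> z * E (h i) (w - z)) \<longlonglongrightarrow> \<phi> z * 0" for z
        using E0[of "w - z"] h unfolding tendsto_at_iff_sequentially comp_def
        by (intro tendsto_mult_left) auto
      then show "AE z in lborel. (\<lambda>i. \<phi> z * E (h i) (w - z)) \<longlonglongrightarrow> 0"
        by simp
      have "cmod (\<phi> z) * cmod (E (h i) (w - z)) \<le> 4 * L * cmod (\<phi> z)" for i z
        using mult_left_mono[OF EL[of "h i" "w - z"], of "cmod (\<phi> z)"] by (simp add: mult.commute)
      then show "AE z in lborel. cmod (\<phi> z * E (h i) (w - z)) \<le> 4 * L * cmod (\<phi> z)" for i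
        by (simp add: norm_mult)
    qed auto
    then show "((\<lambda>h. LINT z|lborel. \<phi> z * E h (w - z)) \<circ> h) \<longlonglongrightarrow> 0"
      by (simp add: comp_def)
  qed
  then have "(\<lambda>h. norm ((?U (w + h) - ?U w - (?A * h + ?B * cnj h)) / of_real (cmod h))) \<midarrow>0\<rightarrow> 0"
    unfolding quot by (rule tendsto_norm_zero)
  then show ?thesis
    unfolding wirtinger_def has_derivative_at
    using bounded_linear_add[OF bounded_linear_mult_right
        bounded_linear_compose[OF bounded_linear_mult_right bounded_linear_cnj], of ?A ?B]
    by (simp add: norm_divide)
qed

lemma integral_lborel_reflect:
  fixes g :: "'a::euclidean_space \<Rightarrow> 'b::{banach, second_countable_topology}"
  assumes "g \<in> borel_measurable borel"
  shows "(LINT z|lborel. g (w - z)) = (LINT z|lborel. g z)"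
proof -
  have "lborel = distr lborel borel (\<lambda>x::'a. w - x)"
    using lborel_affine[of "-1" w] by (simp add: density_1)
  then have "(LINT z|lborel. g z) = (LINT z|distr lborel borel (\<lambda>x::'a. w - x). g z)"
    by simp
  also have "\<dots> = (LINT z|lborel. g (w - z))"
    using assms by (intro integral_distr) auto
  finally show ?thesis by simp
qed

lemma integral_lborel_translate:
  fixes g :: "'a::euclidean_space \<Rightarrow> 'b::{banach, second_countable_topology}"
  assumes [measurable]: "g \<in> borel_measurable borel"
  shows "(LINT z|lborel. g (z - w)) = (LINT z|lborel. g z)"
proof -
  have "(LINT z|lborel. g (- (w - z))) = (LINT z|lborel. g (- z))"
    by (rule integral_lborel_reflect) simp
  also have "\<dots> = (LINT z|lborel. g z)"
    using integral_lborel_reflect[OF assms, of 0] by simp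
  finally show ?thesis by simp
qed

text \<open>Translation invariance makes the convolution of \<open>X\<close> with the indicator of a large ball
  locally constant, so its derivative vanishes.\<close>

lemma divergence_theorem:
  assumes X: "\<And>z. wirtinger X (a z) (b z) z"
    and a: "continuous_on UNIV a" and b: "continuous_on UNIV b"
    and K: "compact K" "\<And>z. z \<notin> K \<Longrightarrow> X z = 0"
  shows "(LINT z|lborel. a z) = 0" "(LINT z|lborel. b z) = 0"
proof -
  have ab0: "a z = 0 \<and> b z = 0" if "z \<notin> K" for z
  proof -
    have "wirtinger (\<lambda>z. 0) (a z) (b z) z"
      by (rule wirtinger_transform_open[OF X, of "- K"]) (use K that compact_imp_closed in auto)
    then show ?thesis
      using wirtinger_const_unique by blast
  qed
  have bd: "\<exists>L. \<forall>z. cmod (Y z) \<le> L" if "continuous_on UNIV Y" "\<And>z. z \<notin> K \<Longrightarrow> Y z = 0"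
    for Y :: "complex \<Rightarrow> complex"
  proof -
    have "bounded (Y ` K)"
      using K(1) that(1) continuous_on_subset compact_continuous_image compact_imp_bounded by blast
    then obtain L where "\<And>z. z \<in> K \<Longrightarrow> cmod (Y z) \<le> L"
      by (auto simp: bounded_iff)
    then have "\<forall>z. cmod (Y z) \<le> max L 0"
      using that(2) by (metis max.cobounded1 max.cobounded2 norm_zero order_trans)
    then show ?thesis ..
  qed
  have cX: "continuous_on UNIV X"
    by (intro continuous_at_imp_continuous_on) (use X wirtinger_continuous in blast)
  obtain L1 where L1: "\<And>z. cmod (a z) \<le> L1"
    using bd[OF a] ab0 by metis
  obtain L2 where L2: "\<And>z. cmod (b z) \<le> L2"
    using bd[OF b] ab0 by metis
  obtain M where M: "\<And>z. cmod (X z) \<le> M"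
    using bd[OF cX K(2)] by metis
  define L where "L = max L1 L2"
  have L: "cmod (a z) \<le> L" "cmod (b z) \<le> L" for z
    using L1[of z] L2[of z] by (auto simp: L_def)
  have m: "a \<in> borel_measurable borel" "b \<in> borel_measurable borel" "X \<in> borel_measurable borel"
    using a b cX by (auto intro: borel_measurable_continuous_onI)
  obtain R where R: "\<And>z. z \<in> K \<Longrightarrow> cmod z \<le> R"
    using compact_imp_bounded[OF K(1)] by (auto simp: bounded_iff)
  \<comment> \<open>The margin 1 leaves room for w in the unit disc: if w - z lies in K then |z| < R
    + 1, so the indicator cuts nothing off.\<close>
  define \<phi> where "\<phi> = (\<lambda>z::complex. indicator (cball 0 (R + 1)) z :: complex)"
  have \<phi>: "integrable lborel \<phi>"
    unfolding \<phi>_def using integrable_indicator[of "cball 0 (R + 1)" lborel "1::complex"]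
      emeasure_lborel_cball_finite[of "0::complex" "R + 1"]
    by (simp add: scaleR_conv_of_real of_real_indicator)
  have red: "(LINT z|lborel. \<phi> z * Y (w - z)) = (LINT z|lborel. Y z)"
    if "Y \<in> borel_measurable borel" "\<And>z. z \<notin> K \<Longrightarrow> Y z = 0" "cmod w < 1" for w Y
  proof -
    have "\<phi> z * Y (w - z) = Y (w - z)" for z
    proof (cases "w - z \<in> K")
      case True
      have "cmod z \<le> cmod (w - z) + cmod w"
        by (metis norm_minus_commute norm_triangle_sub add.commute)
      then show ?thesis
        using R[OF True] that(3) by (simp add: \<phi>_def)
    qed (simp add: that)
    then have "(\<lambda>z. \<phi> z * Y (w - z)) = (\<lambda>z. Y (w - z))"
      by (rule ext)
    then show ?thesis
      using integral_lborel_reflect[OF that(1)] by simp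
  qed
  have "wirtinger (\<lambda>w. LINT z|lborel. \<phi> z * X (w - z))
           (LINT z|lborel. \<phi> z * a (0 - z)) (LINT z|lborel. \<phi> z * b (0 - z)) 0"
    by (rule wirtinger_convolution[OF \<phi> X m(1) L(1) m(2) L(2) M])
  then have "wirtinger (\<lambda>w. LINT z|lborel. X z)
      (LINT z|lborel. \<phi> z * a (0 - z)) (LINT z|lborel. \<phi> z * b (0 - z)) 0"
    by (rule wirtinger_transform_open[of _ _ _ 0 "ball 0 1"]) (auto intro!: red m K(2))
  note 0 = wirtinger_const_unique[OF this]
  have 1: "(LINT z|lborel. \<phi> z * a (0 - z)) = (LINT z|lborel. a z)"
    by (rule red) (use m ab0 in auto)
  have 2: "(LINT z|lborel. \<phi> z * b (0 - z)) = (LINT z|lborel. b z)"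
    by (rule red) (use m ab0 in auto)
  show "(LINT z|lborel. a z) = 0"
    by (rule trans[OF 1[symmetric] 0(1)])
  show "(LINT z|lborel. b z) = 0"
    by (rule trans[OF 2[symmetric] 0(2)])
qed

text \<open>Extension by zero is differentiable on the whole plane, because \<Omega> and the
  complement of K are open and cover it; the coefficients vanish off K together with X, hence extend
  continuously.\<close>

lemma divergence_theorem_on:
  assumes \<Omega>: "open \<Omega>" and X: "\<And>z. z \<in> \<Omega> \<Longrightarrow> wirtinger X (a z) (b z) z"
    and a: "continuous_on \<Omega> a" and b: "continuous_on \<Omega> b"
    and K: "compact K" "K \<subseteq> \<Omega>" "\<And>z. z \<in> \<Omega> - K \<Longrightarrow> X z = 0"
  shows "(LINT z:\<Omega>|lborel. a z) = 0 \<and> (LINT z:\<Omega>|lborel. b z) = 0"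
proof -
  have ab0: "a z = 0 \<and> b z = 0" if "z \<in> \<Omega> - K" for z
  proof -
    have "wirtinger (\<lambda>z. 0) (a z) (b z) z"
    proof (rule wirtinger_transform_open)
      show "wirtinger X (a z) (b z) z" "z \<in> \<Omega> - K"
        using X that by auto
      show "open (\<Omega> - K)"
        using \<Omega> K(1) by (simp add: open_Diff compact_imp_closed)
    qed (rule K(3))
    then show ?thesis
      using wirtinger_const_unique by blast
  qed
  define e where "e = (\<lambda>Y z. if z \<in> \<Omega> then Y z else 0 :: complex)"
  have oK: "open (- K)"
    using K compact_imp_closed by auto
  have cont: "continuous_on UNIV (e Y)"
    if "continuous_on \<Omega> Y" "\<And>z. z \<in> \<Omega> - K \<Longrightarrow> Y z = 0" for Y
  proof -
    have "continuous_on \<Omega> (e Y)"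
      using that(1) by (rule continuous_on_eq) (simp add: e_def)
    moreover have "continuous_on (- K) (e Y)"
      by (rule continuous_on_eq[OF continuous_on_const[of _ 0]]) (use that in \<open>auto simp: e_def\<close>)
    ultimately have "continuous_on (\<Omega> \<union> - K) (e Y)"
      using \<Omega> oK by (rule continuous_on_open_Un[rotated 2])
    moreover have "\<Omega> \<union> - K = UNIV" using K(2) by auto
    ultimately show ?thesis by simp
  qed
  have w: "wirtinger (e X) (e a z) (e b z) z" for z
  proof (cases "z \<in> \<Omega>")
    case True
    show ?thesis
      by (rule wirtinger_transform_open[of X _ _ _ \<Omega>]) (simp_all add: e_def X \<Omega> True)
  next
    case False
    then have z: "z \<in> - K" "e a z = 0" "e b z = 0"
      using K(2) by (auto simp: e_def)
    have "0 = e X x" if "x \<in> - K" for x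
      using K(3) that by (auto simp: e_def)
    from wirtinger_transform_open[OF wirtinger_const oK z(1) this] show ?thesis
      by (simp only: z)
  qed
  have eq: "(LINT z:\<Omega>|lborel. Y z) = (LINT z|lborel. e Y z)" for Y
    unfolding set_lebesgue_integral_def e_def
    by (intro Bochner_Integration.integral_cong) (auto simp: indicator_def)
  have X0: "e X z = 0" if "z \<notin> K" for z
    using that K(3) by (auto simp: e_def)
  have c: "continuous_on UNIV (e a)" "continuous_on UNIV (e b)"
    by (auto intro!: cont a b simp: ab0)
  show ?thesis
    using divergence_theorem[of "e X" "e a" "e b" K, OF w c K(1) X0] by (simp only: eq simp_thms)
qed

section \<open>A regularised Cauchy kernel\<close>

lemma set_integrable_continuous_compact_support:
  fixes g :: "'a::euclidean_space \<Rightarrow> 'b::{banach, second_countable_topology}"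
  assumes g: "continuous_on S g" and K: "compact K" "K \<subseteq> S" "\<And>z. z \<in> S - K \<Longrightarrow> g z = 0"
  shows "set_integrable lborel S g"
proof -
  have "integrable lborel (\<lambda>x. indicator K x *\<^sub>R g x)"
    by (rule borel_integrable_compact) (use K continuous_on_subset[OF g] in auto)
  moreover have "(\<lambda>x. indicator K x *\<^sub>R g x) = (\<lambda>x. indicator S x *\<^sub>R g x)"
  proof
    fix x
    show "indicator K x *\<^sub>R g x = indicator S x *\<^sub>R g x"
      using K(2) K(3)[of x] by (cases "x \<in> K"; cases "x \<in> S") auto
  qed
  ultimately show ?thesis
    by (simp add: set_integrable_def)
qed

lemma wirtinger_radial:
  assumes "(p has_real_derivative p') (at ((cmod z)\<^sup>2))"
  shows "wirtinger (\<lambda>z. of_real (p ((cmod z)\<^sup>2))) (of_real p' * cnj z) (of_real p' * z) z"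
  using wirtinger_norm_sq assms by (rule wirtinger_real_compose)

text \<open>Up to the factor \<open>\<pi>\<close>, \<open>1 / cnj y\<close> is the fundamental solution of \<open>\<partial>/\<partial>y\<close>; the function
  \<open>cauchy_reg \<delta>\<close> is a \<open>C\<^sup>1\<close> regularisation of it that changes it only on the disc of radius
  \<open>\<delta>\<close>, and \<open>bump \<delta>\<close> is its \<open>\<partial>/\<partial>y\<close>-derivative.\<close>

definition reg_profile :: "real \<Rightarrow> real \<Rightarrow> real" where
  "reg_profile \<delta> t = (if t < \<delta>\<^sup>2 then (2 * \<delta>\<^sup>2 - t) / \<delta> ^ 4 else 1 / t)"

definition cauchy_reg :: "real \<Rightarrow> complex \<Rightarrow> complex" where
  "cauchy_reg \<delta> y = y * of_real (reg_profile \<delta> ((cmod y)\<^sup>2))"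

definition bump :: "real \<Rightarrow> complex \<Rightarrow> real" where
  "bump \<delta> y = 2 * max 0 (\<delta>\<^sup>2 - (cmod y)\<^sup>2) / \<delta> ^ 4"

definition cauchy_reg_bar :: "real \<Rightarrow> complex \<Rightarrow> complex" where
  "cauchy_reg_bar \<delta> y = - (y\<^sup>2) / of_real ((max ((cmod y)\<^sup>2) (\<delta>\<^sup>2))\<^sup>2)"

lemma norm_sq_less_iff: "\<delta> > 0 \<Longrightarrow> (cmod y)\<^sup>2 < \<delta>\<^sup>2 \<longleftrightarrow> cmod y < \<delta>"
  using power_strict_mono[of "cmod y" \<delta> 2] power2_less_imp_less[of "cmod y" \<delta>] by auto

text \<open>The linear piece is the tangent of 1 / t at t = \<delta>^2. On t > 0 both pieces are
  given by the single formula (1 - (max 0 (1 - t / \<delta>^2))^2) / t, which settles the gluing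
  point.\<close>

lemma DERIV_reg_profile:
  assumes "\<delta> > 0"
  shows "(reg_profile \<delta> has_real_derivative - 1 / (max t (\<delta>\<^sup>2))\<^sup>2) (at t)"
proof (cases "t < \<delta>\<^sup>2")
  case True
  have "((\<lambda>t. (2 * \<delta>\<^sup>2 - t) / \<delta> ^ 4) has_real_derivative - 1 / (max t (\<delta>\<^sup>2))\<^sup>2) (at t)"
    using True assms
    by (auto intro!: derivative_eq_intros simp: max_def field_simps power2_eq_square power4_eq_xxxx)
  then show ?thesis
    by (rule has_field_derivative_transform_within_open[of _ _ _ "{..<\<delta>\<^sup>2}"])
       (use True in \<open>auto simp: reg_profile_def\<close>)
next
  case False
  then have t: "t > 0"
    using assms by (smt (verit) zero_less_power)
  define u where "u = 1 - t / \<delta>\<^sup>2"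
  have u: "max 0 u = 0"
    using False assms by (simp add: u_def field_simps)
  have "((\<lambda>t. (max 0 (1 - t / \<delta>\<^sup>2))\<^sup>2) has_real_derivative 2 * max 0 u * (- 1 / \<delta>\<^sup>2)) (at t)"
    unfolding u_def
    by (rule DERIV_chain2[OF DERIV_max_sq])
       (use assms in \<open>auto intro!: derivative_eq_intros simp: power2_eq_square power4_eq_xxxx\<close>)
  then have "((\<lambda>t. (max 0 (1 - t / \<delta>\<^sup>2))\<^sup>2) has_real_derivative 0) (at t)"
    by (simp add: u)
  from DERIV_divide[OF DERIV_diff[OF DERIV_const[of 1] this] DERIV_ident]
  have "((\<lambda>t. (1 - (max 0 (1 - t / \<delta>\<^sup>2))\<^sup>2) / t) has_real_derivative
      - 1 / (max t (\<delta>\<^sup>2))\<^sup>2) (at t)"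
    using t False u unfolding u_def by (simp add: max_def power2_eq_square)
  then show ?thesis
  proof (rule has_field_derivative_transform_within_open[of _ _ _ "{0<..}"])
    fix s :: real assume s: "s \<in> {0<..}"
    show "(1 - (max 0 (1 - s / \<delta>\<^sup>2))\<^sup>2) / s = reg_profile \<delta> s"
    proof (cases "s < \<delta>\<^sup>2")
      case True
      then have "max 0 (1 - s / \<delta>\<^sup>2) = 1 - s / \<delta>\<^sup>2"
        using assms by (simp add: field_simps)
      moreover have "(1 - (1 - s / \<delta>\<^sup>2)\<^sup>2) / s = (2 * \<delta>\<^sup>2 - s) / \<delta> ^ 4"
        using s assms by (simp add: field_simps) algebra
      ultimately show ?thesis
        using True by (simp add: reg_profile_def)
    next
      case False
      then have "max 0 (1 - s / \<delta>\<^sup>2) = 0"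
        using assms by (simp add: field_simps)
      then show ?thesis
        using False by (simp add: reg_profile_def)
    qed
  qed (use t in auto)
qed

text \<open>For y p(t) with t = |y|^2 the derivative in y is p + t p', which vanishes where p = 1 /
  t and is the bump on the disc of radius \<delta>; the derivative in cnj y is y^2 p'.\<close>

lemma wirtinger_cauchy_reg:
  assumes "\<delta> > 0"
  shows "wirtinger (cauchy_reg \<delta>) (of_real (bump \<delta> y)) (cauchy_reg_bar \<delta> y) y"
proof -
  define t p' where "t = (cmod y)\<^sup>2" and "p' = - 1 / (max t (\<delta>\<^sup>2))\<^sup>2"
  have "wirtinger (\<lambda>y. y * of_real (reg_profile \<delta> ((cmod y)\<^sup>2)))
     (1 * of_real (reg_profile \<delta> t) + y * (of_real p' * cnj y))
     (0 * of_real (reg_profile \<delta> t) + y * (of_real p' * y)) y"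
    unfolding t_def p'_def
    by (intro wirtinger_mult wirtinger_radial wirtinger_DERIV DERIV_ident DERIV_reg_profile assms)
  moreover have "y * (of_real p' * cnj y) = of_real (p' * t)"
    using complex_norm_square[of y] by (simp add: t_def mult.left_commute)
  moreover have "reg_profile \<delta> t + p' * t = bump \<delta> y"
    using assms unfolding reg_profile_def bump_def p'_def t_def[symmetric]
    by (auto simp: max_def divide_simps power2_eq_square) algebra
  moreover have "y * (of_real p' * y) = cauchy_reg_bar \<delta> y"
    by (simp add: cauchy_reg_bar_def p'_def t_def power2_eq_square)
  ultimately show ?thesis
    unfolding cauchy_reg_def[abs_def] by (simp only: mult_1 mult_zero_left add_0 flip: of_real_add)
qed

lemma bump_nonneg: "bump \<delta> y \<ge> 0"
  by (simp add: bump_def)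

lemma bump_minus: "bump \<delta> (w - z) = bump \<delta> (z - w)"
  by (simp add: bump_def norm_minus_commute)

lemma bump_eq_0: "\<delta> > 0 \<Longrightarrow> cmod y \<ge> \<delta> \<Longrightarrow> bump \<delta> y = 0"
  using power_mono[of \<delta> "cmod y" 2] by (simp add: bump_def)

lemma bump_le: "\<delta> > 0 \<Longrightarrow> bump \<delta> y \<le> 2 / \<delta>\<^sup>2"
  by (auto simp: bump_def field_simps max_def power2_eq_square power4_eq_xxxx)

lemma continuous_on_bump: "\<delta> > 0 \<Longrightarrow> continuous_on S (bump \<delta>)"
  unfolding bump_def[abs_def] by (intro continuous_intros) auto

lemma continuous_on_bump_translate: "\<delta> > 0 \<Longrightarrow> continuous_on S (\<lambda>z. bump \<delta> (z - w))"
  unfolding bump_def[abs_def] by (intro continuous_intros) auto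

lemma continuous_on_cauchy_reg_bar: "\<delta> > 0 \<Longrightarrow> continuous_on S (cauchy_reg_bar \<delta>)"
  unfolding cauchy_reg_bar_def[abs_def]
  by (intro continuous_intros) (auto simp: max_def)

lemma continuous_on_cauchy_reg: "\<delta> > 0 \<Longrightarrow> continuous_on S (cauchy_reg \<delta>)"
  by (intro continuous_at_imp_continuous_on ballI wirtinger_continuous[OF wirtinger_cauchy_reg])

lemma cauchy_reg_eq:
  assumes "\<delta> > 0" "cmod y \<ge> \<delta>"
  shows "cauchy_reg \<delta> y = 1 / cnj y"
proof -
  have "\<not> (cmod y)\<^sup>2 < \<delta>\<^sup>2"
    using assms by (simp add: norm_sq_less_iff)
  then show ?thesis
    using assms complex_norm_square[of y]
    by (auto simp: cauchy_reg_def reg_profile_def divide_simps)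
qed

lemma norm_cauchy_reg_le:
  assumes "\<delta> > 0"
  shows "cmod (cauchy_reg \<delta> y) \<le> 2 / \<delta>"
proof (cases "cmod y < \<delta>")
  case True
  then have t: "(cmod y)\<^sup>2 < \<delta>\<^sup>2"
    by (simp add: power_strict_mono)
  have p: "0 \<le> (2 * \<delta>\<^sup>2 - (cmod y)\<^sup>2) / \<delta> ^ 4"
    using order_trans[OF less_imp_le[OF t], of "2 * \<delta>\<^sup>2"] by (intro divide_nonneg_nonneg) auto
  then have "\<bar>(2 * \<delta>\<^sup>2 - (cmod y)\<^sup>2) / \<delta> ^ 4\<bar> = (2 * \<delta>\<^sup>2 - (cmod y)\<^sup>2) / \<delta> ^ 4"
    by (rule abs_of_nonneg)
  then have "cmod (cauchy_reg \<delta> y) = cmod y * ((2 * \<delta>\<^sup>2 - (cmod y)\<^sup>2) / \<delta> ^ 4)"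
    using t by (simp only: cauchy_reg_def reg_profile_def norm_mult norm_of_real if_True)
  also have "\<dots> \<le> \<delta> * ((2 * \<delta>\<^sup>2) / \<delta> ^ 4)"
    using True assms t p by (intro mult_mono divide_right_mono) auto
  also have "\<dots> = 2 / \<delta>"
    using assms by (simp add: field_simps power2_eq_square power4_eq_xxxx)
  finally show ?thesis .
next
  case False
  then have "cmod (cauchy_reg \<delta> y) = 1 / cmod y"
    using assms by (simp add: cauchy_reg_eq norm_divide)
  also have "\<dots> \<le> 1 / \<delta>"
    using False assms by (intro divide_left_mono mult_pos_pos) auto
  also have "\<dots> \<le> 2 / \<delta>"
    using assms by (simp add: divide_right_mono)
  finally show ?thesis .
qed

lemma norm_cauchy_reg_bar_le:
  assumes "\<delta> > 0"
  shows "cmod (cauchy_reg_bar \<delta> y) \<le> 1 / \<delta>\<^sup>2"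
proof -
  define m where "m = max ((cmod y)\<^sup>2) (\<delta>\<^sup>2)"
  have m: "m > 0" "(cmod y)\<^sup>2 \<le> m" "\<delta>\<^sup>2 \<le> m"
    using assms by (auto simp: m_def max_def intro: less_le_trans)
  have "cmod (cauchy_reg_bar \<delta> y) = (cmod y)\<^sup>2 / m\<^sup>2"
    by (simp add: cauchy_reg_bar_def m_def norm_divide norm_power del: of_real_power)
  also have "\<dots> \<le> m / m\<^sup>2"
    using m by (intro divide_right_mono) auto
  also have "\<dots> = 1 / m"
    by (simp add: power2_eq_square)
  also have "\<dots> \<le> 1 / \<delta>\<^sup>2"
    using m assms by (intro divide_left_mono) auto
  finally show ?thesis .
qed

text \<open>The mass is \<pi>, for every radius; the proof uses only its positivity and its
  independence of the radius.\<close>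

definition bump_mass :: real where "bump_mass = (LINT y|lborel. bump 1 y)"
definition bump_moment :: "real \<Rightarrow> real" where "bump_moment \<delta> = (LINT y|lborel. (cmod y)\<^sup>2 * bump \<delta> y)"

lemma integrable_continuous_times_bump:
  fixes g :: "complex \<Rightarrow> 'b::{banach, second_countable_topology, real_normed_algebra_1}"
  assumes "\<delta> > 0" "continuous_on UNIV g"
  shows "integrable lborel (\<lambda>y. g y * of_real (bump \<delta> y))"
proof -
  have "set_integrable lborel UNIV (\<lambda>y. g y * of_real (bump \<delta> y))"
    by (rule set_integrable_continuous_compact_support[of _ _ "cball 0 \<delta>"])
       (use assms in \<open>auto intro!: continuous_intros continuous_on_bump simp: bump_eq_0\<close>)
  then show ?thesis
    by (simp add: set_integrable_def)
qed

text \<open>Two regularisations of the same kernel differ only on a disc, so the difference of the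
  bumps is the derivative of a compactly supported function and has integral 0.\<close>

lemma integral_bump:
  assumes "\<delta> > 0"
  shows "(LINT y|lborel. bump \<delta> y) = bump_mass"
proof -
  have "(LINT y|lborel. complex_of_real (bump \<delta> y) - of_real (bump 1 y)) = 0"
  proof (rule divergence_theorem)
    show "wirtinger (\<lambda>y. cauchy_reg \<delta> y - cauchy_reg 1 y) (of_real (bump \<delta> y) - of_real (bump 1 y))
       (cauchy_reg_bar \<delta> y - cauchy_reg_bar 1 y) y" for y
      by (intro wirtinger_diff wirtinger_cauchy_reg) (use assms in auto)
    show "compact (cball (0::complex) (max \<delta> 1))" by simp
    show "cauchy_reg \<delta> y - cauchy_reg 1 y = 0" if "y \<notin> cball 0 (max \<delta> 1)" for y
      using that assms by (simp add: cauchy_reg_eq)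
  qed (use assms in \<open>auto intro!: continuous_intros continuous_on_bump continuous_on_cauchy_reg_bar\<close>)
  then have "complex_of_real (LINT y|lborel. bump \<delta> y) - of_real (LINT y|lborel. bump 1 y) = 0"
    using integrable_continuous_times_bump[of \<delta> "\<lambda>_. 1::real"]
      integrable_continuous_times_bump[of 1 "\<lambda>_. 1::real"] assms
    by (simp flip: of_real_diff)
  then show ?thesis
    by (simp add: bump_mass_def)
qed

lemma bump_mass_pos: "bump_mass > 0"
proof -
  have "0 < measure lborel (cball (0::complex) (1/2))"
    by (simp add: content_cball_pos)
  also have "\<dots> = (LINT y|lborel. indicator (cball (0::complex) (1/2)) y)"
    by simp
  also have "\<dots> \<le> (LINT y|lborel. bump 1 y)"
  proof (rule integral_mono)
    show "integrable lborel (\<lambda>y. indicator (cball (0::complex) (1/2)) y :: real)"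
      using emeasure_lborel_cball_finite[of "0::complex" "1/2"] by (intro integrable_real_indicator) auto
    show "integrable lborel (bump 1)"
      using integrable_continuous_times_bump[of 1 "\<lambda>_. 1::real"] by simp
    show "indicator (cball (0::complex) (1/2)) y \<le> bump 1 y" for y
    proof (cases "cmod y \<le> 1/2")
      case True
      then have "(cmod y)\<^sup>2 \<le> (1/2)\<^sup>2"
        by (intro power_mono) auto
      then have "1 \<le> bump 1 y"
        by (simp add: bump_def power2_eq_square)
      then show ?thesis
        by (simp add: indicator_def)
    qed (simp add: bump_nonneg)
  qed
  finally show ?thesis
    by (simp add: bump_mass_def)
qed

text \<open>Write f z = f w + (z - w) f1 z with f1 holomorphic. The radial weight times z - w is the
  derivative in cnj z of a compactly supported function N, so the second part integrates to zero as
  the derivative of N f1.\<close>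

lemma bump_mean_value:
  assumes f: "f holomorphic_on ball w R" and \<delta>: "0 < \<delta>" "\<delta> < R"
  shows "(LINT z:ball w R|lborel. f z * of_real (bump \<delta> (z - w))) = f w * of_real bump_mass"
proof -
  let ?B = "ball w R"
  define f1 where "f1 = (\<lambda>z. if z = w then deriv f w else (f z - f w) / (z - w))"
  have f1: "f1 holomorphic_on ?B"
    unfolding f1_def by (rule pole_lemma[OF f]) (use \<delta> in auto)
  \<comment> \<open>As a function of t = |z - w|^2, N is the antiderivative of the bump that
    vanishes for t \<ge> \<delta>^2.\<close>
  define N where "N = (\<lambda>z. complex_of_real (- ((max 0 (\<delta>\<^sup>2 - (cmod (z - w))\<^sup>2))\<^sup>2 / \<delta> ^ 4)))"
  let ?b = "\<lambda>z. complex_of_real (bump \<delta> (z - w))"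
  have N: "wirtinger N (?b z * cnj (z - w)) (?b z * (z - w)) z" for z
  proof -
    have "((\<lambda>t. - ((max 0 (\<delta>\<^sup>2 - t))\<^sup>2 / \<delta> ^ 4)) has_real_derivative bump \<delta> (z - w)) (at ((cmod (z - w))\<^sup>2))"
      unfolding bump_def
      by (rule DERIV_cong, rule DERIV_minus, rule DERIV_cdivide, rule DERIV_chain2[OF DERIV_max_sq])
         (auto intro!: derivative_eq_intros)
    from wirtinger_translate[OF wirtinger_radial[OF this]] show ?thesis
      by (simp add: N_def)
  qed
  have "(LINT z:?B|lborel. (?b z * (z - w)) * f1 z + N z * 0) = 0"
  proof (rule conjunct2[OF divergence_theorem_on])
    show "wirtinger (\<lambda>z. N z * f1 z) ((?b z * cnj (z - w)) * f1 z + N z * deriv f1 z)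
            ((?b z * (z - w)) * f1 z + N z * 0) z" if "z \<in> ?B" for z
      by (intro wirtinger_mult N wirtinger_DERIV holomorphic_derivI[OF f1] that) auto
    show "compact (cball w \<delta>)" "cball w \<delta> \<subseteq> ?B"
      using \<delta> by auto
    show "N z * f1 z = 0" if "z \<in> ?B - cball w \<delta>" for z
    proof -
      have "\<not> (cmod (z - w))\<^sup>2 < \<delta>\<^sup>2"
        using that \<delta> by (simp add: norm_sq_less_iff dist_norm norm_minus_commute)
      then show ?thesis by (simp add: N_def)
    qed
    have cN: "continuous_on ?B N"
      by (intro continuous_at_imp_continuous_on ballI wirtinger_continuous[OF N])
    have cf1: "continuous_on ?B f1" "continuous_on ?B (deriv f1)"
      using f1 holomorphic_deriv[OF f1] by (auto intro: holomorphic_on_imp_continuous_on)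
    note cb = continuous_on_bump_translate[OF \<delta>(1), of ?B w]
    show "continuous_on ?B (\<lambda>z. (?b z * cnj (z - w)) * f1 z + N z * deriv f1 z)"
      "continuous_on ?B (\<lambda>z. (?b z * (z - w)) * f1 z + N z * 0)"
      by (intro continuous_intros cN cf1 cb)+
  qed simp
  then have 0: "(LINT z:?B|lborel. (?b z * (z - w)) * f1 z) = 0"
    by simp
  have b0: "?b z = 0" if "z \<in> ?B - cball w \<delta>" for z
    using \<delta> that by (auto simp: bump_eq_0 dist_norm norm_minus_commute)
  note cb = continuous_on_bump_translate[OF \<delta>(1), of _ w]
  have cf1: "continuous_on ?B f1"
    using f1 by (rule holomorphic_on_imp_continuous_on)
  have i1: "set_integrable lborel ?B (\<lambda>z. (?b z * (z - w)) * f1 z)"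
    by (rule set_integrable_continuous_compact_support[of _ _ "cball w \<delta>"])
       (use \<delta> b0 in \<open>auto intro!: continuous_intros cb cf1\<close>)
  have i2: "set_integrable lborel ?B ?b"
    by (rule set_integrable_continuous_compact_support[of _ _ "cball w \<delta>"])
       (use \<delta> b0 in \<open>auto intro!: continuous_intros cb\<close>)
  have "(LINT z:?B|lborel. f z * ?b z) = (LINT z:?B|lborel. (?b z * (z - w)) * f1 z + f w * ?b z)"
    by (intro set_lebesgue_integral_cong) (auto simp: f1_def field_simps)
  also have "\<dots> = f w * (LINT z:?B|lborel. ?b z)"
    using 0 set_integral_add(2)[OF i1 set_integrable_mult_right[of "f w", OF i2]] by simp
  also have "(LINT z:?B|lborel. ?b z) = (LINT z|lborel. ?b z)"
    unfolding set_lebesgue_integral_def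
    by (intro Bochner_Integration.integral_cong)
       (use \<delta> in \<open>auto simp: indicator_def dist_norm norm_minus_commute bump_eq_0\<close>)
  also have "\<dots> = (LINT z|lborel. complex_of_real (bump \<delta> z))"
    using integral_lborel_translate[of "\<lambda>z. complex_of_real (bump \<delta> z)" w]
      borel_measurable_continuous_onI[OF continuous_on_of_real[OF continuous_on_bump[OF \<delta>(1)]]] by simp
  also have "\<dots> = of_real bump_mass"
    using integral_bump[OF \<delta>(1)] by simp
  finally show ?thesis .
qed

lemma set_integrable_continuous_bump:
  assumes "0 < \<delta>" "\<delta> < R" "continuous_on (ball w R) g"
  shows "set_integrable lborel (ball w R) (\<lambda>z. g z * complex_of_real (bump \<delta> (z - w)))"
proof (rule set_integrable_continuous_compact_support[of _ _ "cball w \<delta>"])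
  show "continuous_on (ball w R) (\<lambda>z. g z * complex_of_real (bump \<delta> (z - w)))"
    by (intro continuous_intros assms continuous_on_bump_translate)
qed (use assms in \<open>auto simp: bump_eq_0 dist_norm norm_minus_commute\<close>)

lemma bump_mean_value_cnj:
  assumes "f holomorphic_on ball w R" and "0 < \<delta>" "\<delta> < R"
  shows "(LINT z:ball w R|lborel. cnj (f z) * of_real (bump \<delta> (z - w))) = cnj (f w) * of_real bump_mass"
proof -
  have "(LINT z:ball w R|lborel. cnj (f z) * of_real (bump \<delta> (z - w))) =
      cnj (LINT z:ball w R|lborel. f z * of_real (bump \<delta> (z - w)))"
    unfolding set_lebesgue_integral_def
    by (rule trans[OF Bochner_Integration.integral_cong Bochner_Integration.integral_cnj])
       (auto simp: scaleR_conv_of_real)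
  then show ?thesis
    using bump_mean_value[OF assms] by simp
qed

text \<open>Expanding |z|^2 about w gives a holomorphic part, an antiholomorphic part and |z - w|^2.
  The first two have the mean value property; the third yields the moment, which is why
  \<open>pot_reg\<close> subtracts it.\<close>

lemma bump_mean_norm_sq:
  assumes \<delta>: "0 < \<delta>" "\<delta> < R"
  shows "(LINT z:ball w R|lborel. complex_of_real ((cmod z)\<^sup>2) * of_real (bump \<delta> (z - w)))
     = of_real ((cmod w)\<^sup>2 * bump_mass + bump_moment \<delta>)"
proof -
  let ?B = "ball w R" and ?b = "\<lambda>z. complex_of_real (bump \<delta> (z - w))"
  define g where "g = (\<lambda>z. of_real ((cmod w)\<^sup>2) + cnj w * (z - w))"
  have hol: "g holomorphic_on ?B" "(\<lambda>z. cnj w * (z - w)) holomorphic_on ?B"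
    unfolding g_def by (auto intro!: holomorphic_intros)
  have eq: "complex_of_real ((cmod z)\<^sup>2) * ?b z =
     g z * ?b z + (cnj (cnj w * (z - w)) * ?b z + of_real ((cmod (z - w))\<^sup>2) * ?b z)" for z
    unfolding g_def complex_norm_square by (simp add: algebra_simps)
  have I: "set_integrable lborel ?B (\<lambda>z. g z * ?b z)"
    "set_integrable lborel ?B (\<lambda>z. cnj (cnj w * (z - w)) * ?b z)"
    "set_integrable lborel ?B (\<lambda>z. of_real ((cmod (z - w))\<^sup>2) * ?b z)"
    by (intro set_integrable_continuous_bump \<delta> continuous_intros holomorphic_on_imp_continuous_on[OF hol(1)])+
  have "(LINT z:?B|lborel. of_real ((cmod (z - w))\<^sup>2) * ?b z)
      = (LINT z|lborel. complex_of_real ((cmod (z - w))\<^sup>2 * bump \<delta> (z - w)))"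
    unfolding set_lebesgue_integral_def
    by (intro Bochner_Integration.integral_cong)
       (use \<delta> in \<open>auto simp: indicator_def dist_norm norm_minus_commute bump_eq_0\<close>)
  also have "\<dots> = (LINT z|lborel. complex_of_real ((cmod z)\<^sup>2 * bump \<delta> z))"
    by (rule integral_lborel_translate)
       (intro borel_measurable_continuous_onI continuous_intros continuous_on_bump \<delta>)
  finally have 3: "(LINT z:?B|lborel. of_real ((cmod (z - w))\<^sup>2) * ?b z) = of_real (bump_moment \<delta>)"
    by (simp only: bump_moment_def integral_complex_of_real)
  show ?thesis
    unfolding eq set_integral_add(2)[OF I(1) set_integral_add(1)[OF I(2) I(3)]]
      set_integral_add(2)[OF I(2,3)] bump_mean_value[OF hol(1) \<delta>] bump_mean_value_cnj[OF hol(2) \<delta>] 3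
    by (simp add: g_def)
qed

text \<open>Near \<open>w\<close> the density \<open>cnj z - f z\<close> has the primitive \<open>P = |z|\<^sup>2 - F\<close> with respect to
  \<open>\<partial>/\<partial>z\<close>; integrating by parts turns the regularised kernels into means of \<open>P\<close>.\<close>

lemma cauchy_reg_independent:
  assumes f: "f holomorphic_on ball w R" and \<delta>: "0 < \<delta>" "\<delta> < R" "0 < \<epsilon>" "\<epsilon> < R"
  shows "(LINT z:ball w R|lborel. (cnj z - f z) * (cauchy_reg \<delta> (w - z) - cauchy_reg \<epsilon> (w - z)))
    = of_real (bump_moment \<delta> - bump_moment \<epsilon>)"
proof -
  let ?B = "ball w R"
  obtain F where F: "\<And>z. z \<in> ?B \<Longrightarrow> (F has_field_derivative f z) (at z)"
    using holomorphic_convex_primitive'[OF _ _ f] by (metis at_within_open convex_ball open_ball)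
  have hF: "F holomorphic_on ?B"
    using F holomorphic_on_open by blast
  define P where "P = (\<lambda>z. of_real ((cmod z)\<^sup>2) - F z)"
  define k where "k = (\<lambda>z. cauchy_reg \<delta> (w - z) - cauchy_reg \<epsilon> (w - z))"
  define m where "m = (\<lambda>z. complex_of_real (bump \<delta> (z - w)) - of_real (bump \<epsilon> (z - w)))"
  define n where "n = (\<lambda>z. - cauchy_reg_bar \<delta> (w - z) - - cauchy_reg_bar \<epsilon> (w - z))"
  have P: "wirtinger P (cnj z - f z) (z - 0) z" if "z \<in> ?B" for z
    unfolding P_def by (intro wirtinger_diff wirtinger_norm_sq wirtinger_DERIV F that)
  have k: "wirtinger k (- m z) (n z) z" for z
  proof -
    have "wirtinger k (- of_real (bump \<delta> (w - z)) - - of_real (bump \<epsilon> (w - z))) (n z) z"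
      unfolding k_def n_def by (intro wirtinger_diff wirtinger_reflect wirtinger_cauchy_reg \<delta>)
    then show ?thesis
      by (simp add: m_def bump_minus)
  qed
  have cP: "continuous_on ?B P"
    by (intro continuous_at_imp_continuous_on ballI wirtinger_continuous[OF P])
  have ck: "continuous_on ?B k"
    by (intro continuous_at_imp_continuous_on ballI wirtinger_continuous[OF k])
  have cm: "continuous_on ?B m"
    unfolding m_def
    by (intro continuous_intros continuous_on_compose2[OF continuous_on_bump[where S = UNIV]] \<delta>) auto
  have cn: "continuous_on ?B n"
    unfolding n_def
    by (intro continuous_intros continuous_on_compose2[OF continuous_on_cauchy_reg_bar[where S = UNIV]] \<delta>) auto
  have cf: "continuous_on ?B f"
    using f by (rule holomorphic_on_imp_continuous_on)
  let ?K = "cball w (max \<delta> \<epsilon>)"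
  have K: "compact ?K" "?K \<subseteq> ?B"
    using \<delta> by auto
  have k0: "k z = 0" and m0: "m z = 0" if "z \<notin> ?K" for z
    using that \<delta> by (auto simp: k_def m_def cauchy_reg_eq bump_eq_0 dist_norm norm_minus_commute)
  have "(LINT z:?B|lborel. (cnj z - f z) * k z + P z * (- m z)) = 0"
  proof (rule conjunct1[OF divergence_theorem_on])
    show "wirtinger (\<lambda>z. P z * k z) ((cnj z - f z) * k z + P z * (- m z)) ((z - 0) * k z + P z * n z) z"
      if "z \<in> ?B" for z
      by (intro wirtinger_mult P k that)
    show "P z * k z = 0" if "z \<in> ?B - ?K" for z
      using k0 that by auto
  qed (use K in \<open>auto intro!: continuous_intros cP ck cm cn cf\<close>)
  moreover have I: "set_integrable lborel ?B (\<lambda>z. (cnj z - f z) * k z)"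
    by (rule set_integrable_continuous_compact_support[OF _ K])
       (use k0 in \<open>auto intro!: continuous_intros ck cf\<close>)
  moreover have I2: "set_integrable lborel ?B (\<lambda>z. P z * m z)"
    by (rule set_integrable_continuous_compact_support[OF _ K])
       (use m0 in \<open>auto intro!: continuous_intros cm cP\<close>)
  ultimately have eq: "(LINT z:?B|lborel. (cnj z - f z) * k z) = (LINT z:?B|lborel. P z * m z)"
    using set_integral_diff(2)[OF I I2] by simp
  have means: "(LINT z:?B|lborel. P z * of_real (bump \<eta> (z - w))) =
      of_real ((cmod w)\<^sup>2 * bump_mass + bump_moment \<eta>) - F w * of_real bump_mass"
    and ints: "set_integrable lborel ?B (\<lambda>z. P z * of_real (bump \<eta> (z - w)))"
    if \<eta>: "0 < \<eta>" "\<eta> < R" for \<eta>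
  proof -
    have J: "set_integrable lborel ?B (\<lambda>z. of_real ((cmod z)\<^sup>2) * complex_of_real (bump \<eta> (z - w)))"
      "set_integrable lborel ?B (\<lambda>z. F z * complex_of_real (bump \<eta> (z - w)))"
      by (intro set_integrable_continuous_bump \<eta> continuous_intros holomorphic_on_imp_continuous_on[OF hF])+
    show "(LINT z:?B|lborel. P z * of_real (bump \<eta> (z - w))) =
      of_real ((cmod w)\<^sup>2 * bump_mass + bump_moment \<eta>) - F w * of_real bump_mass"
      unfolding P_def left_diff_distrib set_integral_diff(2)[OF J] bump_mean_norm_sq[OF \<eta>]
        bump_mean_value[OF hF \<eta>] ..
    show "set_integrable lborel ?B (\<lambda>z. P z * of_real (bump \<eta> (z - w)))"
      by (intro set_integrable_continuous_bump \<eta> cP)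
  qed
  \<comment> \<open>The contributions of |w|^2 and of F w do not depend on the radius and cancel;
    only the moments survive.\<close>
  have "(LINT z:?B|lborel. P z * m z) = of_real (bump_moment \<delta> - bump_moment \<epsilon>)"
    unfolding m_def right_diff_distrib
      set_integral_diff(2)[OF ints[OF \<delta>(1,2)] ints[OF \<delta>(3,4)]] means[OF \<delta>(1,2)] means[OF \<delta>(3,4)]
    by simp
  then show ?thesis
    using eq by (simp add: k_def)
qed

section \<open>The regularised potential\<close>

locale bounded_domain =
  fixes \<Omega> :: "complex set"
  assumes open_\<Omega>: "open \<Omega>" and bounded_\<Omega>: "bounded \<Omega>"
begin

lemma sets_\<Omega> [measurable, simp]: "\<Omega> \<in> sets borel"
  using open_\<Omega> by auto

lemma emeasure_\<Omega>: "emeasure lborel \<Omega> < \<infinity>"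
  using bounded_\<Omega> by (rule emeasure_bounded_finite)

lemma set_integrable_bounded:
  fixes g :: "complex \<Rightarrow> 'b::{banach, second_countable_topology}"
  assumes g: "set_borel_measurable lborel \<Omega> g" and B: "\<And>z. z \<in> \<Omega> \<Longrightarrow> norm (g z) \<le> B"
  shows "set_integrable lborel \<Omega> g"
  unfolding set_integrable_def
proof (rule integrableI_bounded_set)
  show "\<Omega> \<in> sets lborel" by simp
  show "emeasure lborel \<Omega> < \<infinity>" by (rule emeasure_\<Omega>)
  show "(\<lambda>x. indicator \<Omega> x *\<^sub>R g x) \<in> borel_measurable lborel"
    using g by (simp add: set_borel_measurable_def)
qed (use B in \<open>auto simp: indicator_def\<close>)

lemma set_borel_measurable_continuous:
  fixes g :: "complex \<Rightarrow> 'b::{real_normed_vector, second_countable_topology}"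
  shows "continuous_on \<Omega> g \<Longrightarrow> set_borel_measurable lborel \<Omega> g"
  unfolding set_borel_measurable_def
  using borel_measurable_continuous_on_indicator[OF sets_\<Omega>] by simp

lemma L2_times_L2:
  assumes f: "f \<in> L2_on \<Omega>" and g: "g \<in> L2_on \<Omega>"
  shows "set_integrable lborel \<Omega> (\<lambda>z. f z * g z)"
proof (rule set_integrable_bound)
  have "set_integrable lborel \<Omega> (\<lambda>z. (cmod (f z))\<^sup>2 + (cmod (g z))\<^sup>2)"
    using f g by (intro set_integral_add) (auto simp: L2_on_def)
  then show "set_integrable lborel \<Omega> (\<lambda>z. (cmod (f z))\<^sup>2 + (cmod (g z))\<^sup>2)" .
  have m: "(\<lambda>z. indicator \<Omega> z *\<^sub>R f z) \<in> borel_measurable lborel"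
    "(\<lambda>z. indicator \<Omega> z *\<^sub>R g z) \<in> borel_measurable lborel"
    using f g by (simp_all add: L2_on_def set_borel_measurable_def)
  note borel_measurable_times[OF m]
  moreover have "(\<lambda>z. (indicator \<Omega> z *\<^sub>R f z) * (indicator \<Omega> z *\<^sub>R g z))
      = (\<lambda>z. indicator \<Omega> z *\<^sub>R (f z * g z))"
    by (auto simp: indicator_def)
  ultimately show "set_borel_measurable lborel \<Omega> (\<lambda>z. f z * g z)"
    by (simp add: set_borel_measurable_def)
  have "cmod (f z) * cmod (g z) \<le> (cmod (f z))\<^sup>2 + (cmod (g z))\<^sup>2" for z
    using sum_squares_bound[of "cmod (f z)" "cmod (g z)"]
      mult_nonneg_nonneg[OF norm_ge_zero[of "f z"] norm_ge_zero[of "g z"]] by linarith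
  then show "AE z in lborel. z \<in> \<Omega> \<longrightarrow> norm (f z * g z) \<le> norm ((cmod (f z))\<^sup>2 + (cmod (g z))\<^sup>2)"
    by (simp add: norm_mult)
qed

lemma L2_bounded_continuous:
  fixes g :: "complex \<Rightarrow> complex"
  assumes g: "continuous_on \<Omega> g" and B: "\<And>z. z \<in> \<Omega> \<Longrightarrow> cmod (g z) \<le> B"
  shows "g \<in> L2_on \<Omega>"
proof -
  have "set_integrable lborel \<Omega> (\<lambda>z. (cmod (g z))\<^sup>2)"
    using B power_mono[OF B norm_ge_zero, of _ 2]
    by (intro set_integrable_bounded[of _ "B\<^sup>2"] set_borel_measurable_continuous continuous_intros g) auto
  then show ?thesis
    using g by (auto simp: L2_on_def intro: set_borel_measurable_continuous)
qed

lemma L2_integrable: "f \<in> L2_on \<Omega> \<Longrightarrow> set_integrable lborel \<Omega> f"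
  using L2_times_L2[of f "\<lambda>z. 1"] L2_bounded_continuous[of "\<lambda>z. 1" 1] by simp

lemma cnj_in_L2: "cnj \<in> L2_on \<Omega>"
proof -
  obtain B where "\<And>z. z \<in> \<Omega> \<Longrightarrow> cmod z \<le> B"
    using bounded_\<Omega> by (auto simp: bounded_iff)
  then show ?thesis
    by (intro L2_bounded_continuous[of _ B]) (auto intro: continuous_intros)
qed

lemma L2_diff:
  assumes f: "f \<in> L2_on \<Omega>" and g: "g \<in> L2_on \<Omega>"
  shows "(\<lambda>z. f z - g z) \<in> L2_on \<Omega>"
proof -
  have m: "set_borel_measurable lborel \<Omega> (\<lambda>z. f z - g z)"
    using f g unfolding L2_on_def set_borel_measurable_def by (auto simp: scaleR_diff_right)
  have "set_integrable lborel \<Omega> (\<lambda>z. (cmod (f z - g z))\<^sup>2)"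
  proof (rule set_integrable_bound)
    show "set_integrable lborel \<Omega> (\<lambda>z. 2 * (cmod (f z))\<^sup>2 + 2 * (cmod (g z))\<^sup>2)"
      using f g by (intro set_integral_add set_integrable_mult_right) (auto simp: L2_on_def)
    have "(\<lambda>z. (cmod (indicator \<Omega> z *\<^sub>R (f z - g z)))\<^sup>2) \<in> borel_measurable lborel"
      using m unfolding set_borel_measurable_def by measurable
    moreover have "(\<lambda>z. (cmod (indicator \<Omega> z *\<^sub>R (f z - g z)))\<^sup>2) =
        (\<lambda>z. indicator \<Omega> z *\<^sub>R (cmod (f z - g z))\<^sup>2)"
      by (auto simp: indicator_def)
    ultimately show "set_borel_measurable lborel \<Omega> (\<lambda>z. (cmod (f z - g z))\<^sup>2)"
      by (simp add: set_borel_measurable_def)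
    have "(cmod (f z - g z))\<^sup>2 \<le> 2 * (cmod (f z))\<^sup>2 + 2 * (cmod (g z))\<^sup>2" for z
    proof -
      have "(cmod (f z - g z))\<^sup>2 \<le> (cmod (f z) + cmod (g z))\<^sup>2"
        by (intro power_mono norm_triangle_ineq4) auto
      also have "\<dots> \<le> 2 * (cmod (f z))\<^sup>2 + 2 * (cmod (g z))\<^sup>2"
        using sum_squares_bound[of "cmod (f z)" "cmod (g z)"] by (simp add: power2_sum)
      finally show ?thesis .
    qed
    then show "AE z in lborel. z \<in> \<Omega> \<longrightarrow> norm ((cmod (f z - g z))\<^sup>2) \<le>
        norm (2 * (cmod (f z))\<^sup>2 + 2 * (cmod (g z))\<^sup>2)"
      by simp
  qed
  with m show ?thesis by (simp add: L2_on_def)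
qed

section \<open>Distance to the complement and the potential\<close>

definition bdist :: "complex \<Rightarrow> real" where
  "bdist w = infdist w (- \<Omega>)"

text \<open>\<open>infdist\<close> to the empty set is 0 by convention, so without this
  \<open>bdist\<close> would not be positive on \<Omega>.\<close>

lemma compl_nonempty: "- \<Omega> \<noteq> {}"
proof
  assume "- \<Omega> = {}"
  then have "\<Omega> = UNIV" by auto
  with bounded_\<Omega> show False by simp
qed

lemma bdist_pos: "w \<in> \<Omega> \<Longrightarrow> bdist w > 0"
  using infdist_pos_not_in_closed[of "- \<Omega>" w] open_\<Omega> compl_nonempty
  by (simp add: bdist_def closed_open)

lemma ball_bdist: "ball w (bdist w) \<subseteq> \<Omega>"
proof
  fix z assume z: "z \<in> ball w (bdist w)"
  show "z \<in> \<Omega>"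
  proof (rule ccontr)
    assume "z \<notin> \<Omega>"
    then have "infdist w (- \<Omega>) \<le> dist w z"
      by (intro infdist_le) auto
    then show False
      using z by (simp add: bdist_def)
  qed
qed

lemma bdist_lipschitz: "\<bar>bdist w - bdist z\<bar> \<le> dist w z"
  using infdist_triangle[of w "- \<Omega>" z] infdist_triangle[of z "- \<Omega>" w]
  unfolding bdist_def dist_commute[of z w] by linarith

lemma bdist_attained:
  obtains p where "p \<notin> \<Omega>" "dist w p = bdist w"
proof -
  have "closed (- \<Omega>)"
    using open_\<Omega> by (simp add: closed_open)
  then obtain p where "p \<in> - \<Omega>" "infdist w (- \<Omega>) = dist w p"
    by (rule infdist_attains_inf[OF _ compl_nonempty])
  then show ?thesis
    by (intro that[of p]) (simp_all add: bdist_def)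
qed

text \<open>With the moment subtracted, the value at w is the same for all \<delta> <
  \<open>bdist w\<close>, so the radius may be adapted to the point.\<close>

definition pot_reg :: "(complex \<Rightarrow> complex) \<Rightarrow> real \<Rightarrow> complex \<Rightarrow> complex" where
  "pot_reg f \<delta> w = (LINT z:\<Omega>|lborel. (cnj z - f z) * cauchy_reg \<delta> (w - z)) - of_real (bump_moment \<delta>)"

text \<open>Differentiation turns the kernel into the bump, which is supported in a disc inside
  \<Omega>. There cnj z and f z both have the mean value property, so the density is reproduced up
  to the mass. The other derivative is left unspecified: differentiability is all that is wanted of
  it.\<close>

lemma wirtinger_pot_reg:
  assumes f: "f \<in> bergman_space \<Omega>" and \<delta>: "0 < \<delta>" "\<delta> < bdist w"
  shows "\<exists>b. wirtinger (pot_reg f \<delta>) (of_real bump_mass * (cnj w - f w)) b w"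
proof -
  have hf: "f holomorphic_on \<Omega>" and f2: "f \<in> L2_on \<Omega>"
    using f by (auto simp: bergman_space_def)
  define \<phi> where "\<phi> = (\<lambda>z. indicator \<Omega> z *\<^sub>R (cnj z - f z))"
  have \<phi>: "integrable lborel \<phi>"
    using L2_integrable[OF L2_diff[OF cnj_in_L2 f2]] by (simp add: \<phi>_def set_integrable_def)
  have eq: "(LINT z:\<Omega>|lborel. (cnj z - f z) * G (w - z)) = (LINT z|lborel. \<phi> z * G (w - z))" for G w
    by (simp add: \<phi>_def set_lebesgue_integral_def)
  have cont: "continuous_on UNIV (\<lambda>y. complex_of_real (bump \<delta> y))"
    "continuous_on UNIV (cauchy_reg_bar \<delta>)"
    by (intro continuous_on_of_real continuous_on_bump continuous_on_cauchy_reg_bar \<delta>)+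
  have n1: "cmod (complex_of_real (bump \<delta> y)) \<le> 2 / \<delta>\<^sup>2" for y
    using bump_le[OF \<delta>(1), of y] bump_nonneg[of \<delta> y] by simp
  have "1 / \<delta>\<^sup>2 \<le> 2 / \<delta>\<^sup>2"
    by (intro divide_right_mono) auto
  then have n2: "cmod (cauchy_reg_bar \<delta> y) \<le> 2 / \<delta>\<^sup>2" for y
    using norm_cauchy_reg_bar_le[OF \<delta>(1)] order_trans by blast
  have W: "wirtinger (\<lambda>w. LINT z|lborel. \<phi> z * cauchy_reg \<delta> (w - z))
      (LINT z|lborel. \<phi> z * complex_of_real (bump \<delta> (w - z)))
      (LINT z|lborel. \<phi> z * cauchy_reg_bar \<delta> (w - z)) w"
    by (rule wirtinger_convolution[OF \<phi> wirtinger_cauchy_reg[OF \<delta>(1)]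
        borel_measurable_continuous_onI[OF cont(1)] n1 borel_measurable_continuous_onI[OF cont(2)] n2
        norm_cauchy_reg_le[OF \<delta>(1)]])
  have A: "(LINT z|lborel. \<phi> z * complex_of_real (bump \<delta> (w - z)))
      = of_real bump_mass * (cnj w - f w)"
  proof -
    let ?R = "bdist w"
    have hfB: "f holomorphic_on ball w ?R"
      using hf ball_bdist holomorphic_on_subset by blast
    have "(LINT z|lborel. \<phi> z * complex_of_real (bump \<delta> (w - z)))
       = (LINT z:ball w ?R|lborel. (cnj z - f z) * complex_of_real (bump \<delta> (z - w)))"
      unfolding set_lebesgue_integral_def
    proof (intro Bochner_Integration.integral_cong refl)
      fix z
      show "\<phi> z * complex_of_real (bump \<delta> (w - z))
        = indicat_real (ball w ?R) z *\<^sub>R ((cnj z - f z) * complex_of_real (bump \<delta> (z - w)))"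
        using ball_bdist[of w] \<delta>
        by (auto simp: \<phi>_def indicator_def bump_minus dist_norm norm_minus_commute bump_eq_0)
    qed
    also have "\<dots> = cnj w * of_real bump_mass - f w * of_real bump_mass"
      unfolding left_diff_distrib
      using set_integrable_continuous_bump[OF \<delta>, of w cnj]
        set_integrable_continuous_bump[OF \<delta>, of w f]
        holomorphic_on_imp_continuous_on[OF hfB]
        bump_mean_value_cnj[OF holomorphic_on_ident \<delta>, of w] bump_mean_value[OF hfB \<delta>]
      by (subst set_integral_diff) (auto intro: continuous_intros)
    finally show ?thesis
      by (simp add: algebra_simps)
  qed
  show ?thesis
    using wirtinger_diff[OF W wirtinger_const[of "of_real (bump_moment \<delta>)"]]
    unfolding A pot_reg_def[abs_def] eq by auto
qed

text \<open>Outside the disc of radius \<open>bdist w\<close> both kernels equal 1 / cnj (w - z), so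
  the comparison is the local identity \<open>cauchy_reg_independent\<close>.\<close>

lemma pot_reg_independent:
  assumes f: "f \<in> bergman_space \<Omega>" and \<delta>: "0 < \<delta>" "\<delta> < bdist w" "0 < \<epsilon>" "\<epsilon> < bdist w"
  shows "pot_reg f \<delta> w = pot_reg f \<epsilon> w"
proof -
  have hf: "f holomorphic_on \<Omega>" and f2: "f \<in> L2_on \<Omega>"
    using f by (auto simp: bergman_space_def)
  let ?R = "bdist w"
  have hfB: "f holomorphic_on ball w ?R"
    using hf ball_bdist holomorphic_on_subset by blast
  have I: "set_integrable lborel \<Omega> (\<lambda>z. (cnj z - f z) * cauchy_reg \<eta> (w - z))" if "\<eta> > 0" for \<eta>
  proof (rule L2_times_L2[OF L2_diff[OF cnj_in_L2 f2]])
    show "(\<lambda>z. cauchy_reg \<eta> (w - z)) \<in> L2_on \<Omega>"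
      using norm_cauchy_reg_le[OF that]
      by (intro L2_bounded_continuous[of _ "2 / \<eta>"]
          continuous_on_compose2[OF continuous_on_cauchy_reg[OF that, of UNIV]] continuous_intros) auto
  qed
  have "(LINT z:\<Omega>|lborel. (cnj z - f z) * cauchy_reg \<delta> (w - z))
      - (LINT z:\<Omega>|lborel. (cnj z - f z) * cauchy_reg \<epsilon> (w - z))
     = (LINT z:\<Omega>|lborel. (cnj z - f z) * (cauchy_reg \<delta> (w - z) - cauchy_reg \<epsilon> (w - z)))"
    unfolding right_diff_distrib by (rule set_integral_diff(2)[OF I I, symmetric]) (use \<delta> in auto)
  also have "\<dots> = (LINT z:ball w ?R|lborel. (cnj z - f z) * (cauchy_reg \<delta> (w - z) - cauchy_reg \<epsilon> (w - z)))"
    unfolding set_lebesgue_integral_def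
  proof (intro Bochner_Integration.integral_cong refl)
    fix z
    show "indicat_real \<Omega> z *\<^sub>R ((cnj z - f z) * (cauchy_reg \<delta> (w - z) - cauchy_reg \<epsilon> (w - z)))
      = indicat_real (ball w ?R) z *\<^sub>R ((cnj z - f z) * (cauchy_reg \<delta> (w - z) - cauchy_reg \<epsilon> (w - z)))"
      using ball_bdist[of w] \<delta>
      by (auto simp: indicator_def dist_norm norm_minus_commute cauchy_reg_eq)
  qed
  also have "\<dots> = of_real (bump_moment \<delta> - bump_moment \<epsilon>)"
    by (rule cauchy_reg_independent[OF hfB \<delta>])
  finally show ?thesis
    by (simp add: pot_reg_def algebra_simps)
qed

text \<open>The candidate for h, complex valued until \<open>hpot_real\<close>. The radius has to
  shrink towards the boundary, yet near each point it may be replaced by a constant one.\<close>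

definition hpot :: "(complex \<Rightarrow> complex) \<Rightarrow> complex \<Rightarrow> complex" where
  "hpot f w = of_real ((cmod w)\<^sup>2) - pot_reg f (bdist w / 2) w / of_real bump_mass"

lemma wirtinger_hpot:
  assumes f: "f \<in> bergman_space \<Omega>" and w: "w \<in> \<Omega>"
  shows "\<exists>b. wirtinger (hpot f) (f w) b w"
proof -
  \<comment> \<open>Since \<open>bdist\<close> is 1-Lipschitz, every x within \<open>bdist w\<close>
    / 4 of w has \<open>bdist x\<close> > \<open>bdist w\<close> / 4, so this one radius is
    admissible at all of them.\<close>
  define \<delta> where "\<delta> = bdist w / 4"
  have \<delta>: "0 < \<delta>" "\<delta> < bdist w"
    using bdist_pos[OF w] by (auto simp: \<delta>_def)
  obtain b where b: "wirtinger (pot_reg f \<delta>) (of_real bump_mass * (cnj w - f w)) b w"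
    using wirtinger_pot_reg[OF f \<delta>] by blast
  have "wirtinger (\<lambda>w. of_real ((cmod w)\<^sup>2) - pot_reg f \<delta> w * (1 / of_real bump_mass))
    (cnj w - (of_real bump_mass * (cnj w - f w) * (1 / of_real bump_mass) + pot_reg f \<delta> w * 0))
    (w - (b * (1 / of_real bump_mass) + pot_reg f \<delta> w * 0)) w"
    by (intro wirtinger_diff wirtinger_norm_sq wirtinger_mult wirtinger_const b)
  moreover have "cnj w - (of_real bump_mass * (cnj w - f w) * (1 / of_real bump_mass) + pot_reg f \<delta> w * 0) = f w"
    using bump_mass_pos by simp
  ultimately have "wirtinger (\<lambda>w. of_real ((cmod w)\<^sup>2) - pot_reg f \<delta> w * (1 / of_real bump_mass)) (f w)
    (w - (b * (1 / of_real bump_mass) + pot_reg f \<delta> w * 0)) w"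
    by simp
  then have "wirtinger (hpot f) (f w) (w - (b * (1 / of_real bump_mass) + pot_reg f \<delta> w * 0)) w"
  proof (rule wirtinger_transform_open[of _ _ _ _ "ball w \<delta>"])
    fix x assume x: "x \<in> ball w \<delta>"
    then have "\<bar>bdist w - bdist x\<bar> < \<delta>"
      using bdist_lipschitz[of w x] by simp
    then have "bdist x > \<delta>" "bdist x / 2 < bdist x" "0 < bdist x / 2"
      using \<delta> unfolding \<delta>_def by linarith+
    then have "pot_reg f \<delta> x = pot_reg f (bdist x / 2) x"
      using pot_reg_independent[OF f] \<delta> by blast
    then show "of_real ((cmod x)\<^sup>2) - pot_reg f \<delta> x * (1 / of_real bump_mass) = hpot f x"
      by (simp add: hpot_def)
  qed (use \<delta> in auto)
  then show ?thesis by blast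
qed

text \<open>Subtracting a primitive of f removes the derivative in z; the conjugate of the rest then
  has no derivative in cnj z and is holomorphic.\<close>

lemma hpot_local_form:
  assumes f: "f \<in> bergman_space \<Omega>" and B: "ball z r \<subseteq> \<Omega>"
  obtains F G where "\<And>w. w \<in> ball z r \<Longrightarrow> (F has_field_derivative f w) (at w)"
    "G holomorphic_on ball z r" "\<And>w. w \<in> ball z r \<Longrightarrow> hpot f w = F w + cnj (G w)"
proof -
  have "f holomorphic_on ball z r"
    using f B by (auto simp: bergman_space_def intro: holomorphic_on_subset)
  then obtain F where F: "\<And>w. w \<in> ball z r \<Longrightarrow> (F has_field_derivative f w) (at w)"
    using holomorphic_convex_primitive' by (metis at_within_open convex_ball open_ball)
  define G where "G = (\<lambda>w. cnj (hpot f w - F w))"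
  have "\<exists>g. (G has_field_derivative g) (at w)" if w: "w \<in> ball z r" for w
  proof -
    obtain b where "wirtinger (hpot f) (f w) b w"
      using wirtinger_hpot[OF f] B w by blast
    from wirtinger_cnj[OF wirtinger_diff[OF this wirtinger_DERIV[OF F[OF w]]]]
    have "wirtinger G (cnj b) 0 w"
      by (simp add: G_def)
    then show ?thesis
      using wirtinger_imp_DERIV by blast
  qed
  then have "G holomorphic_on ball z r"
    using holomorphic_on_open by blast
  then show ?thesis
    using F by (intro that[of F G]) (auto simp: G_def)
qed

end

section \<open>The maximum principle\<close>

text \<open>The modulus of exp Q is exp (Re Q), so the maximum modulus principle for exp Q gives the
  claim.\<close>

lemma Re_holomorphic_max_const:
  assumes Q: "Q holomorphic_on ball a r" and max: "\<And>w. w \<in> ball a r \<Longrightarrow> Re (Q w) \<le> Re (Q a)"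
    and w: "w \<in> ball a r"
  shows "Re (Q w) = Re (Q a)"
proof -
  have "r > 0"
    using w by (metis mem_ball dist_not_less_zero le_less_trans not_le zero_le_dist order_less_le_trans)
  then have a: "a \<in> ball a r" by simp
  have "(\<lambda>z. exp (Q z)) constant_on ball a r"
    by (rule maximum_modulus_principle[of _ _ "ball a r" a])
       (use a max in \<open>auto intro!: holomorphic_intros Q\<close>)
  then have "exp (Q w) = exp (Q a)"
    using a w unfolding constant_on_def by metis
  then have "exp (Re (Q w)) = exp (Re (Q a))"
    by (metis norm_exp_eq_Re)
  then show ?thesis by simp
qed

context bounded_domain
begin

text \<open>A sequence on which v \<ge> e > 0 cannot approach the frontier, where v tends to 0; its
  limits therefore stay in \<Omega>.\<close>

lemma compact_superlevel:
  assumes v: "continuous_on \<Omega> v" and v0: "\<And>\<zeta>. \<zeta> \<in> frontier \<Omega> \<Longrightarrow> (v \<longlongrightarrow> 0) (at \<zeta> within \<Omega>)"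
    and e: "(e::real) > 0"
  shows "compact {z \<in> \<Omega>. v z \<ge> e}"
  unfolding compact_eq_bounded_closed closed_sequential_limits
proof (intro conjI allI impI)
  show "bounded {z \<in> \<Omega>. v z \<ge> e}"
    by (rule bounded_subset[OF bounded_\<Omega>]) auto
  fix x l assume x: "(\<forall>n. x n \<in> {z \<in> \<Omega>. v z \<ge> e}) \<and> x \<longlonglongrightarrow> l"
  then have xO: "x n \<in> \<Omega>" and xe: "v (x n) \<ge> e" for n
    by auto
  have xl: "x \<longlonglongrightarrow> l" using x ..
  have cl: "l \<in> closure \<Omega>"
    unfolding closure_sequential using xO xl by (intro exI[of _ x]) simp
  show "l \<in> {z \<in> \<Omega>. v z \<ge> e}"
  proof (cases "l \<in> \<Omega>")
    case True
    have "isCont v l"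
      using v True open_\<Omega> continuous_on_eq_continuous_at by blast
    then have "(\<lambda>n. v (x n)) \<longlonglongrightarrow> v l"
      using xl by (rule isCont_tendsto_compose)
    then have "e \<le> v l"
      by (rule LIMSEQ_le_const) (use xe in auto)
    with True show ?thesis by simp
  next
    case False
    then have l: "l \<in> frontier \<Omega>"
      using cl open_\<Omega> by (simp add: frontier_def interior_open)
    have "x n \<in> \<Omega> \<and> x n \<noteq> l" for n
      using xO[of n] False by auto
    then have "filterlim x (at l within \<Omega>) sequentially"
      unfolding filterlim_at using xl by simp
    with v0[OF l] have "(\<lambda>n. v (x n)) \<longlonglongrightarrow> 0"
      by (rule filterlim_compose)
    then have "e \<le> 0"
      by (rule LIMSEQ_le_const) (use xe in \<open>auto simp: comp_def\<close>)
    with e show ?thesis by simp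
  qed
qed

text \<open>Among the maximum points of \<open>v\<close> the one with the largest real part is taken, so that \<open>v\<close>
  cannot be constant near it; this replaces the usual connectedness argument.\<close>

lemma maximum_principle:
  assumes v: "continuous_on \<Omega> v" and v0: "\<And>\<zeta>. \<zeta> \<in> frontier \<Omega> \<Longrightarrow> (v \<longlongrightarrow> 0) (at \<zeta> within \<Omega>)"
    and c: "(c::real) \<ge> 0"
    and loc: "\<And>z. z \<in> \<Omega> \<Longrightarrow> \<exists>r>0. \<exists>Q. ball z r \<subseteq> \<Omega> \<and> Q holomorphic_on ball z r \<and>
       (\<forall>w\<in>ball z r. v w = Re (Q w) + c * (cmod (w - z))\<^sup>2)"
    and z: "z \<in> \<Omega>"
  shows "v z \<le> 0"
proof (rule ccontr)
  assume neg: "\<not> v z \<le> 0"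
  let ?S = "{x \<in> \<Omega>. v x \<ge> v z}"
  have "compact ?S"
    using neg by (intro compact_superlevel v v0) auto
  moreover have "?S \<noteq> {}" "continuous_on ?S v"
    using z by (auto intro: continuous_on_subset[OF v])
  ultimately have "\<exists>a\<in>?S. \<forall>x\<in>?S. v x \<le> v a"
    by (rule continuous_attains_sup)
  then obtain a where a: "a \<in> ?S" "\<And>x. x \<in> ?S \<Longrightarrow> v x \<le> v a"
    by (elim bexE) (rule that, auto)
  have max: "v x \<le> v a" if "x \<in> \<Omega>" for x
    using a that by (cases "v x \<ge> v z") auto
  let ?M = "{x \<in> \<Omega>. v x \<ge> v a}"
  have "compact ?M"
    using neg a by (intro compact_superlevel v v0) auto
  moreover have "?M \<noteq> {}" "continuous_on ?M Re"
    using a by (auto intro: continuous_intros)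
  ultimately have "\<exists>b\<in>?M. \<forall>x\<in>?M. Re x \<le> Re b"
    by (rule continuous_attains_sup)
  then obtain b where b: "b \<in> ?M" "\<And>x. x \<in> ?M \<Longrightarrow> Re x \<le> Re b"
    by (elim bexE) (rule that, auto)
  have vb: "v b = v a" and bO: "b \<in> \<Omega>"
    using b(1) max[of b] by auto
  obtain r Q where r: "r > 0" "ball b r \<subseteq> \<Omega>" and Q: "Q holomorphic_on ball b r"
    and eq: "\<And>w. w \<in> ball b r \<Longrightarrow> v w = Re (Q w) + c * (cmod (w - b))\<^sup>2"
    using loc[OF bO] by blast
  \<comment> \<open>The quadratic term is nonnegative and vanishes at b, so Re Q also has its
    maximum at b and is constant. Then every nearby point, in particular one to the right of b, is
    again a maximum point of v.\<close>
  have le: "Re (Q w) \<le> Re (Q b)" if "w \<in> ball b r" for w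
    using eq[OF that] eq[of b] max[of w] r that vb mult_nonneg_nonneg[OF c zero_le_power2[of "cmod (w - b)"]]
    by auto
  define w where "w = b + of_real (r / 2)"
  have w: "w \<in> ball b r"
    using r by (simp add: w_def dist_norm)
  have "v w \<ge> v a"
    using eq[OF w] eq[of b] Re_holomorphic_max_const[OF Q le w] r vb
      mult_nonneg_nonneg[OF c zero_le_power2[of "cmod (w - b)"]] by auto
  then have "Re w \<le> Re b"
    using b(2) w r by auto
  then show False
    using r by (simp add: w_def)
qed

lemma hpot_continuous: "f \<in> bergman_space \<Omega> \<Longrightarrow> continuous_on \<Omega> (hpot f)"
  by (intro continuous_at_imp_continuous_on ballI) (use wirtinger_hpot wirtinger_continuous in blast)

text \<open>Im (F + cnj G) is the real part of the holomorphic function -i (F - G) and has boundary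
  values 0; the maximum principle with c = 0 is applied to it with both signs.\<close>

lemma hpot_real:
  assumes f: "f \<in> bergman_space \<Omega>"
    and lim: "\<And>\<zeta>. \<zeta> \<in> frontier \<Omega> \<Longrightarrow> (hpot f \<longlongrightarrow> of_real ((cmod \<zeta>)\<^sup>2)) (at \<zeta> within \<Omega>)"
    and z: "z \<in> \<Omega>"
  shows "Im (hpot f z) = 0"
proof -
  have "s * Im (hpot f z) \<le> 0" for s :: real
  proof (rule maximum_principle[of _ 0 z])
    show "continuous_on \<Omega> (\<lambda>z. s * Im (hpot f z))"
      by (intro continuous_intros hpot_continuous f)
    show "((\<lambda>z. s * Im (hpot f z)) \<longlongrightarrow> 0) (at \<zeta> within \<Omega>)" if "\<zeta> \<in> frontier \<Omega>" for \<zeta>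
      using tendsto_mult[OF tendsto_const[of s] tendsto_Im[OF lim[OF that]]] by simp
    show "\<exists>r>0. \<exists>Q. ball z r \<subseteq> \<Omega> \<and> Q holomorphic_on ball z r \<and>
       (\<forall>w\<in>ball z r. s * Im (hpot f w) = Re (Q w) + 0 * (cmod (w - z))\<^sup>2)" if z: "z \<in> \<Omega>" for z
    proof -
      obtain r where r: "r > 0" "ball z r \<subseteq> \<Omega>"
        using open_\<Omega> z open_contains_ball by blast
      obtain F G where F: "\<And>w. w \<in> ball z r \<Longrightarrow> (F has_field_derivative f w) (at w)"
        and G: "G holomorphic_on ball z r"
        and h: "\<And>w. w \<in> ball z r \<Longrightarrow> hpot f w = F w + cnj (G w)"
        using hpot_local_form[OF f r(2)] by blast
      have "F holomorphic_on ball z r"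
        using F holomorphic_on_open by blast
      then have "(\<lambda>w. - \<i> * of_real s * (F w - G w)) holomorphic_on ball z r"
        by (intro holomorphic_intros G)
      then show ?thesis
        using r h by (intro exI[of _ r] conjI exI[of _ "\<lambda>w. - \<i> * of_real s * (F w - G w)"])
          (auto simp: algebra_simps)
    qed
  qed (use z in auto)
  from this[of 1] this[of "-1"] show ?thesis by simp
qed

text \<open>Realness says F + cnj G = G + cnj F; comparing derivatives in z gives G' = f. The
  symmetric choice (F + G) / 2 is then a primitive of f whose doubled real part is the
  potential.\<close>

lemma primitive_plus_conjugate_hpot:
  assumes f: "f \<in> bergman_space \<Omega>" and real: "\<And>z. z \<in> \<Omega> \<Longrightarrow> Im (hpot f z) = 0"
  shows "primitive_plus_conjugate \<Omega> f (\<lambda>z. Re (hpot f z))"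
  unfolding primitive_plus_conjugate_def
proof
  fix z assume "z \<in> \<Omega>"
  then obtain r where r: "r > 0" "ball z r \<subseteq> \<Omega>"
    using open_\<Omega> open_contains_ball by blast
  obtain F G where F: "\<And>w. w \<in> ball z r \<Longrightarrow> (F has_field_derivative f w) (at w)"
    and G: "G holomorphic_on ball z r"
    and h: "\<And>w. w \<in> ball z r \<Longrightarrow> hpot f w = F w + cnj (G w)"
    using hpot_local_form[OF f r(2)] by blast
  have sym: "F w + cnj (G w) = G w + cnj (F w)" if "w \<in> ball z r" for w
    using real[of w] h[OF that] r that by (auto simp: complex_eq_iff)
  have G': "(G has_field_derivative f w) (at w)" if w: "w \<in> ball z r" for w
  proof -
    have dG: "(G has_field_derivative deriv G w) (at w)"
      using holomorphic_derivI[OF G _ w] by simp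
    have "wirtinger (\<lambda>w. (F w + cnj (G w)) - (G w + cnj (F w)))
        ((f w + cnj 0) - (deriv G w + cnj 0)) ((0 + cnj (deriv G w)) - (0 + cnj (f w))) w"
      by (intro wirtinger_diff wirtinger_add wirtinger_cnj wirtinger_DERIV F[OF w] dG)
    then have "wirtinger (\<lambda>w. 0) ((f w + cnj 0) - (deriv G w + cnj 0))
        ((0 + cnj (deriv G w)) - (0 + cnj (f w))) w"
      by (rule wirtinger_transform_open[OF _ open_ball w]) (simp add: sym)
    from wirtinger_const_unique(1)[OF this] dG show ?thesis
      by simp
  qed
  have "((\<lambda>w. (F w + G w) / 2) has_field_derivative f w) (at w) \<and>
     complex_of_real (Re (hpot f w)) = (F w + G w) / 2 + cnj ((F w + G w) / 2)" if w: "w \<in> ball z r" for w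
  proof
    show "((\<lambda>w. (F w + G w) / 2) has_field_derivative f w) (at w)"
      by (rule DERIV_cong, rule DERIV_cdivide, rule DERIV_add[OF F[OF w] G'[OF w]]) simp
    have "Im (F w) = Im (G w)"
      using arg_cong[OF sym[OF w], of Im] by simp
    then show "complex_of_real (Re (hpot f w)) = (F w + G w) / 2 + cnj ((F w + G w) / 2)"
      using h[OF w] by (simp add: complex_eq_iff)
  qed
  then show "\<exists>r>0. \<exists>F. ball z r \<subseteq> \<Omega> \<and>
        (\<forall>w\<in>ball z r. (F has_field_derivative f w) (at w) \<and>
                       complex_of_real (Re (hpot f w)) = F w + cnj (F w))"
    using r by (intro exI[of _ r] conjI exI[of _ "\<lambda>w. (F w + G w) / 2"]) auto
qed

end

section \<open>Square roots of Moebius transformations\<close>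

text \<open>Integrate along an arbitrarily chosen path p z from a base point. For y near x, the loop
  made of p x, the segment to y and the reversed p y has integral 0, so the function differs from a
  local primitive by a constant.\<close>

lemma primitive_of_closed_integrals_zero:
  assumes S: "open S" "connected S" and f: "f holomorphic_on S"
    and 0: "\<And>\<gamma>. valid_path \<gamma> \<Longrightarrow> path_image \<gamma> \<subseteq> S \<Longrightarrow> pathfinish \<gamma> = pathstart \<gamma> \<Longrightarrow>
      contour_integral \<gamma> f = 0"
  shows "\<exists>g. \<forall>z\<in>S. (g has_field_derivative f z) (at z)"
proof (cases "S = {}")
  case False
  then obtain a where a: "a \<in> S" by blast
  have "\<forall>z\<in>S. \<exists>p. valid_path p \<and> path_image p \<subseteq> S \<and> pathstart p = a \<and> pathfinish p = z"
    using connected_open_polynomial_connected[OF S a] valid_path_polynomial_function by metis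
  then obtain p where p: "\<And>z. z \<in> S \<Longrightarrow> valid_path (p z) \<and> path_image (p z) \<subseteq> S \<and>
      pathstart (p z) = a \<and> pathfinish (p z) = z"
    by metis
  have int: "f contour_integrable_on \<gamma>" if "valid_path \<gamma>" "path_image \<gamma> \<subseteq> S" for \<gamma>
    using contour_integrable_holomorphic_simple[OF f S(1) that] .
  have "((\<lambda>z. contour_integral (p z) f) has_field_derivative f x) (at x)" if x: "x \<in> S" for x
  proof -
    obtain r where r: "r > 0" "ball x r \<subseteq> S"
      using S(1) x open_contains_ball by blast
    have "f holomorphic_on ball x r"
      using f r(2) by (rule holomorphic_on_subset)
    then obtain F where F: "\<And>w. w \<in> ball x r \<Longrightarrow> (F has_field_derivative f w) (at w)"
      using holomorphic_convex_primitive' by (metis at_within_open convex_ball open_ball)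
    have eq: "contour_integral (p y) f = contour_integral (p x) f + (F y - F x)" if y: "y \<in> ball x r" for y
    proof -
      have yS: "y \<in> S" and seg: "closed_segment x y \<subseteq> ball x r"
        using r y by (auto simp: closed_segment_subset)
      have I: "(f has_contour_integral (F y - F x)) (linepath x y)"
        using contour_integral_primitive[of "ball x r" F f "linepath x y"] F seg
        by (auto intro: has_field_derivative_at_within)
      let ?c = "linepath x y +++ reversepath (p y)"
      have c: "valid_path ?c" "path_image ?c \<subseteq> S" "pathstart ?c = x" "pathfinish ?c = a"
        using p[OF yS] seg r(2) by (auto simp: path_image_join)
      have "0 = contour_integral (p x +++ ?c) f"
        using p[OF x] c by (intro 0[symmetric]) (auto simp: path_image_join)
      also have "\<dots> = contour_integral (p x) f + contour_integral ?c f"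
        using p[OF x] c int by (intro contour_integral_join) auto
      also have "contour_integral ?c f = contour_integral (linepath x y) f + contour_integral (reversepath (p y)) f"
        using p[OF yS] has_contour_integral_integrable[OF I]
          contour_integrable_reversepath[of "p y" f] int[of "p y"]
        by (intro contour_integral_join) auto
      also have "contour_integral (reversepath (p y)) f = - contour_integral (p y) f"
        using p[OF yS] by (intro contour_integral_reversepath) auto
      finally show ?thesis
        using contour_integral_unique[OF I] by (simp add: algebra_simps)
    qed
    have "((\<lambda>y. contour_integral (p x) f + (F y - F x)) has_field_derivative f x) (at x)"
      using F[of x] r by (auto intro!: derivative_eq_intros)
    then show ?thesis
    proof (rule has_field_derivative_transform_within_open)
      show "open (ball x r)" "x \<in> ball x r"
        using r by auto
    qed (rule eq[symmetric])
  qed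
  then show ?thesis by blast
qed auto

text \<open>The logarithmic derivative of (z - a) / (z - b) has vanishing periods, so its primitive
  g is a logarithm up to a constant, and exp (g / 2) is a square root up to the factor
  \<open>csqrt c\<close>.\<close>

lemma holomorphic_sqrt_mobius:
  assumes S: "open S" "connected S" and K: "connected K" "a \<in> K" "b \<in> K" "S \<inter> K = {}"
  obtains s where "s holomorphic_on S" "\<And>z. z \<in> S \<Longrightarrow> (s z)\<^sup>2 = (z - a) / (z - b)"
proof -
  have ab: "z \<noteq> a" "z \<noteq> b" if "z \<in> S" for z
    using that K by auto
  define f where "f = (\<lambda>z. 1 / (z - a) - 1 / (z - b))"
  have hf: "f holomorphic_on S"
    unfolding f_def using ab by (auto intro!: holomorphic_intros)
  have "\<exists>g. \<forall>z\<in>S. (g has_field_derivative f z) (at z)"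
  proof (rule primitive_of_closed_integrals_zero[OF S hf])
    fix \<gamma> assume \<gamma>: "valid_path \<gamma>" "path_image \<gamma> \<subseteq> S" "pathfinish \<gamma> = pathstart \<gamma>"
    have n: "a \<notin> path_image \<gamma>" "b \<notin> path_image \<gamma>" "K \<inter> path_image \<gamma> = {}"
      using \<gamma> K by auto
    have "(f has_contour_integral (2 * pi * \<i> * winding_number \<gamma> a - 2 * pi * \<i> * winding_number \<gamma> b)) \<gamma>"
      unfolding f_def
      by (intro has_contour_integral_diff has_contour_integral_winding_number \<gamma> n)
    moreover have "winding_number \<gamma> a = winding_number \<gamma> b"
      by (rule winding_number_eq[OF valid_path_imp_path[OF \<gamma>(1)] \<gamma>(3) K(2,3,1) n(3)])
    ultimately show "contour_integral \<gamma> f = 0"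
      by (simp add: contour_integral_unique)
  qed
  then obtain g where g: "\<And>z. z \<in> S \<Longrightarrow> (g has_field_derivative f z) (at z)"
    by blast
  have "((\<lambda>z. (z - a) / (z - b) * exp (- g z)) has_field_derivative 0) (at z)" if z: "z \<in> S" for z
  proof -
    have m: "((\<lambda>z. (z - a) / (z - b)) has_field_derivative (a - b) / (z - b)\<^sup>2) (at z)"
      using ab[OF z] by (auto intro!: derivative_eq_intros simp: power2_eq_square)
    have e: "((\<lambda>z. exp (- g z)) has_field_derivative exp (- g z) * (- f z)) (at z)"
      using g[OF z] by (auto intro!: derivative_eq_intros)
    have fm: "f z * ((z - a) / (z - b)) = (a - b) / (z - b)\<^sup>2"
      using ab[OF z] unfolding f_def by (simp add: divide_simps power2_eq_square)
    have "(a - b) / (z - b)\<^sup>2 * exp (- g z) + (exp (- g z) * (- f z)) * ((z - a) / (z - b)) = 0"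
      unfolding fm[symmetric] by (simp add: algebra_simps)
    then show ?thesis
      using DERIV_mult[OF m e] by (simp only:)
  qed
  note D = this
  have "continuous_on S (\<lambda>z. (z - a) / (z - b) * exp (- g z))"
    by (rule DERIV_continuous_on) (rule has_field_derivative_at_within[OF D])
  then have "(\<lambda>z. (z - a) / (z - b) * exp (- g z)) constant_on S"
    by (rule DERIV_zero_connected_constant_on[OF S(2,1) finite.emptyI]) (use D in simp)
  then obtain c where c: "\<And>z. z \<in> S \<Longrightarrow> (z - a) / (z - b) * exp (- g z) = c"
    unfolding constant_on_def by blast
  show ?thesis
  proof (rule that)
    have "g holomorphic_on S"
      using g S(1) holomorphic_on_open by blast
    then show "(\<lambda>z. csqrt c * exp (g z / 2)) holomorphic_on S"
      by (intro holomorphic_intros) auto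
    show "(csqrt c * exp (g z / 2))\<^sup>2 = (z - a) / (z - b)" if "z \<in> S" for z
    proof -
      have "(csqrt c * exp (g z / 2))\<^sup>2 = c * exp (g z)"
        by (simp add: power_mult_distrib flip: exp_double)
      also have "\<dots> = (z - a) / (z - b)"
        unfolding c[OF that, symmetric] by (simp add: exp_minus)
      finally show ?thesis .
    qed
  qed
qed

text \<open>With t = s z / s w the left side is t^2 - 1 = (t - 1) (t + 1); the formula thus measures
  how far t is from both 1 and -1.\<close>

lemma sqrt_mobius_ratio:
  fixes a b w z :: complex
  assumes "z \<noteq> b" "w \<noteq> b" "w \<noteq> a"
  shows "((z - a) / (z - b)) / ((w - a) / (w - b)) - 1 = (z - w) * (a - b) / ((z - b) * (w - a))"
  using assms by (simp add: divide_simps) (simp add: algebra_simps)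

text \<open>As \<open>s\<^sup>2\<close> is injective, \<open>- s w\<close> and a whole disc around it are omitted by \<open>s\<close>.\<close>

lemma sqrt_mobius_omits:
  assumes s: "continuous_on S s" "\<And>z. z \<in> S \<Longrightarrow> (s z)\<^sup>2 = (z - a) / (z - b)"
    and nS: "a \<notin> S" "b \<notin> S" and z: "z \<in> S"
    and d: "d = cmod (w - a)" "ball w d \<subseteq> S" "d > 0" "8 * d \<le> cmod (a - b)"
  shows "cmod (s z / s w + 1) \<ge> 1 / 6"
proof -
  let ?A = "cmod (a - b)"
  have w: "w \<in> S" using d by auto
  have ne: "x \<noteq> a" "x \<noteq> b" if "x \<in> S" for x
    using that nS by auto
  have s0: "s x \<noteq> 0" if "x \<in> S" for x
    using s(2)[OF that] ne[OF that] by auto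
  have t2: "(s x / s w)\<^sup>2 - 1 = (x - w) * (a - b) / ((x - b) * (w - a))" if "x \<in> S" for x
    using sqrt_mobius_ratio[of x b w a] ne[OF that] ne[OF w] s(2)[OF that] s(2)[OF w]
    by (simp add: power_divide)
  have t2n: "cmod ((s x / s w)\<^sup>2 - 1) = cmod (x - w) * ?A / (cmod (x - b) * d)" if "x \<in> S" for x
    unfolding t2[OF that] by (simp add: norm_mult norm_divide d(1))
  have tri: "cmod (x - a) \<le> cmod (x - w) + d" "cmod (w - b) \<le> d + ?A"
    "?A \<le> cmod (x - a) + cmod (x - b)" "cmod (x - b) \<le> cmod (x - w) + cmod (w - b)" for x
    using norm_triangle_ineq[of "x - w" "w - a"] norm_triangle_ineq[of "w - a" "a - b"]
      norm_triangle_ineq4[of "x - b" "x - a"] norm_triangle_ineq[of "x - w" "w - b"]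
    by (auto simp: d(1))
  show ?thesis
  proof (cases "cmod (z - w) < d / 2")
    case True
    \<comment> \<open>On the disc of half the radius, t^2 stays within distance 1 of 1, so t never
      meets the imaginary axis. Starting from t = 1 at w, it remains in the right half-plane, away
      from -1.\<close>
    have Re_t: "Re (s x / s w) \<noteq> 0" if x: "x \<in> ball w (d / 2)" for x
    proof
      assume 0: "Re (s x / s w) = 0"
      have xw: "cmod (x - w) < d / 2"
        using x by (simp add: dist_norm norm_minus_commute)
      then have xS: "x \<in> S"
        using d(3) by (intro subsetD[OF d(2)]) (simp add: dist_norm norm_minus_commute)
      have "cmod (x - b) > ?A / 2"
        using tri(1)[of x] tri(3)[of x] xw d by linarith
      then have "cmod (x - w) * ?A < d / 2 * (2 * cmod (x - b))"
        using xw d by (intro mult_strict_mono) auto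
      then have "cmod ((s x / s w)\<^sup>2 - 1) < 1"
        unfolding t2n[OF xS] using d ne[OF xS] by (simp add: divide_simps mult.commute)
      then have "\<bar>Re ((s x / s w)\<^sup>2 - 1)\<bar> < 1"
        using abs_Re_le_cmod order_le_less_trans by blast
      then have "Re ((s x / s w)\<^sup>2) > 0"
        by simp
      then show False
        using 0 by (simp add: Re_power2 del: Re_divide)
    qed
    have "connected ((\<lambda>x. Re (s x / s w)) ` ball w (d / 2))"
    proof (intro connected_continuous_image continuous_intros)
      show "continuous_on (ball w (d / 2)) s"
        by (rule continuous_on_subset[OF s(1)], rule order_trans[OF subset_ball d(2)])
           (use d(3) in simp)
      show "\<forall>x\<in>ball w (d / 2). s w \<noteq> 0"
        using s0[OF w] by simp
    qed auto
    then have "is_interval ((\<lambda>x. Re (s x / s w)) ` ball w (d / 2))"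
      by (simp add: is_interval_connected_1)
    moreover have "1 \<in> (\<lambda>x. Re (s x / s w)) ` ball w (d / 2)"
      using d s0[OF w] by (intro image_eqI[of _ _ w]) auto
    moreover have zi: "Re (s z / s w) \<in> (\<lambda>x. Re (s x / s w)) ` ball w (d / 2)"
      using True by (intro imageI) (simp add: dist_norm norm_minus_commute)
    moreover have "0 \<notin> (\<lambda>x. Re (s x / s w)) ` ball w (d / 2)"
    proof
      assume "0 \<in> (\<lambda>x. Re (s x / s w)) ` ball w (d / 2)"
      then obtain x where x: "x \<in> ball w (d / 2)" and "0 = Re (s x / s w)"
        by (rule imageE)
      with Re_t[OF x] show False by (rule_tac notE[OF _ sym])
    qed
    ultimately have "Re (s z / s w) \<ge> 0"
      unfolding is_interval_1 by (meson linear zero_le_one)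
    then show ?thesis
      using complex_Re_le_cmod[of "s z / s w + 1"] by (simp del: Re_divide)
  next
    case False
    let ?t = "s z / s w" and ?x = "cmod (z - w)"
    have pos: "cmod (z - b) * d > 0"
      using ne[OF z] d by simp
    have "cmod (z - b) \<le> ?x + 9 / 8 * ?A"
      using tri(2) tri(4)[of z] d by linarith
    \<comment> \<open>With x = |z - w| and A = |a - b|, the bound uses d \<le> A / 8 in the first
      summand and d \<le> 2 x in the second: (1/20 + 9/10) x A \<le> x A.\<close>
    then have "2 / 5 * (cmod (z - b) * d) \<le> 2 / 5 * ((?x + 9 / 8 * ?A) * d)"
      using d by (intro mult_left_mono mult_right_mono) auto
    also have "\<dots> = 2 / 5 * (?x * d) + 9 / 20 * (?A * d)"
      by (simp add: algebra_simps)
    also have "\<dots> \<le> 2 / 5 * (?x * (?A / 8)) + 9 / 20 * (?A * (2 * ?x))"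
      using d False by (intro add_mono mult_left_mono) auto
    also have "\<dots> \<le> ?x * ?A"
      by (simp add: algebra_simps)
    finally have "2 / 5 \<le> cmod (?t\<^sup>2 - 1)"
      unfolding t2n[OF z] using pos by (simp add: pos_le_divide_eq)
    also have "?t\<^sup>2 - 1 = (?t - 1) * (?t + 1)"
      by (simp add: power2_eq_square algebra_simps)
    finally have prod: "2 / 5 \<le> cmod (?t - 1) * cmod (?t + 1)"
      by (simp add: norm_mult)
    show ?thesis
    \<comment> \<open>If t were within 1/6 of -1, the product would be at most 13/36, which is less
      than 2/5.\<close>
    proof (rule ccontr)
      assume "\<not> ?thesis"
      then have l: "cmod (?t + 1) < 1 / 6" by simp
      moreover have "cmod (?t - 1) \<le> cmod (?t + 1) + 2"
        using norm_triangle_ineq4[of "?t + 1" 2] by simp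
      ultimately have "cmod (?t - 1) * cmod (?t + 1) \<le> (1/6 + 2) * (1 / 6)"
        by (intro mult_mono) auto
      with prod show False by simp
    qed
  qed
qed

section \<open>Approximation of the kernel by holomorphic functions\<close>

text \<open>Scale-invariant majorant: its integral over the plane does not depend on the scale \<open>d\<close>.\<close>

definition tail_weight :: "real \<Rightarrow> real \<Rightarrow> real" where
  "tail_weight d r = (if r \<le> d then 1 / (d * r) else d / r ^ 3)"

lemma tail_weight_nonneg: "d > 0 \<Longrightarrow> r \<ge> 0 \<Longrightarrow> tail_weight d r \<ge> 0"
  by (simp add: tail_weight_def)

lemma borel_measurable_tail_weight [measurable]:
  "(\<lambda>z. tail_weight d (cmod (z - a))) \<in> borel_measurable borel"
  unfolding tail_weight_def by measurable

lemma dyadic_bracket: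
  assumes "(x::real) \<ge> 1"
  obtains n where "2 ^ n \<le> x" "x < 2 ^ Suc n"
proof -
  define N where "N = (LEAST n. x < 2 ^ Suc n)"
  obtain m where "x < 2 ^ m"
    using real_arch_pow[of 2 x] by auto
  then have "x < 2 ^ Suc m"
    by (rule less_le_trans) simp
  then have N: "x < 2 ^ Suc N"
    unfolding N_def by (rule LeastI)
  moreover have "2 ^ N \<le> x"
  proof (cases N)
    case (Suc k)
    then have "\<not> x < 2 ^ Suc k"
      using not_less_Least[of k "\<lambda>n. x < 2 ^ Suc n"] by (simp add: N_def)
    then show ?thesis using Suc by simp
  qed (use assms in simp)
  ultimately show ?thesis using that by blast
qed

definition disc_area :: real where "disc_area = unit_ball_vol 2"

lemma emeasure_cball_complex: "r \<ge> 0 \<Longrightarrow> emeasure lborel (cball (a::complex) r) = ennreal (disc_area * r\<^sup>2)"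
  by (simp add: emeasure_cball disc_area_def)

lemma disc_area_nonneg: "disc_area \<ge> 0"
  by (simp add: disc_area_def)

text \<open>In each dyadic shell about a the weight is bounded by a single term of the series. The
  integral is thereby reduced to areas of discs and geometric series, without polar coordinates. At
  z = a division by zero makes the weight 0.\<close>

lemma tail_weight_dyadic_le:
  assumes d: "d > 0"
  shows "ennreal (tail_weight d (cmod (z - a))) \<le>
    (\<Sum>n. ennreal (2 ^ Suc n / d\<^sup>2) * indicator (cball a (d / 2 ^ n)) z) +
    (\<Sum>n. ennreal (1 / (d\<^sup>2 * 8 ^ n)) * indicator (cball a (d * 2 ^ Suc n)) z)"
    (is "_ \<le> (\<Sum>n. ?f n) + (\<Sum>n. ?g n)")
proof -
  let ?r = "cmod (z - a)"
  have sg: "h n \<le> (\<Sum>n. h n)" for h :: "nat \<Rightarrow> ennreal" and n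
    using sum_le_suminf[of h "{n}"] by simp
  consider "?r = 0" | "0 < ?r" "?r \<le> d" | "?r > d"
    using norm_ge_zero[of "z - a"] by linarith
  then show ?thesis
  proof cases
    case 1
    then show ?thesis using d by (simp add: tail_weight_def)
  next
    case 2
    then have "1 \<le> d / ?r" by simp
    then obtain n where n: "2 ^ n \<le> d / ?r" "d / ?r < 2 ^ Suc n"
      by (rule dyadic_bracket)
    have "?r \<le> d / 2 ^ n"
      using n(1) 2 by (simp add: field_simps)
    then have i: "z \<in> cball a (d / 2 ^ n)"
      by (simp add: dist_norm norm_minus_commute)
    have "tail_weight d ?r = d / ?r / d\<^sup>2"
      using 2 d by (simp add: tail_weight_def field_simps power2_eq_square)
    also have "\<dots> \<le> 2 ^ Suc n / d\<^sup>2"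
      using n(2) by (intro divide_right_mono) auto
    finally have "ennreal (tail_weight d ?r) \<le> ?f n"
      using i by (simp add: ennreal_leI del: power_Suc)
    also have "\<dots> \<le> (\<Sum>n. ?f n)" by (rule sg)
    finally show ?thesis
      by (rule order_trans) simp
  next
    case 3
    then have "1 \<le> ?r / d" using d by simp
    then obtain n where n: "2 ^ n \<le> ?r / d" "?r / d < 2 ^ Suc n"
      by (rule dyadic_bracket)
    have "?r \<le> d * 2 ^ Suc n"
      using n(2) d by (simp add: field_simps)
    then have i: "z \<in> cball a (d * 2 ^ Suc n)"
      by (simp add: dist_norm norm_minus_commute)
    have dn: "d * 2 ^ n \<le> ?r"
      using n(1) d by (simp add: field_simps)
    have "tail_weight d ?r = d / ?r ^ 3"
      using 3 by (simp add: tail_weight_def)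
    also have "\<dots> \<le> d / (d * 2 ^ n) ^ 3"
      using dn d 3 by (intro divide_left_mono power_mono mult_pos_pos zero_less_power) auto
    also have "\<dots> = 1 / (d\<^sup>2 * 8 ^ n)"
      using d by (simp add: power_mult_distrib power3_eq_cube power2_eq_square flip: power_mult_distrib)
    finally have "ennreal (tail_weight d ?r) \<le> ?g n"
      using i by (simp add: ennreal_leI del: power_Suc)
    also have "\<dots> \<le> (\<Sum>n. ?g n)" by (rule sg)
    finally show ?thesis
      by (rule order_trans) simp
  qed
qed

text \<open>The constant is 12 = 4 + 8: in units of the disc area, the inner discs contribute 2 /
  2^n each and the outer discs 4 / 2^n each.\<close>

lemma nn_integral_tail_weight:
  assumes d: "d > 0"
  shows "(\<integral>\<^sup>+z. ennreal (tail_weight d (cmod (z - a))) \<partial>lborel) \<le> ennreal (12 * disc_area)"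
proof -
  let ?f = "\<lambda>n z. ennreal (2 ^ Suc n / d\<^sup>2) * indicator (cball a (d / 2 ^ n)) z"
  let ?g = "\<lambda>n z. ennreal (1 / (d\<^sup>2 * 8 ^ n)) * indicator (cball a (d * 2 ^ Suc n)) z"
  have [measurable]: "(\<lambda>z. c * indicator (cball a r) z) \<in> borel_measurable lborel" for c :: ennreal and r
    by (intro borel_measurable_times_ennreal borel_measurable_const borel_measurable_indicator) auto
  have geo: "(\<lambda>n. c * disc_area * (1 / 2) ^ n) sums (c * disc_area * 2)" for c
    using sums_mult[OF geometric_sums[of "1/2::real"], of "c * disc_area"] by simp
  have f: "(\<integral>\<^sup>+z. ?f n z \<partial>lborel) = ennreal (2 * disc_area * (1 / 2) ^ n)" for n
  proof -
    have "(\<integral>\<^sup>+z. ?f n z \<partial>lborel) = ennreal (2 ^ Suc n / d\<^sup>2) * ennreal (disc_area * (d / 2 ^ n)\<^sup>2)"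
      using d by (subst nn_integral_cmult_indicator) (auto simp: emeasure_cball_complex simp del: power_Suc)
    also have "\<dots> = ennreal (2 ^ Suc n / d\<^sup>2 * (disc_area * (d / 2 ^ n)\<^sup>2))"
      by (rule ennreal_mult[symmetric]) (use disc_area_nonneg in auto)
    also have "2 ^ Suc n / d\<^sup>2 * (disc_area * (d / 2 ^ n)\<^sup>2) = 2 * disc_area * (1 / 2) ^ n"
      using d by (simp add: power_divide field_simps power2_eq_square)
    finally show ?thesis .
  qed
  have g: "(\<integral>\<^sup>+z. ?g n z \<partial>lborel) = ennreal (4 * disc_area * (1 / 2) ^ n)" for n
  proof -
    have "(\<integral>\<^sup>+z. ?g n z \<partial>lborel) = ennreal (1 / (d\<^sup>2 * 8 ^ n)) * ennreal (disc_area * (d * 2 ^ Suc n)\<^sup>2)"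
      using d by (subst nn_integral_cmult_indicator) (auto simp: emeasure_cball_complex simp del: power_Suc)
    also have "\<dots> = ennreal (1 / (d\<^sup>2 * 8 ^ n) * (disc_area * (d * 2 ^ Suc n)\<^sup>2))"
      by (rule ennreal_mult[symmetric]) (use disc_area_nonneg in auto)
    also have "1 / (d\<^sup>2 * 8 ^ n) * (disc_area * (d * 2 ^ Suc n)\<^sup>2) = 4 * disc_area * (1 / 2) ^ n"
    proof -
      have "(8::real) ^ n = 2 ^ n * 2 ^ n * 2 ^ n"
        by (simp flip: power_mult_distrib)
      then show ?thesis
        using d by (simp add: power_divide field_simps power2_eq_square)
    qed
    finally show ?thesis .
  qed
  have "(\<integral>\<^sup>+z. ennreal (tail_weight d (cmod (z - a))) \<partial>lborel) \<le>
     (\<integral>\<^sup>+z. (\<Sum>n. ?f n z) + (\<Sum>n. ?g n z) \<partial>lborel)"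
    by (intro nn_integral_mono tail_weight_dyadic_le d)
  also have "\<dots> = (\<integral>\<^sup>+z. (\<Sum>n. ?f n z) \<partial>lborel) + (\<integral>\<^sup>+z. (\<Sum>n. ?g n z) \<partial>lborel)"
    by (intro nn_integral_add borel_measurable_suminf) measurable
  also have "(\<integral>\<^sup>+z. (\<Sum>n. ?f n z) \<partial>lborel) = (\<Sum>n. \<integral>\<^sup>+z. ?f n z \<partial>lborel)"
    by (intro nn_integral_suminf) measurable
  also have "\<dots> = ennreal (4 * disc_area)"
    unfolding f using disc_area_nonneg geo[of 2] by (intro suminf_ennreal_eq) auto
  also have "(\<integral>\<^sup>+z. (\<Sum>n. ?g n z) \<partial>lborel) = (\<Sum>n. \<integral>\<^sup>+z. ?g n z \<partial>lborel)"
    by (intro nn_integral_suminf) measurable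
  also have "\<dots> = ennreal (8 * disc_area)"
    unfolding g using disc_area_nonneg geo[of 4] by (intro suminf_ennreal_eq) auto
  also have "ennreal (4 * disc_area) + ennreal (8 * disc_area) = ennreal (12 * disc_area)"
    using disc_area_nonneg by (subst ennreal_plus[symmetric]) auto
  finally show ?thesis .
qed

lemma integral_tail_weight:
  assumes d: "d > 0"
  shows "integrable lborel (\<lambda>z. tail_weight d (cmod (z - a)))"
    and "(LINT z|lborel. tail_weight d (cmod (z - a))) \<le> 12 * disc_area"
proof -
  have nn: "tail_weight d (cmod (z - a)) \<ge> 0" for z
    by (rule tail_weight_nonneg[OF d]) simp
  have "(\<integral>\<^sup>+z. ennreal (tail_weight d (cmod (z - a))) \<partial>lborel) < \<infinity>"
    using nn_integral_tail_weight[OF d] by (rule le_less_trans) simp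
  then show I: "integrable lborel (\<lambda>z. tail_weight d (cmod (z - a)))"
    by (intro integrableI_nonneg) (use nn in auto)
  have "ennreal (LINT z|lborel. tail_weight d (cmod (z - a))) \<le> ennreal (12 * disc_area)"
    using nn_integral_tail_weight[OF d, of a] nn_integral_eq_integral[OF I] nn by simp
  then show "(LINT z|lborel. tail_weight d (cmod (z - a))) \<le> 12 * disc_area"
    using disc_area_nonneg by (subst (asm) ennreal_le_iff) auto
qed

lemma sq_sum_le: "cmod (x + y) \<le> u + v \<Longrightarrow> (cmod (x + y))\<^sup>2 \<le> 2 * u\<^sup>2 + 2 * v\<^sup>2"
proof -
  assume "cmod (x + y) \<le> u + v"
  then have "(cmod (x + y))\<^sup>2 \<le> (u + v)\<^sup>2"
    by (intro power_mono) auto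
  also have "\<dots> \<le> 2 * u\<^sup>2 + 2 * v\<^sup>2"
    using sum_squares_bound[of u v] by (simp add: power2_sum)
  finally show ?thesis .
qed

text \<open>The factor \<open>s / (s + s w)\<close> is close to \<open>1\<close> far away from \<open>a\<close> and small near \<open>a\<close>, which
  removes the non-integrable singularity of \<open>1 / (z - a)\<close>.\<close>

lemma cauchy_reg_approx:
  assumes s: "continuous_on S s" "\<And>z. z \<in> S \<Longrightarrow> (s z)\<^sup>2 = (z - a) / (z - b)"
    and nS: "a \<notin> S" "b \<notin> S" and z: "z \<in> S"
    and d: "d = cmod (w - a)" "ball w d \<subseteq> S" "d > 0" "8 * d \<le> cmod (a - b)"
    and D: "cmod (z - b) \<le> D"
  shows "(cmod (cnj (cauchy_reg (d / 2) (w - z)) + 1 / (z - a) * (s z / (s z + s w))))\<^sup>2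
    \<le> (688 + 576 * (D / cmod (a - b))) * tail_weight d (cmod (z - a))"
proof -
  define A r where "A = cmod (a - b)" and "r = cmod (z - a)"
  define t where "t = s z / s w"
  have w: "w \<in> S" using d(2,3) by auto
  have ne: "x \<noteq> a" "x \<noteq> b" if "x \<in> S" for x
    using that nS by auto
  have s0: "s x \<noteq> 0" if "x \<in> S" for x
    using s(2)[OF that] ne[OF that] by auto
  have r: "r > 0" using ne[OF z] by (simp add: r_def)
  have A: "A \<ge> 8 * d" "A > 0" using d(3,4) by (auto simp: A_def)
  have t1: "cmod (t + 1) \<ge> 1 / 6"
    unfolding t_def by (rule sqrt_mobius_omits[OF s nS z d])
  have tt: "s z / (s z + s w) = t / (t + 1)"
  proof -
    have "s z = t * s w" "s z + s w = (t + 1) * s w"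
      using s0[OF w] by (simp_all add: t_def ring_distribs)
    then show ?thesis
      using s0[OF w] by simp
  qed
  have tri: "cmod (w - b) \<le> d + A" "A \<le> d + cmod (w - b)" "A \<le> r + cmod (z - b)"
      "r \<le> cmod (z - w) + d"
    using norm_triangle_ineq[of "w - a" "a - b"] norm_triangle_ineq4[of "w - b" "w - a"]
      norm_triangle_ineq4[of "z - b" "z - a"] norm_triangle_ineq[of "z - w" "w - a"]
    by (auto simp: d(1) A_def r_def)
  have "(cmod t)\<^sup>2 = cmod (t\<^sup>2)"
    by (simp add: norm_power)
  also have "t\<^sup>2 = ((z - a) / (z - b)) / ((w - a) / (w - b))"
    unfolding t_def power_divide s(2)[OF z] s(2)[OF w] ..
  finally have t2: "(cmod t)\<^sup>2 = r * cmod (w - b) / (cmod (z - b) * d)"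
    by (simp add: norm_divide norm_mult r_def d(1))
  define C where "C = 688 + 576 * (D / A)"
  have DA: "D / A \<ge> 0"
    using D A norm_ge_zero[of "z - b"] by (intro divide_nonneg_pos) linarith+
  have "(cmod (cnj (cauchy_reg (d / 2) (w - z)) + 1 / (z - a) * (t / (t + 1))))\<^sup>2 \<le> C * tail_weight d r"
  proof (cases "r \<le> 2 * d")
    case True
    have k: "cmod (cnj (cauchy_reg (d / 2) (w - z))) \<le> 4 / d"
      using norm_cauchy_reg_le[of "d / 2" "w - z"] d(3) by simp
    have g: "cmod (1 / (z - a) * (t / (t + 1))) \<le> 6 * (cmod t / r)"
    proof -
      have "cmod (t / (t + 1)) \<le> cmod t / (1 / 6)"
        unfolding norm_divide using t1 by (intro divide_left_mono mult_pos_pos) auto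
      then have "cmod (t / (t + 1)) / r \<le> cmod t * 6 / r"
        using r by (intro divide_right_mono) auto
      then show ?thesis
        by (simp add: norm_mult norm_divide r_def mult.commute)
    qed
    have "(cmod t)\<^sup>2 \<le> 3 / 2 * (r / d)"
    proof -
      have zb: "cmod (z - b) \<ge> 3 / 4 * A"
        using tri True A by linarith
      have "r * cmod (w - b) \<le> r * (9 / 8 * A)"
        using tri A r by (intro mult_left_mono) linarith+
      also have "\<dots> \<le> r * (3 / 2 * cmod (z - b))"
        using zb r by (intro mult_left_mono) linarith+
      finally have "r * cmod (w - b) \<le> 3 / 2 * r * cmod (z - b)" by simp
      moreover have "cmod (z - b) > 0" using ne[OF z] by simp
      ultimately show ?thesis
        unfolding t2 using d(3) by (simp add: field_simps)
    qed
    then have "36 * (cmod t)\<^sup>2 / r\<^sup>2 \<le> 36 * (3 / 2 * (r / d)) / r\<^sup>2"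
      by (intro divide_right_mono mult_left_mono) auto
    then have "(6 * (cmod t / r))\<^sup>2 \<le> 36 * (3 / 2 * (r / d)) / r\<^sup>2"
      by (simp add: power_mult_distrib power_divide)
    also have "\<dots> = 54 / (r * d)"
      using r d(3) by (simp add: field_simps power2_eq_square)
    finally have g2: "(6 * (cmod t / r))\<^sup>2 \<le> 54 / (r * d)" .
    have k2: "(4 / d)\<^sup>2 \<le> 32 / (r * d)"
      using True r d(3) by (simp add: field_simps power2_eq_square)
    have "(cmod (cnj (cauchy_reg (d / 2) (w - z)) + 1 / (z - a) * (t / (t + 1))))\<^sup>2
        \<le> 2 * (4 / d)\<^sup>2 + 2 * (6 * (cmod t / r))\<^sup>2"
      using k g by (intro sq_sum_le order_trans[OF norm_triangle_ineq] add_mono)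
    also have "\<dots> \<le> 2 * (32 / (r * d)) + 2 * (54 / (r * d))"
      by (intro add_mono mult_left_mono g2 k2) auto
    also have "\<dots> = 172 / (r * d)"
      by simp
    \<comment> \<open>688 = 4 * 172: for d < r \<le> 2 d the weight d / r^3 may be as small as a
      quarter of 1 / (r d).\<close>
    also have "\<dots> \<le> 688 * tail_weight d r"
    proof (cases "r \<le> d")
      case True
      then show ?thesis
        using r d(3) by (simp add: tail_weight_def field_simps)
    next
      case False
      have "r * r \<le> 2 * d * (2 * d)"
        using \<open>r \<le> 2 * d\<close> r by (intro mult_mono) auto
      then show ?thesis
        using False r d(3) by (simp add: tail_weight_def field_simps power3_eq_cube)
    qed
    also have "\<dots> \<le> C * tail_weight d r"
      using DA tail_weight_nonneg[of d r] r d(3) by (intro mult_right_mono) (auto simp: C_def)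
    finally show ?thesis .
  next
    case False
    \<comment> \<open>Here the regularisation is inactive. The kernel cancels against 1 / (z - a) up
      to a term of order d / r^2, and what remains is 1 / ((z - a) (t + 1)), of order 1 / (r
      |t|).\<close>
    have zw: "cmod (z - w) \<ge> r / 2" "cmod (z - w) \<ge> d / 2"
      using tri False by linarith+
    have zw0: "z \<noteq> w" using zw(1) r by auto
    have "cauchy_reg (d / 2) (w - z) = 1 / cnj (w - z)"
      using zw(2) d(3) by (intro cauchy_reg_eq) (auto simp: norm_minus_commute)
    then have k: "cnj (cauchy_reg (d / 2) (w - z)) = 1 / (w - z)"
      by simp
    have "t + 1 \<noteq> 0" using t1 by auto
    then have tq: "t / (t + 1) = 1 - 1 / (t + 1)"
      by (simp add: field_simps)
    have ring: "p + q * (1 - x) = (p + q) + (- (q * x))" for p q x :: complex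
      by (simp add: algebra_simps)
    have pq: "1 / (w - z) + 1 / (z - a) = (w - a) / ((w - z) * (z - a))"
      using zw0 ne[OF z] by (simp add: field_simps)
    have E: "cnj (cauchy_reg (d / 2) (w - z)) + 1 / (z - a) * (t / (t + 1)) =
        (w - a) / ((w - z) * (z - a)) + (- (1 / (z - a) * (1 / (t + 1))))"
      unfolding k tq pq[symmetric] by (rule ring)
    have e1: "cmod ((w - a) / ((w - z) * (z - a))) \<le> 2 * d / r\<^sup>2"
    proof -
      have "cmod ((w - a) / ((w - z) * (z - a))) = d / (cmod (z - w) * r)"
        by (simp add: norm_divide norm_mult d(1) r_def norm_minus_commute)
      also have "\<dots> \<le> d / (r / 2 * r)"
        using zw(1) r d(3) by (intro divide_left_mono mult_right_mono mult_pos_pos) auto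
      finally show ?thesis by (simp add: power2_eq_square mult.commute)
    qed
    have t0: "cmod t > 0"
      using s0[OF z] s0[OF w] by (simp add: t_def)
    have "cmod t \<le> cmod (t + 1) + 1"
      using norm_triangle_ineq4[of "t + 1" 1] by simp
    then have "cmod t \<le> 12 * cmod (t + 1)"
      using t1 by linarith
    moreover have "cmod (t + 1) > 0" using t1 by linarith
    ultimately have "1 / cmod (t + 1) \<le> 12 / cmod t"
      using t0 by (simp add: divide_simps mult.commute)
    then have "1 / cmod (t + 1) / r \<le> 12 / cmod t / r"
      using r by (intro divide_right_mono) auto
    then have e2: "cmod (- (1 / (z - a) * (1 / (t + 1)))) \<le> 12 / cmod t / r"
      by (simp add: norm_mult norm_divide r_def mult.commute)
    \<comment> \<open>The decay r^(-3/2) arises here: |w - b| \<ge> A / 2 makes 1 / |t|^2 of order d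
      / r. The ratio D / A enters because |z - b|, a denominator in t^2, is only bounded by
      D.\<close>
    have "1 / (cmod t)\<^sup>2 = cmod (z - b) * d / (r * cmod (w - b))"
      unfolding t2 by simp
    also have "\<dots> \<le> D * d / (r * (A / 2))"
      using D d(3) tri A r by (intro frac_le mult_right_mono mult_left_mono mult_pos_pos mult_nonneg_nonneg)
        (auto intro: order_trans[OF norm_ge_zero D])
    finally have "144 * (1 / (cmod t)\<^sup>2) / r\<^sup>2 \<le> 144 * (D * d / (r * (A / 2))) / r\<^sup>2"
      by (intro divide_right_mono mult_left_mono) auto
    moreover have "(12 / cmod t / r)\<^sup>2 = 144 * (1 / (cmod t)\<^sup>2) / r\<^sup>2"
      by (simp add: power_divide power_mult_distrib)
    ultimately have "(12 / cmod t / r)\<^sup>2 \<le> 144 * (D * d / (r * (A / 2))) / r\<^sup>2"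
      by (simp only:)
    also have "\<dots> = 288 * (D / A) * (d / r ^ 3)"
      using r A by (simp add: field_simps power2_eq_square power3_eq_cube)
    finally have e2': "(12 / cmod t / r)\<^sup>2 \<le> 288 * (D / A) * (d / r ^ 3)" .
    have "(2 * d / r\<^sup>2)\<^sup>2 = 4 * (d / r) * (d / r ^ 3)"
      using r by (simp add: field_simps power2_eq_square power3_eq_cube)
    also have "\<dots> \<le> 4 * 1 * (d / r ^ 3)"
      using False r d(3) by (intro mult_right_mono mult_left_mono) auto
    finally have e1': "(2 * d / r\<^sup>2)\<^sup>2 \<le> 4 * (d / r ^ 3)" by simp
    have "(cmod (cnj (cauchy_reg (d / 2) (w - z)) + 1 / (z - a) * (t / (t + 1))))\<^sup>2
        \<le> 2 * (2 * d / r\<^sup>2)\<^sup>2 + 2 * (12 / cmod t / r)\<^sup>2"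
      unfolding E using e1 e2 by (intro sq_sum_le order_trans[OF norm_triangle_ineq] add_mono)
    also have "\<dots> \<le> 8 * (d / r ^ 3) + 576 * (D / A) * (d / r ^ 3)"
      using e1' e2' by simp
    also have "\<dots> = (8 + 576 * (D / A)) * (d / r ^ 3)"
      by (simp only: distrib_right)
    also have "\<dots> \<le> C * (d / r ^ 3)"
      using r d(3) by (intro mult_right_mono) (auto simp: C_def)
    also have "d / r ^ 3 = tail_weight d r"
      using False d(3) by (simp add: tail_weight_def)
    finally show ?thesis .
  qed
  then show ?thesis
    unfolding tt C_def A_def r_def .
qed

section \<open>Boundary values of the potential\<close>

lemma bump_moment_bounds:
  assumes \<delta>: "\<delta> > 0"
  shows "0 \<le> bump_moment \<delta>" "bump_moment \<delta> \<le> \<delta>\<^sup>2 * bump_mass"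
proof -
  show "0 \<le> bump_moment \<delta>"
    unfolding bump_moment_def by (intro Bochner_Integration.integral_nonneg) (simp add: bump_nonneg)
  have "bump_moment \<delta> \<le> (LINT y|lborel. \<delta>\<^sup>2 * bump \<delta> y)"
    unfolding bump_moment_def
  proof (rule integral_mono)
    show "integrable lborel (\<lambda>y. (cmod y)\<^sup>2 * bump \<delta> y)"
      using integrable_continuous_times_bump[OF \<delta>, of "\<lambda>y. (cmod y)\<^sup>2"] by (simp add: continuous_intros)
    show "integrable lborel (\<lambda>y. \<delta>\<^sup>2 * bump \<delta> y)"
      using integrable_continuous_times_bump[OF \<delta>, of "\<lambda>y. \<delta>\<^sup>2"] by simp
    show "(cmod y)\<^sup>2 * bump \<delta> y \<le> \<delta>\<^sup>2 * bump \<delta> y" for y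
    proof (cases "cmod y < \<delta>")
      case True
      then show ?thesis
        by (intro mult_right_mono bump_nonneg power_mono) auto
    qed (use \<delta> in \<open>simp add: bump_eq_0\<close>)
  qed
  then show "bump_moment \<delta> \<le> \<delta>\<^sup>2 * bump_mass"
    using integral_bump[OF \<delta>] by simp
qed

text \<open>\<open>large\<close> is the quantitative form of having no point components: it supplies
  b at distance at least \<rho> from a. The bound B then controls |z - b| / |a - b|.\<close>

locale nondegenerate_domain = bounded_domain +
  fixes \<rho> B :: real
  assumes connected_\<Omega>: "connected \<Omega>" and \<rho>: "\<rho> > 0"
    and large: "\<And>x. x \<notin> \<Omega> \<Longrightarrow> \<exists>K q. connected K \<and> K \<inter> \<Omega> = {} \<and> x \<in> K \<and> q \<in> K \<and> \<rho> \<le> dist x q"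
    and B: "\<And>z. z \<in> \<Omega> \<Longrightarrow> cmod z \<le> B"
begin

text \<open>The constant of \<open>cauchy_reg_approx\<close> for D = 2 B + 2 |a - b|, with |a - b|
  \<ge> \<rho>.\<close>

definition approx_const :: real where
  "approx_const = 688 + 576 * (2 * B / \<rho> + 2)"

lemma approx_const_pos: "\<Omega> \<noteq> {} \<Longrightarrow> approx_const > 0"
proof -
  assume "\<Omega> \<noteq> {}"
  then obtain z where "z \<in> \<Omega>" by blast
  then have "B \<ge> 0" using B[of z] norm_ge_zero[of z] by linarith
  then have "2 * B / \<rho> \<ge> 0" using \<rho> by simp
  then show ?thesis
    unfolding approx_const_def by (intro add_pos_nonneg mult_nonneg_nonneg add_nonneg_nonneg) auto
qed

text \<open>Square integrability of g is obtained indirectly: the kernel is bounded and its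
  difference from g is dominated by an integrable weight. The conjugate of the kernel is
  approximated, since \<open>L2_inner\<close> conjugates its second argument.\<close>

lemma bergman_approximation:
  assumes w: "w \<in> \<Omega>" and dw: "8 * bdist w \<le> \<rho>"
  obtains a g where "a \<notin> \<Omega>" "dist w a = bdist w" "g \<in> bergman_space \<Omega>"
    "\<And>z. z \<in> \<Omega> \<Longrightarrow> (cmod (cnj (cauchy_reg (bdist w / 2) (w - z)) - g z))\<^sup>2
        \<le> approx_const * tail_weight (bdist w) (cmod (z - a))"
proof -
  let ?d = "bdist w"
  have d: "?d > 0" by (rule bdist_pos[OF w])
  obtain a where a: "a \<notin> \<Omega>" "dist w a = ?d"
    by (rule bdist_attained)
  obtain K b where K: "connected K" "K \<inter> \<Omega> = {}" "a \<in> K" "b \<in> K" and ab: "\<rho> \<le> dist a b"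
    using large[OF a(1)] by blast
  have b: "b \<notin> \<Omega>" using K by auto
  have "\<Omega> \<inter> K = {}" using K(2) by auto
  then obtain s where s: "s holomorphic_on \<Omega>" "\<And>z. z \<in> \<Omega> \<Longrightarrow> (s z)\<^sup>2 = (z - a) / (z - b)"
    using holomorphic_sqrt_mobius[OF open_\<Omega> connected_\<Omega> K(1,3,4)] by blast
  have sc: "continuous_on \<Omega> s"
    using s(1) by (rule holomorphic_on_imp_continuous_on)
  have dd: "?d = cmod (w - a)" "ball w ?d \<subseteq> \<Omega>" "?d > 0" "8 * ?d \<le> cmod (a - b)"
    using a(2) ball_bdist d dw ab by (auto simp: dist_norm)
  have sw: "s w \<noteq> 0"
    using s(2)[OF w] w a b by auto
  have ne: "s z + s w \<noteq> 0" if "z \<in> \<Omega>" for z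
  proof
    assume "s z + s w = 0"
    then have "s z / s w + 1 = 0"
      using sw by (simp add: divide_simps)
    then show False
      using sqrt_mobius_omits[OF sc s(2) a(1) b that dd] by simp
  qed
  define g where "g = (\<lambda>z. - (1 / (z - a) * (s z / (s z + s w))))"
  have hg: "g holomorphic_on \<Omega>"
    unfolding g_def using a(1) ne by (intro holomorphic_intros s) auto
  define k where "k = (\<lambda>z. cnj (cauchy_reg (?d / 2) (w - z)))"
  have kg: "(cmod (k z - g z))\<^sup>2 \<le> approx_const * tail_weight ?d (cmod (z - a))" if z: "z \<in> \<Omega>" for z
  proof -
    have zb: "cmod (z - b) \<le> 2 * B + 2 * cmod (a - b)"
    proof -
      have "cmod (z - b) \<le> cmod z + cmod w + cmod (w - a) + cmod (a - b)"
        using norm_triangle_ineq4[of z w] norm_triangle_ineq[of "z - w" "w - a"]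
          norm_triangle_ineq[of "z - a" "a - b"] by simp
      then show ?thesis
        using B[OF z] B[OF w] dd by linarith
    qed
    have "(cmod (k z - g z))\<^sup>2 \<le> (688 + 576 * ((2 * B + 2 * cmod (a - b)) / cmod (a - b)))
        * tail_weight ?d (cmod (z - a))"
      using cauchy_reg_approx[OF sc s(2) a(1) b z dd zb] by (simp add: k_def g_def)
    also have "\<dots> \<le> approx_const * tail_weight ?d (cmod (z - a))"
    proof (intro mult_right_mono tail_weight_nonneg d norm_ge_zero)
      have A: "cmod (a - b) \<ge> \<rho>" "cmod (a - b) > 0"
        using ab \<rho> by (auto simp: dist_norm)
      have "B \<ge> 0" using B[OF w] norm_ge_zero[of w] by linarith
      then have "2 * B / cmod (a - b) \<le> 2 * B / \<rho>"
        using A \<rho> by (intro divide_left_mono mult_pos_pos) auto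
      then have "688 + 576 * (2 * B / cmod (a - b) + 2) \<le> approx_const"
        unfolding approx_const_def by (intro add_left_mono mult_left_mono add_right_mono) auto
      moreover have "(2 * B + 2 * cmod (a - b)) / cmod (a - b) = 2 * B / cmod (a - b) + 2"
        using A by (simp add: add_divide_distrib)
      ultimately show "688 + 576 * ((2 * B + 2 * cmod (a - b)) / cmod (a - b)) \<le> approx_const"
        by (simp only:)
    qed
    finally show ?thesis .
  qed
  have ck: "continuous_on \<Omega> k"
    unfolding k_def using d
    by (intro continuous_intros continuous_on_compose2[OF continuous_on_cauchy_reg[of "?d / 2" UNIV]]) auto
  have cg: "continuous_on \<Omega> g"
    using hg by (rule holomorphic_on_imp_continuous_on)
  have kL2: "k \<in> L2_on \<Omega>"
    using norm_cauchy_reg_le[of "?d / 2"] d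
    by (intro L2_bounded_continuous[OF ck, of "2 / (?d / 2)"]) (auto simp: k_def)
  have "set_integrable lborel \<Omega> (\<lambda>z. (cmod (k z - g z))\<^sup>2)"
  proof (rule set_integrable_bound)
    show "set_borel_measurable lborel \<Omega> (\<lambda>z. (cmod (k z - g z))\<^sup>2)"
      by (rule set_borel_measurable_continuous) (intro continuous_intros ck cg)
    have "integrable lborel (\<lambda>z. approx_const * tail_weight ?d (cmod (z - a)))"
      using integral_tail_weight(1)[OF d] by simp
    then show "set_integrable lborel \<Omega> (\<lambda>z. approx_const * tail_weight ?d (cmod (z - a)))"
      unfolding set_integrable_def by (intro integrable_mult_indicator) auto
    show "AE z in lborel. z \<in> \<Omega> \<longrightarrow> norm ((cmod (k z - g z))\<^sup>2) \<le>
        norm (approx_const * tail_weight ?d (cmod (z - a)))"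
      by (rule AE_I2) (auto intro: order_trans[OF kg abs_ge_self])
  qed
  moreover have "set_borel_measurable lborel \<Omega> (\<lambda>z. k z - g z)"
    by (rule set_borel_measurable_continuous) (intro continuous_intros ck cg)
  ultimately have "(\<lambda>z. k z - g z) \<in> L2_on \<Omega>"
    by (simp add: L2_on_def)
  from L2_diff[OF kL2 this] have "g \<in> L2_on \<Omega>" by simp
  with hg have "g \<in> bergman_space \<Omega>" by (simp add: bergman_space_def)
  with a kg show ?thesis
    by (intro that[of a g]) (auto simp: k_def)
qed

text \<open>By orthogonality the kernel may be replaced by the approximation error e. Inside the
  ball about \<zeta>, |\<phi>| |e| \<le> |\<phi>|^2 / l + l |e|^2 separates the small energy of
  \<phi> from the L^2 norm of e, which is merely bounded. Outside, e is uniformly small and meets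
  the L^1 norm of \<phi>. The last term bounds the moment; R and l stay free, to be fixed before w
  approaches \<zeta>.\<close>

lemma pot_reg_bound:
  assumes proj: "is_L2_projection \<Omega> (bergman_space \<Omega>) cnj f"
    and w: "w \<in> \<Omega>" and \<zeta>: "\<zeta> \<notin> \<Omega>" and R: "R > 0" "8 * dist w \<zeta> \<le> R" "8 * dist w \<zeta> \<le> \<rho>"
    and l: "l > 0"
  shows "cmod (pot_reg f (bdist w / 2) w) \<le>
     (LINT z:\<Omega> \<inter> ball \<zeta> R|lborel. (cmod (cnj z - f z))\<^sup>2) / l + l * (approx_const * (12 * disc_area))
     + sqrt (8 * approx_const * dist w \<zeta> / R ^ 3) * (LINT z:\<Omega>|lborel. cmod (cnj z - f z))
     + (dist w \<zeta>)\<^sup>2 * bump_mass"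
proof -
  let ?d = "bdist w" and ?x = "dist w \<zeta>"
  define \<phi> where "\<phi> = (\<lambda>z. cnj z - f z)"
  have f: "f \<in> bergman_space \<Omega>" and orth: "\<And>g. g \<in> bergman_space \<Omega> \<Longrightarrow> L2_inner \<Omega> \<phi> g = 0"
    using proj by (auto simp: is_L2_projection_def \<phi>_def)
  have \<phi>2: "\<phi> \<in> L2_on \<Omega>"
    unfolding \<phi>_def using f by (intro L2_diff cnj_in_L2) (auto simp: bergman_space_def)
  have d: "?d > 0" by (rule bdist_pos[OF w])
  have dx: "?d \<le> ?x"
    unfolding bdist_def using \<zeta> by (intro infdist_le) auto
  have x: "?x > 0" using d dx by linarith
  have C: "approx_const > 0"
    using approx_const_pos w by auto
  have "8 * ?d \<le> \<rho>" using dx R by linarith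
  then obtain a g where a: "a \<notin> \<Omega>" "dist w a = ?d" and g: "g \<in> bergman_space \<Omega>"
    and E: "\<And>z. z \<in> \<Omega> \<Longrightarrow> (cmod (cnj (cauchy_reg (?d / 2) (w - z)) - g z))\<^sup>2
        \<le> approx_const * tail_weight ?d (cmod (z - a))"
    using bergman_approximation[OF w] by blast
  define k where "k = (\<lambda>z. cauchy_reg (?d / 2) (w - z))"
  define e where "e = (\<lambda>z. cnj (k z) - g z)"
  have ck: "continuous_on \<Omega> k"
    unfolding k_def using d
    by (intro continuous_intros continuous_on_compose2[OF continuous_on_cauchy_reg[of "?d / 2" UNIV]]) auto
  have kL2: "k \<in> L2_on \<Omega>"
    using norm_cauchy_reg_le[of "?d / 2"] d
    by (intro L2_bounded_continuous[OF ck, of "2 / (?d / 2)"]) (auto simp: k_def)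
  have gL2: "g \<in> L2_on \<Omega>" using g by (simp add: bergman_space_def)
  have cg: "continuous_on \<Omega> g"
    using g by (auto simp: bergman_space_def intro: holomorphic_on_imp_continuous_on)
  have cgL2: "(\<lambda>z. cnj (g z)) \<in> L2_on \<Omega>"
    using gL2 set_borel_measurable_continuous[OF continuous_on_cnj[OF cg]] by (simp add: L2_on_def)
  have I1: "set_integrable lborel \<Omega> (\<lambda>z. \<phi> z * k z)"
    by (rule L2_times_L2[OF \<phi>2 kL2])
  have I2: "set_integrable lborel \<Omega> (\<lambda>z. \<phi> z * cnj (g z))"
    by (rule L2_times_L2[OF \<phi>2 cgL2])
  have eqe: "\<phi> z * k z - \<phi> z * cnj (g z) = \<phi> z * cnj (e z)" for z
    by (simp add: e_def algebra_simps)
  have "(LINT z:\<Omega>|lborel. \<phi> z * k z) = (LINT z:\<Omega>|lborel. \<phi> z * k z) - (LINT z:\<Omega>|lborel. \<phi> z * cnj (g z))"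
    using orth[OF g] by (simp add: L2_inner_def)
  also have "\<dots> = (LINT z:\<Omega>|lborel. \<phi> z * cnj (e z))"
    unfolding set_integral_diff(2)[OF I1 I2, symmetric] eqe ..
  finally have eq: "(LINT z:\<Omega>|lborel. \<phi> z * k z) = (LINT z:\<Omega>|lborel. \<phi> z * cnj (e z))" .
  have Ie: "set_integrable lborel \<Omega> (\<lambda>z. \<phi> z * cnj (e z))"
    using set_integral_diff(1)[OF I1 I2] unfolding eqe .
  \<comment> \<open>A bound for |e| outside the ball of radius R about \<zeta>; for fixed R it tends
    to 0 with the distance from w to \<zeta>.\<close>
  define \<kappa> where "\<kappa> = sqrt (8 * approx_const * ?x / R ^ 3)"
  let ?T = "\<lambda>z. tail_weight ?d (cmod (z - a))"
  let ?U = "\<lambda>z. indicat_real (\<Omega> \<inter> ball \<zeta> R) z *\<^sub>R (cmod (\<phi> z))\<^sup>2 / l + l * (approx_const * ?T z)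
      + \<kappa> * (indicat_real \<Omega> z *\<^sub>R cmod (\<phi> z))"
  have T0: "?T z \<ge> 0" for z
    by (rule tail_weight_nonneg[OF d]) simp
  have pw: "norm (indicat_real \<Omega> z *\<^sub>R (\<phi> z * cnj (e z))) \<le> ?U z" for z
  proof (cases "z \<in> \<Omega>")
    case False
    then show ?thesis
      using T0[of z] l C by simp
  next
    case True
    have Ez: "(cmod (e z))\<^sup>2 \<le> approx_const * ?T z"
      using E[OF True] by (simp add: e_def k_def)
    have \<kappa>0: "\<kappa> \<ge> 0" using C x R by (simp add: \<kappa>_def)
    show ?thesis
    proof (cases "z \<in> ball \<zeta> R")
      case inb: True
      have "0 \<le> (cmod (\<phi> z) / l - cmod (e z))\<^sup>2" by simp
      then have "2 * (cmod (\<phi> z) / l * cmod (e z)) \<le> (cmod (\<phi> z) / l)\<^sup>2 + (cmod (e z))\<^sup>2"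
        by (simp add: power2_diff)
      then have "cmod (\<phi> z) / l * cmod (e z) \<le> (cmod (\<phi> z) / l)\<^sup>2 + (cmod (e z))\<^sup>2"
        using l mult_nonneg_nonneg[of "cmod (\<phi> z) / l" "cmod (e z)"]
          divide_nonneg_pos[OF norm_ge_zero l, of "\<phi> z"] norm_ge_zero[of "e z"] by linarith
      then have "l * (cmod (\<phi> z) / l * cmod (e z)) \<le> l * ((cmod (\<phi> z) / l)\<^sup>2 + (cmod (e z))\<^sup>2)"
        using l by (intro mult_left_mono) auto
      also have "l * (cmod (\<phi> z) / l * cmod (e z)) = cmod (\<phi> z) * cmod (e z)"
        using l by simp
      also have "l * ((cmod (\<phi> z) / l)\<^sup>2 + (cmod (e z))\<^sup>2) = (cmod (\<phi> z))\<^sup>2 / l + l * (cmod (e z))\<^sup>2"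
        using l by (simp add: field_simps power2_eq_square)
      also have "\<dots> \<le> (cmod (\<phi> z))\<^sup>2 / l + l * (approx_const * ?T z)"
        using Ez l by (intro add_left_mono mult_left_mono) auto
      finally have "cmod (\<phi> z) * cmod (e z) \<le> (cmod (\<phi> z))\<^sup>2 / l + l * (approx_const * ?T z)
          + \<kappa> * cmod (\<phi> z)"
        using mult_nonneg_nonneg[OF \<kappa>0 norm_ge_zero[of "\<phi> z"]] by linarith
      then show ?thesis
        using True inb by (simp add: norm_mult)
    next
      case outb: False
      \<comment> \<open>The weight is centred at a, not at \<zeta>; as a is within 2
        \<open>dist w \<zeta>\<close> \<le> R / 4 of \<zeta>, points outside the ball keep distance
        at least R / 2 from a.\<close>
      have "dist a \<zeta> \<le> 2 * ?x"
        using dist_triangle[of a \<zeta> w] a(2) dx by (simp add: dist_commute)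
      then have r: "cmod (z - a) \<ge> R / 2"
        using outb dist_triangle[of \<zeta> z a] R(2) x
        unfolding mem_ball dist_norm norm_minus_commute[of z a] norm_minus_commute[of a \<zeta>] by linarith
      have rd: "\<not> cmod (z - a) \<le> ?d"
        using r R dx x by linarith
      have "?T z = ?d / cmod (z - a) ^ 3"
        using rd by (simp add: tail_weight_def)
      also have "\<dots> \<le> ?x / (R / 2) ^ 3"
        using r R dx d by (intro frac_le power_mono) auto
      also have "\<dots> = 8 * ?x / R ^ 3"
        by (simp add: power_divide)
      finally have "(cmod (e z))\<^sup>2 \<le> approx_const * (8 * ?x / R ^ 3)"
        using Ez C mult_left_mono order_trans less_imp_le by meson
      then have "cmod (e z) \<le> \<kappa>"
        unfolding \<kappa>_def by (intro real_le_rsqrt) (simp add: mult.assoc mult.left_commute)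
      then have "cmod (\<phi> z) * cmod (e z) \<le> \<kappa> * cmod (\<phi> z)"
        by (subst mult.commute) (rule mult_right_mono, auto)
      then show ?thesis
        using True outb l C T0[of z] by (simp add: norm_mult add_increasing)
    qed
  qed
  have J1: "integrable lborel (\<lambda>z. indicat_real (\<Omega> \<inter> ball \<zeta> R) z *\<^sub>R (cmod (\<phi> z))\<^sup>2)"
    using set_integrable_subset[of lborel \<Omega> "\<lambda>z. (cmod (\<phi> z))\<^sup>2" "\<Omega> \<inter> ball \<zeta> R"] \<phi>2
    by (simp add: L2_on_def set_integrable_def)
  have J2: "integrable lborel ?T"
    by (rule integral_tail_weight(1)[OF d])
  have J3: "integrable lborel (\<lambda>z. indicat_real \<Omega> z *\<^sub>R cmod (\<phi> z))"
    using set_integrable_norm[OF L2_integrable[OF \<phi>2]] by (simp add: set_integrable_def)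
  have Ie': "integrable lborel (\<lambda>z. indicat_real \<Omega> z *\<^sub>R (\<phi> z * cnj (e z)))"
    using Ie by (simp add: set_integrable_def)
  have "cmod (LINT z:\<Omega>|lborel. \<phi> z * cnj (e z))
      \<le> (LINT z|lborel. norm (indicat_real \<Omega> z *\<^sub>R (\<phi> z * cnj (e z))))"
    unfolding set_lebesgue_integral_def by (rule integral_norm_bound)
  also have "\<dots> \<le> (LINT z|lborel. ?U z)"
  proof (rule integral_mono)
    show "integrable lborel (\<lambda>z. norm (indicat_real \<Omega> z *\<^sub>R (\<phi> z * cnj (e z))))"
      by (rule integrable_norm[OF Ie'])
    show "integrable lborel ?U"
      by (intro Bochner_Integration.integrable_add integrable_divide integrable_mult_right J1 J2 J3)
  qed (rule pw)
  also have "\<dots> = (LINT z:\<Omega> \<inter> ball \<zeta> R|lborel. (cmod (\<phi> z))\<^sup>2) / l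
     + l * (approx_const * (LINT z|lborel. ?T z)) + \<kappa> * (LINT z:\<Omega>|lborel. cmod (\<phi> z))"
    unfolding set_lebesgue_integral_def
    using J1 J2 J3 by simp
  also have "\<dots> \<le> (LINT z:\<Omega> \<inter> ball \<zeta> R|lborel. (cmod (\<phi> z))\<^sup>2) / l
     + l * (approx_const * (12 * disc_area)) + \<kappa> * (LINT z:\<Omega>|lborel. cmod (\<phi> z))"
    using l C integral_tail_weight(2)[OF d] by (intro add_mono mult_left_mono order_refl) auto
  finally have main: "cmod (LINT z:\<Omega>|lborel. \<phi> z * k z) \<le> (LINT z:\<Omega> \<inter> ball \<zeta> R|lborel. (cmod (\<phi> z))\<^sup>2) / l
     + l * (approx_const * (12 * disc_area)) + \<kappa> * (LINT z:\<Omega>|lborel. cmod (\<phi> z))"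
    unfolding eq .
  have "bump_moment (?d / 2) \<le> (?d / 2)\<^sup>2 * bump_mass" "0 \<le> bump_moment (?d / 2)"
    using bump_moment_bounds[of "?d / 2"] d by auto
  moreover have "(?d / 2)\<^sup>2 * bump_mass \<le> ?x\<^sup>2 * bump_mass"
    using d dx bump_mass_pos by (intro mult_right_mono power_mono) auto
  ultimately have mom: "cmod (of_real (bump_moment (?d / 2))) \<le> ?x\<^sup>2 * bump_mass"
    by simp
  have "cmod (pot_reg f (?d / 2) w) \<le> cmod (LINT z:\<Omega>|lborel. \<phi> z * k z) + cmod (of_real (bump_moment (?d / 2)))"
    unfolding pot_reg_def \<phi>_def k_def by (rule norm_triangle_ineq4)
  with main mom show ?thesis
    unfolding \<phi>_def \<kappa>_def by linarith
qed

lemma small_ball_energy: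
  assumes \<phi>: "set_integrable lborel \<Omega> (\<lambda>z. (cmod (\<phi> z))\<^sup>2)"
  shows "(\<lambda>n. LINT z:\<Omega> \<inter> ball \<zeta> (1 / real (Suc n))|lborel. (cmod (\<phi> z))\<^sup>2) \<longlonglongrightarrow> 0"
proof -
  have "(\<lambda>n. LINT z:\<Omega> \<inter> ball \<zeta> (1 / real (Suc n))|lborel. (cmod (\<phi> z))\<^sup>2) \<longlonglongrightarrow>
      integral\<^sup>L lborel (\<lambda>z::complex. 0::real)"
    unfolding set_lebesgue_integral_def
  proof (rule integral_dominated_convergence)
    show "integrable lborel (\<lambda>z. indicat_real \<Omega> z *\<^sub>R (cmod (\<phi> z))\<^sup>2)"
      using \<phi> by (simp add: set_integrable_def)
    show "(\<lambda>z. indicat_real (\<Omega> \<inter> ball \<zeta> (1 / real (Suc n))) z *\<^sub>R (cmod (\<phi> z))\<^sup>2) \<in> borel_measurable lborel" for n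
      using set_integrable_subset[OF \<phi>, of "\<Omega> \<inter> ball \<zeta> (1 / real (Suc n))"]
      by (simp add: set_integrable_def)
    show "AE z in lborel. norm (indicat_real (\<Omega> \<inter> ball \<zeta> (1 / real (Suc n))) z *\<^sub>R (cmod (\<phi> z))\<^sup>2) \<le>
        indicat_real \<Omega> z *\<^sub>R (cmod (\<phi> z))\<^sup>2" for n
      by (auto simp: indicator_def)
    have "(\<lambda>n. indicat_real (\<Omega> \<inter> ball \<zeta> (1 / real (Suc n))) z *\<^sub>R (cmod (\<phi> z))\<^sup>2) \<longlonglongrightarrow> 0" if "z \<noteq> \<zeta>" for z
    proof (rule tendsto_eventually)
      have "(\<lambda>n. 1 / real (Suc n)) \<longlonglongrightarrow> 0"
        using LIMSEQ_inverse_real_of_nat by (simp add: inverse_eq_divide)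
      moreover have "dist \<zeta> z > 0" using that by simp
      ultimately have "\<forall>\<^sub>F n in sequentially. 1 / real (Suc n) < dist \<zeta> z"
        by (rule order_tendstoD)
      then show "\<forall>\<^sub>F n in sequentially. indicat_real (\<Omega> \<inter> ball \<zeta> (1 / real (Suc n))) z *\<^sub>R (cmod (\<phi> z))\<^sup>2 = 0"
        by eventually_elim auto
    qed
    moreover have "AE z in lborel. z \<noteq> \<zeta>"
      by (rule AE_lborel_singleton)
    ultimately show "AE z in lborel. (\<lambda>n. indicat_real (\<Omega> \<inter> ball \<zeta> (1 / real (Suc n))) z *\<^sub>R (cmod (\<phi> z))\<^sup>2) \<longlonglongrightarrow> 0"
      by auto
  qed simp
  then show ?thesis by simp
qed

lemma hpot_boundary_values:
  assumes proj: "is_L2_projection \<Omega> (bergman_space \<Omega>) cnj f" and \<zeta>: "\<zeta> \<in> frontier \<Omega>"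
  shows "(hpot f \<longlongrightarrow> of_real ((cmod \<zeta>)\<^sup>2)) (at \<zeta> within \<Omega>)"
proof -
  let ?P = "\<lambda>w. pot_reg f (bdist w / 2) w" and ?F = "at \<zeta> within \<Omega>"
  have \<zeta>O: "\<zeta> \<notin> \<Omega>"
    using \<zeta> open_\<Omega> by (auto simp: frontier_def interior_open)
  have "\<Omega> \<noteq> {}" using \<zeta> by auto
  then have C: "approx_const > 0" by (rule approx_const_pos)
  define \<phi> where "\<phi> = (\<lambda>z. cnj z - f z)"
  have f: "f \<in> bergman_space \<Omega>" using proj by (simp add: is_L2_projection_def)
  have \<phi>2: "\<phi> \<in> L2_on \<Omega>"
    unfolding \<phi>_def using f by (intro L2_diff cnj_in_L2) (auto simp: bergman_space_def)
  have "(?P \<longlongrightarrow> 0) ?F"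
  proof (rule tendstoI)
    fix e :: real assume e: "e > 0"
    define A where "A = approx_const * (12 * disc_area)"
    have A: "A \<ge> 0" using C disc_area_nonneg by (simp add: A_def)
    \<comment> \<open>The order of choices matters: l makes the error term small, then R, depending
      on l, makes the energy divided by l small, and only then does w approach \<zeta>. The summand
      1 keeps the denominator positive.\<close>
    define l where "l = e / 4 / (A + 1)"
    have l: "l > 0" "l * A \<le> e / 4"
      using e A by (auto simp: l_def field_simps)
    have "\<forall>\<^sub>F n in sequentially. (LINT z:\<Omega> \<inter> ball \<zeta> (1 / real (Suc n))|lborel. (cmod (\<phi> z))\<^sup>2) < l * (e / 4)"
      using small_ball_energy[of \<phi> \<zeta>] \<phi>2 l e by (intro order_tendstoD) (auto simp: L2_on_def)
    then obtain n where n: "(LINT z:\<Omega> \<inter> ball \<zeta> (1 / real (Suc n))|lborel. (cmod (\<phi> z))\<^sup>2) < l * (e / 4)"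
      unfolding eventually_sequentially by blast
    define R where "R = 1 / real (Suc n)"
    have R: "R > 0" by (simp add: R_def)
    let ?L = "LINT z:\<Omega>|lborel. cmod (\<phi> z)"
    have dist0: "((\<lambda>w. dist w \<zeta>) \<longlongrightarrow> 0) ?F"
      using tendsto_dist[OF tendsto_ident_at tendsto_const[of \<zeta>], of \<zeta> \<Omega>] by simp
    have "((\<lambda>w. sqrt (8 * approx_const * dist w \<zeta> / R ^ 3) * ?L + (dist w \<zeta>)\<^sup>2 * bump_mass) \<longlongrightarrow>
       sqrt (8 * approx_const * 0 / R ^ 3) * ?L + 0\<^sup>2 * bump_mass) ?F"
      by (intro tendsto_intros dist0) (use R in auto)
    then have ev1: "\<forall>\<^sub>F w in ?F. sqrt (8 * approx_const * dist w \<zeta> / R ^ 3) * ?L + (dist w \<zeta>)\<^sup>2 * bump_mass < e / 4"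
      using e by (intro order_tendstoD) auto
    have ev2: "\<forall>\<^sub>F w in ?F. dist w \<zeta> < min R \<rho> / 8"
      using R \<rho> by (intro order_tendstoD[OF dist0]) auto
    have ev3: "\<forall>\<^sub>F w in ?F. w \<in> \<Omega>"
      by (simp add: eventually_at_filter)
    show "\<forall>\<^sub>F w in ?F. dist (?P w) 0 < e"
      using ev1 ev2 ev3
    proof eventually_elim
      case (elim w)
      have "cmod (?P w) \<le> (LINT z:\<Omega> \<inter> ball \<zeta> R|lborel. (cmod (\<phi> z))\<^sup>2) / l + l * A
         + sqrt (8 * approx_const * dist w \<zeta> / R ^ 3) * ?L + (dist w \<zeta>)\<^sup>2 * bump_mass"
        unfolding A_def \<phi>_def
        by (rule pot_reg_bound[OF proj elim(3) \<zeta>O R _ _ l(1)]) (use elim in auto)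
      moreover have "(LINT z:\<Omega> \<inter> ball \<zeta> R|lborel. (cmod (\<phi> z))\<^sup>2) / l < e / 4"
        using n l by (simp add: R_def pos_divide_less_eq mult.commute)
      ultimately have "cmod (?P w) < e"
        using l elim e by linarith
      then show ?case by simp
    qed
  qed
  then have "((\<lambda>w. of_real ((cmod w)\<^sup>2) - ?P w / of_real bump_mass) \<longlongrightarrow>
      of_real ((cmod \<zeta>)\<^sup>2) - 0 / of_real bump_mass) ?F"
    using bump_mass_pos by (intro tendsto_intros) auto
  then show ?thesis
    unfolding hpot_def[abs_def] by simp
qed

end

section \<open>From harmonic solutions to the projection\<close>

text \<open>\<open>C\<^sup>1\<close> truncations of the identity on the negative half-line, vanishing near \<open>0\<close>.\<close>

definition trunc :: "real \<Rightarrow> real \<Rightarrow> real" where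
  "trunc \<epsilon> t = (max 0 (- t - \<epsilon>))\<^sup>2 / t"

definition trunc' :: "real \<Rightarrow> real \<Rightarrow> real" where
  "trunc' \<epsilon> t = 1 - (\<epsilon> / max \<epsilon> (- t))\<^sup>2"

text \<open>For t < -\<epsilon> the truncation is t + 2 \<epsilon> + \<epsilon>^2 / t, with
  derivative 1 - (\<epsilon> / t)^2; this is 0 at t = -\<epsilon>, where the zero piece
  begins.\<close>

lemma DERIV_trunc:
  assumes "\<epsilon> > 0" "t < 0"
  shows "(trunc \<epsilon> has_real_derivative trunc' \<epsilon> t) (at t)"
proof -
  define m where "m = max 0 (- t - \<epsilon>)"
  have "((\<lambda>t. (max 0 (- t - \<epsilon>))\<^sup>2) has_real_derivative 2 * m * (- 1)) (at t)"
    unfolding m_def by (rule DERIV_chain2[OF DERIV_max_sq]) (auto intro!: derivative_eq_intros)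
  from DERIV_divide[OF this DERIV_ident] assms(2)
  have "(trunc \<epsilon> has_real_derivative (2 * m * (- 1) * t - m\<^sup>2 * 1) / (t * t)) (at t)"
    by (simp add: trunc_def[abs_def] m_def)
  moreover have "(2 * m * (- 1) * t - m\<^sup>2 * 1) / (t * t) = trunc' \<epsilon> t"
  proof (cases "t < - \<epsilon>")
    case True
    then have m: "m = - t - \<epsilon>" and max: "max \<epsilon> (- t) = - t" by (auto simp: m_def)
    show ?thesis
      unfolding trunc'_def max m using assms by (simp add: power_divide field_simps power2_eq_square)
  next
    case False
    then have "m = 0" "max \<epsilon> (- t) = \<epsilon>" by (auto simp: m_def)
    then show ?thesis
      using assms by (simp add: trunc'_def)
  qed
  ultimately show ?thesis by simp
qed

lemma trunc_eq_0: "- t < \<epsilon> \<Longrightarrow> trunc \<epsilon> t = 0"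
  by (simp add: trunc_def)

lemma trunc'_eq_0: "\<epsilon> > 0 \<Longrightarrow> - t < \<epsilon> \<Longrightarrow> trunc' \<epsilon> t = 0"
  by (simp add: trunc'_def)

lemma trunc'_bounds:
  assumes "\<epsilon> > 0"
  shows "0 \<le> trunc' \<epsilon> t" "trunc' \<epsilon> t \<le> 1"
proof -
  have "\<epsilon> / max \<epsilon> (- t) \<le> 1" "0 \<le> \<epsilon> / max \<epsilon> (- t)"
    using assms by (auto simp: max_def divide_simps)
  then have "(\<epsilon> / max \<epsilon> (- t))\<^sup>2 \<le> 1"
    by (simp add: power_le_one)
  then show "0 \<le> trunc' \<epsilon> t" "trunc' \<epsilon> t \<le> 1"
    by (simp_all add: trunc'_def)
qed

lemma trunc_bounds:
  assumes "\<epsilon> > 0" "t < 0"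
  shows "- trunc \<epsilon> t \<le> - t"
proof -
  have "(max 0 (- t - \<epsilon>))\<^sup>2 \<le> (- t)\<^sup>2"
    using assms by (intro power_mono) auto
  then have "(max 0 (- t - \<epsilon>))\<^sup>2 / (- t) \<le> (- t)\<^sup>2 / (- t)"
    using assms by (intro divide_right_mono) auto
  then show ?thesis
    using assms by (simp add: trunc_def power2_eq_square)
qed

lemma continuous_on_trunc':
  "\<epsilon> > 0 \<Longrightarrow> continuous_on S u \<Longrightarrow> continuous_on S (\<lambda>z. trunc' \<epsilon> (u z))"
  unfolding trunc'_def by (intro continuous_intros) (auto simp: max_def)

lemma trunc'_tendsto:
  assumes "t < 0"
  shows "(\<lambda>n. trunc' (1 / real (Suc n)) t) \<longlonglongrightarrow> 1"
proof -
  have "(\<lambda>n. 1 / real (Suc n)) \<longlonglongrightarrow> 0"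
    using LIMSEQ_inverse_real_of_nat by (simp add: inverse_eq_divide)
  then have "(\<lambda>n. 1 - ((1 / real (Suc n)) / max (1 / real (Suc n)) (- t))\<^sup>2) \<longlonglongrightarrow> 1 - (0 / max 0 (- t))\<^sup>2"
    using assms by (intro tendsto_intros) auto
  then show ?thesis by (simp add: trunc'_def)
qed

section \<open>The function |z|^2 - h and its truncated energies\<close>

locale harmonic_solution = bounded_domain +
  fixes f :: "complex \<Rightarrow> complex" and h :: "complex \<Rightarrow> real"
  assumes prim: "primitive_plus_conjugate \<Omega> f h"
    and bv: "has_boundary_values \<Omega> h (\<lambda>z. (cmod z)\<^sup>2)"
begin

definition u :: "complex \<Rightarrow> real" where "u z = (cmod z)\<^sup>2 - h z"
definition \<phi> :: "complex \<Rightarrow> complex" where "\<phi> z = cnj z - f z"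

lemma local_primitive:
  assumes "z \<in> \<Omega>"
  shows "\<exists>r F. r > 0 \<and> ball z r \<subseteq> \<Omega> \<and> (\<forall>w\<in>ball z r. (F has_field_derivative f w) (at w) \<and>
    complex_of_real (h w) = F w + cnj (F w))"
  using prim assms unfolding primitive_plus_conjugate_def by blast

lemma holomorphic_f: "f holomorphic_on \<Omega>"
  unfolding holomorphic_on_open[OF open_\<Omega>]
proof
  fix z assume "z \<in> \<Omega>"
  from local_primitive[OF this] obtain r F where r: "r > 0"
    and FH: "\<forall>w\<in>ball z r. (F has_field_derivative f w) (at w) \<and> complex_of_real (h w) = F w + cnj (F w)"
    by blast
  note F = bspec[OF FH, THEN conjunct1]
  have "F holomorphic_on ball z r"
    using F holomorphic_on_open by blast
  then have "deriv F holomorphic_on ball z r"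
    by (intro holomorphic_deriv) auto
  then have "f holomorphic_on ball z r"
    by (rule holomorphic_transform) (rule DERIV_imp_deriv[OF F])
  then show "\<exists>f'. (f has_field_derivative f') (at z)"
    using r holomorphic_on_open[OF open_ball] by (metis centre_in_ball)
qed

lemma wirtinger_u: "z \<in> \<Omega> \<Longrightarrow> wirtinger (\<lambda>z. of_real (u z)) (\<phi> z) (cnj (\<phi> z)) z"
proof -
  assume "z \<in> \<Omega>"
  from local_primitive[OF this] obtain r F where r: "r > 0"
    and FH: "\<forall>w\<in>ball z r. (F has_field_derivative f w) (at w) \<and> complex_of_real (h w) = F w + cnj (F w)"
    by blast
  note F = bspec[OF FH, THEN conjunct1] and h = bspec[OF FH, THEN conjunct2]
  have z: "z \<in> ball z r" using r by simp
  have "wirtinger (\<lambda>w. of_real ((cmod w)\<^sup>2) - (F w + cnj (F w)))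
      (cnj z - (f z + cnj 0)) (z - (0 + cnj (f z))) z"
    by (intro wirtinger_diff wirtinger_norm_sq wirtinger_add wirtinger_cnj wirtinger_DERIV F z)
  then have "wirtinger (\<lambda>z. of_real (u z)) (cnj z - (f z + cnj 0)) (z - (0 + cnj (f z))) z"
    by (rule wirtinger_transform_open[OF _ open_ball z]) (simp add: u_def flip: h)
  then show ?thesis by (simp add: \<phi>_def)
qed

lemma wirtinger_\<phi>: "z \<in> \<Omega> \<Longrightarrow> wirtinger \<phi> (- deriv f z) 1 z"
  using wirtinger_diff[OF wirtinger_cnj_ident wirtinger_DERIV[OF holomorphic_derivI[OF holomorphic_f open_\<Omega>]]]
  by (simp add: \<phi>_def[abs_def])

lemma continuous_\<phi>: "continuous_on \<Omega> \<phi>"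
  unfolding \<phi>_def by (intro continuous_intros holomorphic_on_imp_continuous_on holomorphic_f)

lemma continuous_u: "continuous_on \<Omega> u"
proof -
  have "continuous_on \<Omega> (\<lambda>z. complex_of_real (u z))"
    by (intro continuous_at_imp_continuous_on ballI wirtinger_continuous[OF wirtinger_u])
  from continuous_on_Re[OF this] show ?thesis by simp
qed

lemma u_boundary: "\<zeta> \<in> frontier \<Omega> \<Longrightarrow> (u \<longlongrightarrow> 0) (at \<zeta> within \<Omega>)"
proof -
  assume \<zeta>: "\<zeta> \<in> frontier \<Omega>"
  have "((\<lambda>z. (cmod z)\<^sup>2 - h z) \<longlongrightarrow> (cmod \<zeta>)\<^sup>2 - (cmod \<zeta>)\<^sup>2) (at \<zeta> within \<Omega>)"
    using bv \<zeta> unfolding has_boundary_values_def by (intro tendsto_intros) auto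
  then show ?thesis by (simp add: u_def[abs_def])
qed

lemma u_local:
  assumes "z \<in> \<Omega>"
  shows "\<exists>r>0. \<exists>Q. ball z r \<subseteq> \<Omega> \<and> Q holomorphic_on ball z r \<and>
       (\<forall>w\<in>ball z r. u w = Re (Q w) + 1 * (cmod (w - z))\<^sup>2)"
proof -
  from local_primitive[OF assms] obtain r F where r: "r > 0" "ball z r \<subseteq> \<Omega>"
    and FH: "\<forall>w\<in>ball z r. (F has_field_derivative f w) (at w) \<and> complex_of_real (h w) = F w + cnj (F w)"
    by blast
  note F = bspec[OF FH, THEN conjunct1] and h = bspec[OF FH, THEN conjunct2]
  have hF: "F holomorphic_on ball z r"
    using F holomorphic_on_open by blast
  \<comment> \<open>From |w|^2 = |z|^2 + 2 Re (cnj z (w - z)) + |w - z|^2: what is left after the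
    last term is harmonic, and the maximum principle applies with c = 1.\<close>
  define Q where "Q = (\<lambda>w. of_real ((cmod z)\<^sup>2) + 2 * cnj z * (w - z) - 2 * F w)"
  have "Q holomorphic_on ball z r"
    unfolding Q_def by (intro holomorphic_intros hF)
  moreover have "u w = Re (Q w) + 1 * (cmod (w - z))\<^sup>2" if w: "w \<in> ball z r" for w
  proof -
    have "h w = 2 * Re (F w)"
      using arg_cong[OF h[OF w], of Re] by simp
    then show ?thesis
      unfolding u_def Q_def cmod_power2 by (simp add: power2_eq_square algebra_simps)
  qed
  ultimately show ?thesis using r by blast
qed

text \<open>Strictness allows u to be composed with \<open>trunc\<close>, which divides by its
  argument. At an interior zero the harmonic part Re Q would attain its maximum, hence be constant,
  and u would equal |w - z|^2 > 0 at nearby points.\<close>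

lemma u_neg: "z \<in> \<Omega> \<Longrightarrow> u z < 0"
proof -
  assume z: "z \<in> \<Omega>"
  have le: "u x \<le> 0" if "x \<in> \<Omega>" for x
    by (rule maximum_principle[OF continuous_u u_boundary _ u_local that]) auto
  have "u z \<noteq> 0"
  proof
    assume 0: "u z = 0"
    obtain r Q where r: "r > 0" "ball z r \<subseteq> \<Omega>" and Q: "Q holomorphic_on ball z r"
      and uQ: "\<And>w. w \<in> ball z r \<Longrightarrow> u w = Re (Q w) + 1 * (cmod (w - z))\<^sup>2"
      using u_local[OF z] by blast
    have Qz: "Re (Q z) = 0" using uQ[of z] r 0 by simp
    have max: "Re (Q w) \<le> Re (Q z)" if "w \<in> ball z r" for w
      using uQ[OF that] le[OF subsetD[OF r(2) that]] Qz zero_le_power2[of "cmod (w - z)"] by linarith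
    define w where "w = z + of_real (r / 2)"
    have w: "w \<in> ball z r"
      using r by (simp add: w_def dist_norm)
    have "u w = (cmod (w - z))\<^sup>2"
      using uQ[OF w] Re_holomorphic_max_const[OF Q max w] Qz by simp
    also have "\<dots> > 0" using r by (simp add: w_def)
    finally show False using le[of w] w r by auto
  qed
  with le[OF z] show ?thesis by simp
qed

lemma compact_sublevel: "\<epsilon> > 0 \<Longrightarrow> compact {z \<in> \<Omega>. - u z \<ge> \<epsilon>}"
proof (rule compact_superlevel)
  show "continuous_on \<Omega> (\<lambda>z. - u z)"
    by (intro continuous_intros continuous_u)
  show "((\<lambda>z. - u z) \<longlongrightarrow> 0) (at \<zeta> within \<Omega>)" if "\<zeta> \<in> frontier \<Omega>" for \<zeta>
    using tendsto_minus[OF u_boundary[OF that]] by simp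
qed

lemma u_bounded: "\<exists>M. \<forall>z\<in>\<Omega>. - u z \<le> M"
proof -
  let ?K = "{z \<in> \<Omega>. - u z \<ge> 1}"
  have "compact (u ` ?K)"
    by (rule compact_continuous_image[OF continuous_on_subset[OF continuous_u] compact_sublevel]) auto
  then have "bounded (u ` ?K)"
    by (rule compact_imp_bounded)
  then obtain M where M: "\<And>z. z \<in> ?K \<Longrightarrow> \<bar>u z\<bar> \<le> M"
    by (auto simp: bounded_iff)
  have "- u z \<le> max M 1" if "z \<in> \<Omega>" for z
  proof (cases "z \<in> ?K")
    case True
    then show ?thesis using M[OF True] by linarith
  next
    case False
    then have "- u z \<le> 1" using that by auto
    then show ?thesis by simp
  qed
  then show ?thesis by blast
qed

lemma wirtinger_trunc_u:
  assumes "\<epsilon> > 0" "z \<in> \<Omega>"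
  shows "wirtinger (\<lambda>z. of_real (trunc \<epsilon> (u z))) (of_real (trunc' \<epsilon> (u z)) * \<phi> z)
      (of_real (trunc' \<epsilon> (u z)) * cnj (\<phi> z)) z"
  by (rule wirtinger_real_compose[OF wirtinger_u DERIV_trunc]) (use assms u_neg in auto)

lemma continuous_trunc_u:
  assumes "\<epsilon> > 0"
  shows "continuous_on \<Omega> (\<lambda>z. trunc \<epsilon> (u z))"
proof -
  have "continuous_on \<Omega> (\<lambda>z. complex_of_real (trunc \<epsilon> (u z)))"
    by (intro continuous_at_imp_continuous_on ballI wirtinger_continuous[OF wirtinger_trunc_u] assms)
  from continuous_on_Re[OF this] show ?thesis by simp
qed

text \<open>Green's formula with the test function \<open>trunc \<epsilon> u\<close>.\<close>

lemma truncated_energy: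
  assumes \<epsilon>: "\<epsilon> > 0"
  shows "set_integrable lborel \<Omega> (\<lambda>z. trunc' \<epsilon> (u z) * (cmod (\<phi> z))\<^sup>2)"
    and "(LINT z:\<Omega>|lborel. trunc' \<epsilon> (u z) * (cmod (\<phi> z))\<^sup>2) = (LINT z:\<Omega>|lborel. - trunc \<epsilon> (u z))"
proof -
  let ?K = "{z \<in> \<Omega>. - u z \<ge> \<epsilon>}"
  let ?t = "\<lambda>z. trunc \<epsilon> (u z)" and ?t' = "\<lambda>z. trunc' \<epsilon> (u z)"
  have K: "compact ?K" "?K \<subseteq> \<Omega>"
    using compact_sublevel[OF \<epsilon>] by auto
  have ct: "continuous_on \<Omega> ?t" "continuous_on \<Omega> ?t'"
    by (rule continuous_trunc_u[OF \<epsilon>], rule continuous_on_trunc'[OF \<epsilon> continuous_u])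
  have I: "set_integrable lborel \<Omega> (\<lambda>z. ?t' z * (cmod (\<phi> z))\<^sup>2)"
    by (rule set_integrable_continuous_compact_support[OF _ K])
       (use \<epsilon> in \<open>auto intro!: continuous_intros ct continuous_\<phi> simp: trunc'_eq_0\<close>)
  have J: "set_integrable lborel \<Omega> ?t"
    by (rule set_integrable_continuous_compact_support[OF _ K])
       (auto intro!: ct simp: trunc_eq_0)
  \<comment> \<open>The derivative in cnj z of \<open>trunc \<epsilon> (u z) * \<phi> z\<close>: the
    derivative of u is cnj \<phi>, which gives the energy, and that of \<phi> is 1, which gives the
    truncation itself.\<close>
  have "(LINT z:\<Omega>|lborel. of_real (?t' z) * cnj (\<phi> z) * \<phi> z + of_real (?t z) * 1) = 0"
  proof (rule conjunct2[OF divergence_theorem_on[OF open_\<Omega>]])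
    show "wirtinger (\<lambda>z. of_real (?t z) * \<phi> z)
       ((of_real (?t' z) * \<phi> z) * \<phi> z + of_real (?t z) * (- deriv f z))
       ((of_real (?t' z) * cnj (\<phi> z)) * \<phi> z + of_real (?t z) * 1) z" if "z \<in> \<Omega>" for z
      by (intro wirtinger_mult wirtinger_trunc_u wirtinger_\<phi> \<epsilon> that)
    show "continuous_on \<Omega> (\<lambda>z. (of_real (?t' z) * \<phi> z) * \<phi> z + of_real (?t z) * (- deriv f z))"
      by (intro continuous_intros ct continuous_\<phi> holomorphic_on_imp_continuous_on
          holomorphic_deriv holomorphic_f open_\<Omega>)
    show "continuous_on \<Omega> (\<lambda>z. (of_real (?t' z) * cnj (\<phi> z)) * \<phi> z + of_real (?t z) * 1)"
      by (intro continuous_intros ct continuous_\<phi>)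
    show "of_real (?t z) * \<phi> z = 0" if "z \<in> \<Omega> - ?K" for z
    proof -
      have "- u z < \<epsilon>" using that by auto
      then show ?thesis by (simp add: trunc_eq_0)
    qed
  qed (rule K)+
  also have "(\<lambda>z. of_real (?t' z) * cnj (\<phi> z) * \<phi> z + of_real (?t z) * 1) =
      (\<lambda>z. complex_of_real (?t' z * (cmod (\<phi> z))\<^sup>2 + ?t z))"
    by (simp only: of_real_mult of_real_add complex_norm_square mult.assoc mult.commute[of "cnj _"] mult_1_right)
  finally have "complex_of_real (LINT z:\<Omega>|lborel. ?t' z * (cmod (\<phi> z))\<^sup>2 + ?t z) = 0"
    by (simp only: set_integral_complex_of_real)
  then have "(LINT z:\<Omega>|lborel. ?t' z * (cmod (\<phi> z))\<^sup>2 + ?t z) = 0"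
    by (simp only: of_real_eq_0_iff)
  then show "(LINT z:\<Omega>|lborel. ?t' z * (cmod (\<phi> z))\<^sup>2) = (LINT z:\<Omega>|lborel. - ?t z)"
    unfolding set_integral_add(2)[OF I J] set_integral_uminus[OF J] by simp
  show "set_integrable lborel \<Omega> (\<lambda>z. ?t' z * (cmod (\<phi> z))\<^sup>2)"
    by (rule I)
qed

text \<open>The truncated energies equal the integrals of -\<open>trunc\<close>, hence are at most
  those of -u \<le> M over a set of finite area. The bound does not depend on the truncation, and
  Fatou's lemma passes to the limit.\<close>

lemma \<phi>_L2: "\<phi> \<in> L2_on \<Omega>"
proof -
  obtain M where M: "\<And>z. z \<in> \<Omega> \<Longrightarrow> - u z \<le> M"
    using u_bounded by blast
  let ?e = "\<lambda>n. 1 / real (Suc n)"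
  let ?f = "\<lambda>n z. indicat_real \<Omega> z *\<^sub>R (trunc' (?e n) (u z) * (cmod (\<phi> z))\<^sup>2)"
  have iM: "set_integrable lborel \<Omega> (\<lambda>z. M)"
    by (rule set_integrable_bounded[of _ "\<bar>M\<bar>"])
       (auto intro: set_borel_measurable_continuous)
  define C where "C = (LINT z:\<Omega>|lborel. M)"
  have int: "integrable lborel (?f n)" and le: "integral\<^sup>L lborel (?f n) \<le> C" for n
  proof -
    have e: "?e n > 0" by simp
    show "integrable lborel (?f n)"
      using truncated_energy(1)[OF e] by (simp only: set_integrable_def)
    have "set_integrable lborel \<Omega> (\<lambda>z. - trunc (?e n) (u z))"
      by (rule set_integrable_continuous_compact_support[OF _ compact_sublevel[OF e]])
         (auto intro!: continuous_intros continuous_trunc_u simp: trunc_eq_0)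
    then have "(LINT z:\<Omega>|lborel. - trunc (?e n) (u z)) \<le> C"
      unfolding C_def
    proof (rule set_integral_mono[OF _ iM])
      show "- trunc (?e n) (u z) \<le> M" if "z \<in> \<Omega>" for z
        using trunc_bounds[OF e u_neg[OF that]] M[OF that] by linarith
    qed
    then show "integral\<^sup>L lborel (?f n) \<le> C"
      using truncated_energy(2)[OF e] by (simp only: set_lebesgue_integral_def)
  qed
  have f0: "?f n z \<ge> 0" for n z
    using trunc'_bounds(1)[of "?e n" "u z"] by (simp add: indicator_def)
  have lim: "(\<lambda>n. ?f n z) \<longlonglongrightarrow> indicat_real \<Omega> z *\<^sub>R (cmod (\<phi> z))\<^sup>2" for z
  proof (cases "z \<in> \<Omega>")
    case True
    have "(\<lambda>n. trunc' (?e n) (u z) * (cmod (\<phi> z))\<^sup>2) \<longlonglongrightarrow> 1 * (cmod (\<phi> z))\<^sup>2"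
      by (intro tendsto_intros trunc'_tendsto u_neg True)
    then show ?thesis using True by simp
  qed simp
  have m: "set_borel_measurable lborel \<Omega> (\<lambda>z. (cmod (\<phi> z))\<^sup>2)"
    by (rule set_borel_measurable_continuous) (intro continuous_intros continuous_\<phi>)
  have "(\<integral>\<^sup>+z. ennreal (indicat_real \<Omega> z *\<^sub>R (cmod (\<phi> z))\<^sup>2) \<partial>lborel)
     = (\<integral>\<^sup>+z. liminf (\<lambda>n. ennreal (?f n z)) \<partial>lborel)"
  proof (rule nn_integral_cong)
    fix z
    have "(\<lambda>n. ennreal (?f n z)) \<longlonglongrightarrow> ennreal (indicat_real \<Omega> z *\<^sub>R (cmod (\<phi> z))\<^sup>2)"
      by (rule tendsto_ennrealI[OF lim])
    from lim_imp_Liminf[OF sequentially_bot this]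
    show "ennreal (indicat_real \<Omega> z *\<^sub>R (cmod (\<phi> z))\<^sup>2) = liminf (\<lambda>n. ennreal (?f n z))" ..
  qed
  also have "\<dots> \<le> liminf (\<lambda>n. \<integral>\<^sup>+z. ennreal (?f n z) \<partial>lborel)"
    by (rule nn_integral_liminf) (use int in \<open>auto intro!: measurable_compose[OF _ measurable_ennreal]\<close>)
  also have "\<dots> \<le> liminf (\<lambda>n. ennreal C)"
  proof (intro Liminf_mono always_eventually allI)
    fix n
    have "(\<integral>\<^sup>+z. ennreal (?f n z) \<partial>lborel) = ennreal (integral\<^sup>L lborel (?f n))"
      by (rule nn_integral_eq_integral[OF int]) (use f0 in auto)
    then show "(\<integral>\<^sup>+z. ennreal (?f n z) \<partial>lborel) \<le> ennreal C"
      using le[of n] by (simp only: ennreal_leI)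
  qed
  also have "\<dots> = ennreal C"
    by (simp add: Liminf_const)
  also have "\<dots> < \<infinity>" by simp
  finally have "integrable lborel (\<lambda>z. indicat_real \<Omega> z *\<^sub>R (cmod (\<phi> z))\<^sup>2)"
    using m by (intro integrableI_nonneg) (auto simp: set_borel_measurable_def)
  then show ?thesis
    using set_borel_measurable_continuous[OF continuous_\<phi>] by (simp add: L2_on_def set_integrable_def)
qed

text \<open>Since cnj g has no derivative in z, that of
  \<open>trunc \<epsilon> (u z) * cnj (g z)\<close> is \<open>trunc'\<close> times \<phi> cnj g,
  with integral 0. Membership of \<phi> in L^2 makes |\<phi> cnj g| an integrable majorant as
  \<epsilon> tends to 0.\<close>

lemma \<phi>_orthogonal:
  assumes g: "g \<in> bergman_space \<Omega>"
  shows "L2_inner \<Omega> \<phi> g = 0"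
proof -
  have hg: "g holomorphic_on \<Omega>" and g2: "g \<in> L2_on \<Omega>"
    using g by (auto simp: bergman_space_def)
  have cg: "continuous_on \<Omega> g"
    using hg by (rule holomorphic_on_imp_continuous_on)
  let ?e = "\<lambda>n. 1 / real (Suc n)"
  let ?s = "\<lambda>n z. indicat_real \<Omega> z *\<^sub>R (of_real (trunc' (?e n) (u z)) * \<phi> z * cnj (g z))"
  have zero: "(LINT z:\<Omega>|lborel. of_real (trunc' \<epsilon> (u z)) * \<phi> z * cnj (g z)) = 0" if \<epsilon>: "\<epsilon> > 0" for \<epsilon>
  proof -
    let ?K = "{z \<in> \<Omega>. - u z \<ge> \<epsilon>}"
    let ?t = "\<lambda>z. trunc \<epsilon> (u z)" and ?t' = "\<lambda>z. trunc' \<epsilon> (u z)"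
    have K: "compact ?K" "?K \<subseteq> \<Omega>"
      using compact_sublevel[OF \<epsilon>] by auto
    have ct: "continuous_on \<Omega> ?t" "continuous_on \<Omega> ?t'"
      by (rule continuous_trunc_u[OF \<epsilon>], rule continuous_on_trunc'[OF \<epsilon> continuous_u])
    have "(LINT z:\<Omega>|lborel. (of_real (?t' z) * \<phi> z) * cnj (g z) + of_real (?t z) * cnj 0) = 0"
    proof (rule conjunct1[OF divergence_theorem_on[OF open_\<Omega>]])
      show "wirtinger (\<lambda>z. of_real (?t z) * cnj (g z))
         ((of_real (?t' z) * \<phi> z) * cnj (g z) + of_real (?t z) * cnj 0)
         ((of_real (?t' z) * cnj (\<phi> z)) * cnj (g z) + of_real (?t z) * cnj (deriv g z)) z" if "z \<in> \<Omega>" for z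
        by (intro wirtinger_mult wirtinger_trunc_u wirtinger_cnj wirtinger_DERIV
            holomorphic_derivI[OF hg open_\<Omega>] \<epsilon> that)
      show "continuous_on \<Omega> (\<lambda>z. (of_real (?t' z) * \<phi> z) * cnj (g z) + of_real (?t z) * cnj 0)"
        by (intro continuous_intros ct continuous_\<phi> cg)
      show "continuous_on \<Omega> (\<lambda>z. (of_real (?t' z) * cnj (\<phi> z)) * cnj (g z) + of_real (?t z) * cnj (deriv g z))"
        by (intro continuous_intros ct continuous_\<phi> cg holomorphic_on_imp_continuous_on[OF holomorphic_deriv[OF hg open_\<Omega>]])
      show "of_real (?t z) * cnj (g z) = 0" if "z \<in> \<Omega> - ?K" for z
      proof -
        have "- u z < \<epsilon>" using that by auto
        then show ?thesis by (simp add: trunc_eq_0)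
      qed
    qed (rule K)+
    then show ?thesis by simp
  qed
  have cgL2: "(\<lambda>z. cnj (g z)) \<in> L2_on \<Omega>"
    using g2 set_borel_measurable_continuous[OF continuous_on_cnj[OF cg]] by (simp add: L2_on_def)
  have I: "integrable lborel (\<lambda>z. indicat_real \<Omega> z *\<^sub>R (\<phi> z * cnj (g z)))"
    using L2_times_L2[OF \<phi>_L2 cgL2] by (simp only: set_integrable_def)
  have "(\<lambda>n. integral\<^sup>L lborel (?s n)) \<longlonglongrightarrow> integral\<^sup>L lborel (\<lambda>z. indicat_real \<Omega> z *\<^sub>R (\<phi> z * cnj (g z)))"
  proof (rule integral_dominated_convergence)
    show "(\<lambda>z. indicat_real \<Omega> z *\<^sub>R (\<phi> z * cnj (g z))) \<in> borel_measurable lborel"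
      using I by (rule borel_measurable_integrable)
    show "integrable lborel (\<lambda>z. cmod (indicat_real \<Omega> z *\<^sub>R (\<phi> z * cnj (g z))))"
      by (rule integrable_norm[OF I])
    have "continuous_on \<Omega> (\<lambda>z. of_real (trunc' (?e n) (u z)) * \<phi> z * cnj (g z))" for n
      by (intro continuous_intros continuous_on_trunc' continuous_u continuous_\<phi> cg) simp
    from set_borel_measurable_continuous[OF this]
    show "?s n \<in> borel_measurable lborel" for n
      by (simp only: set_borel_measurable_def)
    have "(\<lambda>n. ?s n z) \<longlonglongrightarrow> indicat_real \<Omega> z *\<^sub>R (\<phi> z * cnj (g z))" for z
    proof (cases "z \<in> \<Omega>")
      case True
      have "(\<lambda>n. of_real (trunc' (?e n) (u z)) * \<phi> z * cnj (g z)) \<longlonglongrightarrow> of_real 1 * \<phi> z * cnj (g z)"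
        by (intro tendsto_intros trunc'_tendsto u_neg True)
      then show ?thesis using True by simp
    qed simp
    then show "AE z in lborel. (\<lambda>n. ?s n z) \<longlonglongrightarrow> indicat_real \<Omega> z *\<^sub>R (\<phi> z * cnj (g z))"
      by (rule AE_I2)
    have "norm (?s n z) \<le> cmod (indicat_real \<Omega> z *\<^sub>R (\<phi> z * cnj (g z)))" for n z
    proof -
      have "\<bar>trunc' (?e n) (u z)\<bar> \<le> 1"
        using trunc'_bounds[of "?e n" "u z"] by simp
      then have "\<bar>trunc' (?e n) (u z)\<bar> * (cmod (\<phi> z) * cmod (g z)) \<le> 1 * (cmod (\<phi> z) * cmod (g z))"
        by (rule mult_right_mono) simp
      then show ?thesis
        by (simp add: norm_mult mult.assoc indicator_def)
    qed
    then show "AE z in lborel. norm (?s n z) \<le> cmod (indicat_real \<Omega> z *\<^sub>R (\<phi> z * cnj (g z)))" for n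
      by (rule AE_I2)
  qed
  moreover have "integral\<^sup>L lborel (?s n) = 0" for n
    using zero[of "?e n"] by (simp only: set_lebesgue_integral_def) simp
  ultimately have "integral\<^sup>L lborel (\<lambda>z. indicat_real \<Omega> z *\<^sub>R (\<phi> z * cnj (g z))) = 0"
    using LIMSEQ_unique[OF _ tendsto_const] by simp
  then show ?thesis
    by (simp only: L2_inner_def set_lebesgue_integral_def)
qed

lemma is_projection: "is_L2_projection \<Omega> (bergman_space \<Omega>) cnj f"
proof -
  have "(\<lambda>z. cnj z - \<phi> z) \<in> L2_on \<Omega>"
    by (rule L2_diff[OF cnj_in_L2 \<phi>_L2])
  then have "f \<in> bergman_space \<Omega>"
    using holomorphic_f by (simp add: bergman_space_def \<phi>_def)
  then show ?thesis
    using \<phi>_orthogonal cnj_in_L2 unfolding is_L2_projection_def \<phi>_def[abs_def] by blast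
qed

end

text \<open>In a component with two points a and b, every x is at distance at least |a - b| / 2 from
  one of them; a minimum over the finitely many components gives \<rho>.\<close>

lemma nondegenerate_components_uniform:
  fixes S :: "complex set"
  assumes fin: "finite (components S)" and nd: "\<And>p. {p} \<notin> components S"
  shows "\<exists>\<rho>>0. \<forall>x\<in>S. \<exists>K q. connected K \<and> K \<subseteq> S \<and> x \<in> K \<and> q \<in> K \<and> \<rho> \<le> dist x q"
proof -
  have "\<forall>K\<in>components S. \<exists>r. r > 0 \<and> (\<forall>x\<in>K. \<exists>q\<in>K. r \<le> dist x q)"
  proof
    fix K assume K: "K \<in> components S"
    obtain a where a: "a \<in> K"
      using in_components_nonempty[OF K] by blast
    have "K \<noteq> {a}" using nd K by blast
    then obtain b where b: "b \<in> K" "b \<noteq> a" using a by blast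
    have "dist a b / 2 \<le> dist x a \<or> dist a b / 2 \<le> dist x b" for x
      using dist_triangle2[of a b x] unfolding dist_commute[of a x] dist_commute[of b x] by linarith
    then show "\<exists>r. r > 0 \<and> (\<forall>x\<in>K. \<exists>q\<in>K. r \<le> dist x q)"
      using a b by (intro exI[of _ "dist a b / 2"]) auto
  qed
  from bchoice[OF this] obtain r
    where r: "\<forall>K\<in>components S. r K > 0 \<and> (\<forall>x\<in>K. \<exists>q\<in>K. r K \<le> dist x q)"
    by (elim exE)
  \<comment> \<open>The inserted 1 keeps the set nonempty, so that \<open>Min\<close> is meaningful
    for any number of components.\<close>
  define \<rho> where "\<rho> = Min (insert 1 (r ` components S))"
  have \<rho>: "\<rho> > 0" "\<And>K. K \<in> components S \<Longrightarrow> \<rho> \<le> r K"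
    using fin r by (auto simp: \<rho>_def)
  have "\<exists>K q. connected K \<and> K \<subseteq> S \<and> x \<in> K \<and> q \<in> K \<and> \<rho> \<le> dist x q" if "x \<in> S" for x
  proof -
    have "x \<in> \<Union>(components S)"
      using that by (simp add: Union_components)
    then obtain K where K: "K \<in> components S" "x \<in> K"
      by (rule UnionE)
    obtain q where "q \<in> K" "r K \<le> dist x q"
      using bspec[OF conjunct2[OF bspec[OF r K(1)]] K(2)] by (elim bexE)
    then show ?thesis
      using K \<rho>(2)[OF K(1)] in_components_connected[OF K(1)] in_components_subset[OF K(1)]
      by (intro exI[of _ K] exI[of _ q]) auto
  qed
  with \<rho>(1) show ?thesis by blast
qed

theorem theorem1:
  fixes \<Omega> :: "complex set" and f :: "complex \<Rightarrow> complex"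
  assumes "bounded_finitely_connected_domain \<Omega>"
    and nondegenerate: "\<And>p. {p} \<notin> components (- \<Omega>)"
  shows "is_L2_projection \<Omega> (bergman_space \<Omega>) cnj f \<longleftrightarrow>
         (\<exists>h. primitive_plus_conjugate \<Omega> f h \<and>
              has_boundary_values \<Omega> h (\<lambda>z. (cmod z)\<^sup>2))"
proof
  have \<Omega>: "open \<Omega>" "connected \<Omega>" "bounded \<Omega>" "finite (components (- \<Omega>))"
    using assms(1) by (auto simp: bounded_finitely_connected_domain_def)
  assume proj: "is_L2_projection \<Omega> (bergman_space \<Omega>) cnj f"
  obtain \<rho> where \<rho>: "\<rho> > 0"
    "\<forall>x\<in>- \<Omega>. \<exists>K q. connected K \<and> K \<subseteq> - \<Omega> \<and> x \<in> K \<and> q \<in> K \<and> \<rho> \<le> dist x q"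
    using nondegenerate_components_uniform[OF \<Omega>(4) nondegenerate] by blast
  obtain B where B: "\<And>z. z \<in> \<Omega> \<Longrightarrow> cmod z \<le> B"
    using \<Omega>(3) by (auto simp: bounded_iff)
  interpret nondegenerate_domain \<Omega> \<rho> B
  proof
    fix x assume "x \<notin> \<Omega>"
    then obtain K q where "connected K" "K \<subseteq> - \<Omega>" "x \<in> K" "q \<in> K" "\<rho> \<le> dist x q"
      using \<rho>(2) by blast
    then show "\<exists>K q. connected K \<and> K \<inter> \<Omega> = {} \<and> x \<in> K \<and> q \<in> K \<and> \<rho> \<le> dist x q"
      by (intro exI[of _ K] exI[of _ q]) auto
  qed (use \<Omega> \<rho> B in auto)
  have f: "f \<in> bergman_space \<Omega>"
    using proj by (simp add: is_L2_projection_def)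
  have lim: "(hpot f \<longlongrightarrow> of_real ((cmod \<zeta>)\<^sup>2)) (at \<zeta> within \<Omega>)" if "\<zeta> \<in> frontier \<Omega>" for \<zeta>
    by (rule hpot_boundary_values[OF proj that])
  have "primitive_plus_conjugate \<Omega> f (\<lambda>z. Re (hpot f z))"
    by (rule primitive_plus_conjugate_hpot[OF f hpot_real[OF f lim]])
  moreover have "has_boundary_values \<Omega> (\<lambda>z. Re (hpot f z)) (\<lambda>z. (cmod z)\<^sup>2)"
    unfolding has_boundary_values_def
  proof
    fix \<zeta> assume "\<zeta> \<in> frontier \<Omega>"
    from tendsto_Re[OF lim[OF this]]
    show "((\<lambda>z. Re (hpot f z)) \<longlongrightarrow> (cmod \<zeta>)\<^sup>2) (at \<zeta> within \<Omega>)"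
      by (simp only: Re_complex_of_real)
  qed
  ultimately show "\<exists>h. primitive_plus_conjugate \<Omega> f h \<and> has_boundary_values \<Omega> h (\<lambda>z. (cmod z)\<^sup>2)"
    by blast
next
  assume "\<exists>h. primitive_plus_conjugate \<Omega> f h \<and> has_boundary_values \<Omega> h (\<lambda>z. (cmod z)\<^sup>2)"
  then obtain h where h: "primitive_plus_conjugate \<Omega> f h" "has_boundary_values \<Omega> h (\<lambda>z. (cmod z)\<^sup>2)"
    by blast
  interpret harmonic_solution \<Omega> f h
    by unfold_locales (use assms(1) h in \<open>auto simp: bounded_finitely_connected_domain_def\<close>)
  show "is_L2_projection \<Omega> (bergman_space \<Omega>) cnj f"
    by (rule is_projection)
qed

end
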